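(* For a small quantaloid $\mathcal{Q}$, the following conditions are equivalent: (1) $\mathcal{Q}$ is locally localic, map-discrete, weakly tabular and weakly modular; (2) $F\colon \mathcal{R}(\mathrm{Map}(\mathcal{Q}))\to\mathcal{Q}$, given by the identity on objects and by $F(R)=\bigvee\{f\circ g^*\mid (f,g)\in R\}$ on arrows, is a full and locally left exact $\mathrm{Sup}$-functor; (3) putting, for each object $X$ of $\mathrm{Map}(\mathcal{Q})$, $$J(X):=\Big\{S \text{ is a sieve on } X \text{ in } \mathrm{Map}(\mathcal{Q})\ \Big|\ 1_X=\bigvee_{s\in S}s\circ s^*\Big\}$$ defines a Grothendieck topology $J$ on $\mathrm{Map}(\mathcal{Q})$ for which $\mathcal{Q}\cong\mathcal{R}(\mathrm{Map}(\mathcal{Q}),J)$; (4) $\mathcal{Q}$ is a small quantaloid of closed cribles. In this case, $\mathcal{Q}$ carries an involution, sending $q\colon Y\to X$ to $$q^{\circ}:=\bigvee\left\{g\circ f^*\ \Big|\ f\colon U\to X \text{ and } g\colon U\to Y \text{ are left adjoints in } \mathcal{Q} \text{ with common domain } U \text{ such that } f\circ g^*\leq q\right\},$$ which makes $\mathcal{Q}$ a modular quantaloid.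
   Context: A quantaloid $\mathcal{Q}$ is a category enriched in $\mathrm{Sup}$, the symmetric monoidal closed category of complete lattices and supremum-preserving functions: each hom $\mathcal{Q}(X,Y)$ is a complete lattice and composition preserves arbitrary suprema in each variable. It is small if it has a set of objects. A $\mathrm{Sup}$-functor is a functor preserving suprema of arrows locally (on homs); it is full if it is surjective on homs, and locally left exact if it preserves finite infima (including the empty one) of arrows in each hom. Equivalence ($\simeq$) and isomorphism ($\cong$) of quantaloids are meant in the $\mathrm{Sup}$-enriched sense. An arrow $f\colon X\to Y$ is a left adjoint if there is $f^*\colon Y\to X$ (its right adjoint) with $1_X\leq f^*f$ and $ff^*\leq 1_Y$; we write $gf$ for $g\circ f$. $\mathrm{Map}(\mathcal{Q})$ is the category with the objects of $\mathcal{Q}$ and the left adjoints of $\mathcal{Q}$ as arrows. Spans: in a category $\mathcal{C}$, a span $(f,g)$ from $X$ to $Y$ is a pair of arrows $f\colon U\to Y$, $g\colon U\to X$ with common domain $U$. (Note the convention: the first component lands in the target $Y$, the second in the source $X$.) A span of left adjoints in $\mathcal{Q}$ is a span in $\mathrm{Map}(\mathcal{Q})$. A quantaloid $\mathcal{Q}$ is: - locally localic if every $\mathcal{Q}(X,Y)$ is a locale; - map-discrete if for all left adjoints $f,g\colon X\to Y$, $f\leq g$ implies $f=g$; - weakly tabular if for every $q\colon X\to Y$, $q=\bigvee\{fg^*\mid (f,g)\text{ is a span of left adjoints from }X\text{ to }Y\text{ such that }fg^*\leq q\}$; - weakly modular if for every two spans of left adjoints $(f,g)$ and $(m,n)$ from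 $X$ to $Y$, $fg^*\wedge mn^*\leq f(g^*n\wedge f^*m)n^*$. An involution on $\mathcal{Q}$ is a $\mathrm{Sup}$-functor $(-)^{\circ}\colon\mathcal{Q}^{\mathrm{op}}\to\mathcal{Q}$ that is the identity on objects and satisfies $f^{\circ\circ}=f$. A quantaloid is modular if it is involutive and for all $f\colon X\to Y$, $g\colon Y\to Z$, $h\colon X\to Z$ one has $gf\wedge h\leq g(f\wedge g^{\circ}h)$. Cribles: for a small category $\mathcal{C}$, a crible $R$ from $X$ to $Y$ is a set of spans from $X$ to $Y$ such that $(f,g)\in R$ implies $(f\circ h,g\circ h)\in R$ for every $h$ with codomain $\mathrm{dom}(f)$. The quantaloid $\mathcal{R}(\mathcal{C})$ has the objects of $\mathcal{C}$ as objects and cribles as arrows; for $R\colon X\to Y$ and $S\colon Y\to Z$, $S\circ R$ consists of those $(f,g)$ for which there is $t$ in $\mathcal{C}$ with $(f,t)\in S$ and $(t,g)\in R$; the identity on $X$ is $\{(f,f)\mid \mathrm{cod}(f)=X\}$; suprema of arrows are unions. A nucleus $j$ on a quantaloid is a lax functor from it to itself which is the identity on objects and is a closure operator on each hom. The quantaloid $\mathcal{Q}_j$ has the same objects as $\mathcal{Q}$ and as arrows those $f$ with $j(f)=f$, with composition $j(g\circ f)$, identities $j(1_X)$, and suprema $j(\bigvee_i f_i)$. For a Grothendieck topology $J$ on a small category $\mathcal{C}$, a nucleus on $\mathcal{R}(\mathcal{C})$ is given, for a crible $R$ from $C$ to $D$, by $$j(R)=\{(f,g)\text{ a span from }C\text{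 to }D\mid \exists S\in J(\mathrm{dom}(f)):\ \forall s\in S,\ (f\circ s,g\circ s)\in R\},$$ and $\mathcal{R}(\mathcal{C},J):=\mathcal{R}(\mathcal{C})_j$. A small quantaloid of closed cribles is a small quantaloid equivalent to $\mathcal{R}(\mathcal{C},J)$ for some small site $(\mathcal{C},J)$. *)

theory Defs
  imports "HOL-Algebra.Complete_Lattice"
begin

section \<open>Small categories\<close>

text \<open>A small category is given by a set of objects and a single set of arrows with domain and
  codomain maps. \<^term>\<open>Comp C g f\<close> is the composite of \<^term>\<open>g\<close> after \<^term>\<open>f\<close>; it is only
  meaningful when the codomain of \<^term>\<open>f\<close> is the domain of \<^term>\<open>g\<close>.\<close>

record ('o, 'a) category =
  Ob :: "'o set"
  Arr :: "'a set"
  Dom :: "'a \<Rightarrow> 'o"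
  Cod :: "'a \<Rightarrow> 'o"
  Ident :: "'o \<Rightarrow> 'a"
  Comp :: "'a \<Rightarrow> 'a \<Rightarrow> 'a" (infixr \<open>\<cdot>\<index>\<close> 75)

definition Hom :: "('o, 'a, 'm) category_scheme \<Rightarrow> 'o \<Rightarrow> 'o \<Rightarrow> 'a set"
  where "Hom C X Y = {f \<in> Arr C. Dom C f = X \<and> Cod C f = Y}"

locale category =
  fixes C :: "('o, 'a, 'm) category_scheme" (structure)
  assumes Dom_in_Ob: "f \<in> Arr C \<Longrightarrow> Dom C f \<in> Ob C"
    and Cod_in_Ob: "f \<in> Arr C \<Longrightarrow> Cod C f \<in> Ob C"
    and Ident_in_Hom: "X \<in> Ob C \<Longrightarrow> Ident C X \<in> Hom C X X"
    and Comp_in_Hom: "f \<in> Hom C X Y \<Longrightarrow> g \<in> Hom C Y Z \<Longrightarrow> g \<cdot> f \<in> Hom C X Z"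
    and Comp_assoc: "f \<in> Hom C W X \<Longrightarrow> g \<in> Hom C X Y \<Longrightarrow> h \<in> Hom C Y Z \<Longrightarrow>
          (h \<cdot> g) \<cdot> f = h \<cdot> (g \<cdot> f)"
    and Comp_Ident_left: "f \<in> Hom C X Y \<Longrightarrow> Ident C Y \<cdot> f = f"
    and Comp_Ident_right: "f \<in> Hom C X Y \<Longrightarrow> f \<cdot> Ident C X = f"

locale category_functor = dom: category C + cod: category D
  for C :: "('o, 'a, 'm) category_scheme" and D :: "('p, 'b, 'n) category_scheme" +
  fixes FO :: "'o \<Rightarrow> 'p" and FA :: "'a \<Rightarrow> 'b"
  assumes Ob_map: "X \<in> Ob C \<Longrightarrow> FO X \<in> Ob D"
    and Hom_map: "f \<in> Hom C X Y \<Longrightarrow> FA f \<in> Hom D (FO X) (FO Y)"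
    and Ident_map: "X \<in> Ob C \<Longrightarrow> FA (Ident C X) = Ident D (FO X)"
    and Comp_map: "f \<in> Hom C X Y \<Longrightarrow> g \<in> Hom C Y Z \<Longrightarrow>
          FA (g \<cdot>\<^bsub>C\<^esub> f) = FA g \<cdot>\<^bsub>D\<^esub> FA f"

definition full_functor ::
  "('o, 'a, 'm) category_scheme \<Rightarrow> ('p, 'b, 'n) category_scheme \<Rightarrow> ('o \<Rightarrow> 'p) \<Rightarrow> ('a \<Rightarrow> 'b) \<Rightarrow> bool"
  where "full_functor C D FO FA \<longleftrightarrow>
    (\<forall>X\<in>Ob C. \<forall>Y\<in>Ob C. FA ` Hom C X Y = Hom D (FO X) (FO Y))"

definition iso_arrow :: "('o, 'a, 'm) category_scheme \<Rightarrow> 'o \<Rightarrow> 'o \<Rightarrow> 'a \<Rightarrow> bool"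
  where "iso_arrow C X Y f \<longleftrightarrow> f \<in> Hom C X Y \<and>
    (\<exists>g\<in>Hom C Y X. g \<cdot>\<^bsub>C\<^esub> f = Ident C X \<and> f \<cdot>\<^bsub>C\<^esub> g = Ident C Y)"

definition naturally_isomorphic ::
  "('o, 'a, 'm) category_scheme \<Rightarrow> ('p, 'b, 'n) category_scheme \<Rightarrow>
   ('o \<Rightarrow> 'p) \<Rightarrow> ('a \<Rightarrow> 'b) \<Rightarrow> ('o \<Rightarrow> 'p) \<Rightarrow> ('a \<Rightarrow> 'b) \<Rightarrow> bool"
  where "naturally_isomorphic C D FO FA GO GA \<longleftrightarrow>
    (\<exists>\<eta>. (\<forall>X\<in>Ob C. iso_arrow D (FO X) (GO X) (\<eta> X)) \<and>
         (\<forall>X Y. \<forall>f\<in>Hom C X Y. \<eta> Y \<cdot>\<^bsub>D\<^esub> FA f = GA f \<cdot>\<^bsub>D\<^esub> \<eta> X))"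


section \<open>Quantaloids\<close>

text \<open>The order \<^term>\<open>Leq Q\<close> only matters between parallel arrows.\<close>

record ('o, 'a) quantaloid = "('o, 'a) category" +
  Leq :: "'a \<Rightarrow> 'a \<Rightarrow> bool" (infixl \<open>\<preceq>\<index>\<close> 50)

definition hom_lattice :: "('o, 'a, 'm) quantaloid_scheme \<Rightarrow> 'o \<Rightarrow> 'o \<Rightarrow> 'a gorder"
  where "hom_lattice Q X Y = \<lparr>carrier = Hom Q X Y, eq = (=), le = Leq Q\<rparr>"

locale quantaloid = category Q
  for Q :: "('o, 'a, 'm) quantaloid_scheme" (structure) +
  assumes complete_lattice_Hom:
      "X \<in> Ob Q \<Longrightarrow> Y \<in> Ob Q \<Longrightarrow> complete_lattice (hom_lattice Q X Y)"
    and Comp_Sup_right: "Z \<in> Ob Q \<Longrightarrow> X \<in> Ob Q \<Longrightarrow> g \<in> Hom Q Y Z \<Longrightarrow> A \<subseteq> Hom Q X Y \<Longrightarrow>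
          g \<cdot> (\<Squnion>\<^bsub>hom_lattice Q X Y\<^esub> A) = \<Squnion>\<^bsub>hom_lattice Q X Z\<^esub> ((\<lambda>f. g \<cdot> f) ` A)"
    and Comp_Sup_left: "Z \<in> Ob Q \<Longrightarrow> X \<in> Ob Q \<Longrightarrow> f \<in> Hom Q X Y \<Longrightarrow> A \<subseteq> Hom Q Y Z \<Longrightarrow>
          (\<Squnion>\<^bsub>hom_lattice Q Y Z\<^esub> A) \<cdot> f = \<Squnion>\<^bsub>hom_lattice Q X Z\<^esub> ((\<lambda>g. g \<cdot> f) ` A)"

locale sup_functor =
  dom: quantaloid Q + cod: quantaloid R + category_functor Q R FO FA
  for Q :: "('o, 'a, 'm) quantaloid_scheme" and R :: "('p, 'b, 'n) quantaloid_scheme"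
    and FO :: "'o \<Rightarrow> 'p" and FA :: "'a \<Rightarrow> 'b" +
  assumes Sup_map: "X \<in> Ob Q \<Longrightarrow> Y \<in> Ob Q \<Longrightarrow> A \<subseteq> Hom Q X Y \<Longrightarrow>
    FA (\<Squnion>\<^bsub>hom_lattice Q X Y\<^esub> A) = \<Squnion>\<^bsub>hom_lattice R (FO X) (FO Y)\<^esub> (FA ` A)"

text \<open>The empty infimum (the case \<^term>\<open>A = {}\<close>) is the top element of the hom.\<close>

definition locally_left_exact ::
  "('o, 'a, 'm) quantaloid_scheme \<Rightarrow> ('p, 'b, 'n) quantaloid_scheme \<Rightarrow>
   ('o \<Rightarrow> 'p) \<Rightarrow> ('a \<Rightarrow> 'b) \<Rightarrow> bool"
  where "locally_left_exact Q R FO FA \<longleftrightarrow>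
    (\<forall>X\<in>Ob Q. \<forall>Y\<in>Ob Q. \<forall>A. finite A \<and> A \<subseteq> Hom Q X Y \<longrightarrow>
      FA (\<Sqinter>\<^bsub>hom_lattice Q X Y\<^esub> A) = \<Sqinter>\<^bsub>hom_lattice R (FO X) (FO Y)\<^esub> (FA ` A))"

definition quantaloid_isomorphic ::
  "('o, 'a, 'm) quantaloid_scheme \<Rightarrow> ('p, 'b, 'n) quantaloid_scheme \<Rightarrow> bool"
  where "quantaloid_isomorphic Q R \<longleftrightarrow>
    (\<exists>FO FA GO GA. sup_functor Q R FO FA \<and> sup_functor R Q GO GA \<and>
      (\<forall>X\<in>Ob Q. GO (FO X) = X) \<and> (\<forall>f\<in>Arr Q. GA (FA f) = f) \<and>
      (\<forall>X\<in>Ob R. FO (GO X) = X) \<and> (\<forall>f\<in>Arr R. FA (GA f) = f))"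

text \<open>Since the order on homs carries no further data, a Sup-enriched natural transformation
  between Sup-functors is just a natural transformation.\<close>

definition quantaloid_equivalent ::
  "('o, 'a, 'm) quantaloid_scheme \<Rightarrow> ('p, 'b, 'n) quantaloid_scheme \<Rightarrow> bool"
  where "quantaloid_equivalent Q R \<longleftrightarrow>
    (\<exists>FO FA GO GA. sup_functor Q R FO FA \<and> sup_functor R Q GO GA \<and>
      naturally_isomorphic Q Q (GO \<circ> FO) (GA \<circ> FA) id id \<and>
      naturally_isomorphic R R (FO \<circ> GO) (FA \<circ> GA) id id)"


section \<open>Left adjoints\<close>

definition adjoint :: "('o, 'a, 'm) quantaloid_scheme \<Rightarrow> 'a \<Rightarrow> 'a \<Rightarrow> bool"
  where "adjoint Q f g \<longleftrightarrow> f \<in> Arr Q \<and> g \<in> Hom Q (Cod Q f) (Dom Q f) \<and>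
    Ident Q (Dom Q f) \<preceq>\<^bsub>Q\<^esub> g \<cdot>\<^bsub>Q\<^esub> f \<and> f \<cdot>\<^bsub>Q\<^esub> g \<preceq>\<^bsub>Q\<^esub> Ident Q (Cod Q f)"

definition left_adjoint :: "('o, 'a, 'm) quantaloid_scheme \<Rightarrow> 'a \<Rightarrow> bool"
  where "left_adjoint Q f \<longleftrightarrow> (\<exists>g. adjoint Q f g)"

text \<open>Right adjoints in a quantaloid are unique.\<close>

definition radj :: "('o, 'a, 'm) quantaloid_scheme \<Rightarrow> 'a \<Rightarrow> 'a"
  where "radj Q f = (THE g. adjoint Q f g)"

definition Map :: "('o, 'a, 'm) quantaloid_scheme \<Rightarrow> ('o, 'a) category"
  where "Map Q = \<lparr>Ob = Ob Q, Arr = {f \<in> Arr Q. left_adjoint Q f}, Dom = Dom Q, Cod = Cod Q,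
    Ident = Ident Q, Comp = Comp Q\<rparr>"

text \<open>The first leg of a span lands in the target \<^term>\<open>Y\<close>, the second in the source
  \<^term>\<open>X\<close>.\<close>

definition spans :: "('o, 'a, 'm) category_scheme \<Rightarrow> 'o \<Rightarrow> 'o \<Rightarrow> ('a \<times> 'a) set"
  where "spans C X Y = {(f, g). f \<in> Arr C \<and> g \<in> Arr C \<and> Dom C f = Dom C g \<and>
    Cod C f = Y \<and> Cod C g = X}"


section \<open>Properties of quantaloids\<close>

locale frame = complete_lattice L for L (structure) +
  assumes meet_Sup_distrib:
    "x \<in> carrier L \<Longrightarrow> A \<subseteq> carrier L \<Longrightarrow> x \<sqinter> (\<Squnion>A) = \<Squnion>((\<lambda>a. x \<sqinter> a) ` A)"

definition locally_localic :: "('o, 'a, 'm) quantaloid_scheme \<Rightarrow> bool"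
  where "locally_localic Q \<longleftrightarrow> (\<forall>X\<in>Ob Q. \<forall>Y\<in>Ob Q. frame (hom_lattice Q X Y))"

definition map_discrete :: "('o, 'a, 'm) quantaloid_scheme \<Rightarrow> bool"
  where "map_discrete Q \<longleftrightarrow>
    (\<forall>X Y. \<forall>f\<in>Hom Q X Y. \<forall>g\<in>Hom Q X Y.
      left_adjoint Q f \<and> left_adjoint Q g \<and> f \<preceq>\<^bsub>Q\<^esub> g \<longrightarrow> f = g)"

definition weakly_tabular :: "('o, 'a, 'm) quantaloid_scheme \<Rightarrow> bool"
  where "weakly_tabular Q \<longleftrightarrow>
    (\<forall>X Y. \<forall>q\<in>Hom Q X Y.
      q = \<Squnion>\<^bsub>hom_lattice Q X Y\<^esub> {f \<cdot>\<^bsub>Q\<^esub> radj Q g | f g.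
            (f, g) \<in> spans (Map Q) X Y \<and> f \<cdot>\<^bsub>Q\<^esub> radj Q g \<preceq>\<^bsub>Q\<^esub> q})"

definition weakly_modular :: "('o, 'a, 'm) quantaloid_scheme \<Rightarrow> bool"
  where "weakly_modular Q \<longleftrightarrow>
    (\<forall>X\<in>Ob Q. \<forall>Y\<in>Ob Q. \<forall>(f, g)\<in>spans (Map Q) X Y. \<forall>(m, n)\<in>spans (Map Q) X Y.
      (f \<cdot>\<^bsub>Q\<^esub> radj Q g) \<sqinter>\<^bsub>hom_lattice Q X Y\<^esub> (m \<cdot>\<^bsub>Q\<^esub> radj Q n) \<preceq>\<^bsub>Q\<^esub>
      f \<cdot>\<^bsub>Q\<^esub> ((radj Q g \<cdot>\<^bsub>Q\<^esub> n) \<sqinter>\<^bsub>hom_lattice Q (Dom Q m) (Dom Q f)\<^esub> (radj Q f \<cdot>\<^bsub>Q\<^esub> m))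
        \<cdot>\<^bsub>Q\<^esub> radj Q n)"

definition op_quantaloid :: "('o, 'a, 'm) quantaloid_scheme \<Rightarrow> ('o, 'a) quantaloid"
  where "op_quantaloid Q = \<lparr>Ob = Ob Q, Arr = Arr Q, Dom = Cod Q, Cod = Dom Q,
    Ident = Ident Q, Comp = (\<lambda>g f. f \<cdot>\<^bsub>Q\<^esub> g), Leq = Leq Q\<rparr>"

definition involution :: "('o, 'a, 'm) quantaloid_scheme \<Rightarrow> ('a \<Rightarrow> 'a) \<Rightarrow> bool"
  where "involution Q i \<longleftrightarrow>
    sup_functor (op_quantaloid Q) Q id i \<and> (\<forall>f\<in>Arr Q. i (i f) = f)"

definition modular :: "('o, 'a, 'm) quantaloid_scheme \<Rightarrow> ('a \<Rightarrow> 'a) \<Rightarrow> bool"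
  where "modular Q i \<longleftrightarrow> involution Q i \<and>
    (\<forall>X Y Z. \<forall>f\<in>Hom Q X Y. \<forall>g\<in>Hom Q Y Z. \<forall>h\<in>Hom Q X Z.
      (g \<cdot>\<^bsub>Q\<^esub> f) \<sqinter>\<^bsub>hom_lattice Q X Z\<^esub> h \<preceq>\<^bsub>Q\<^esub>
      g \<cdot>\<^bsub>Q\<^esub> (f \<sqinter>\<^bsub>hom_lattice Q X Y\<^esub> (i g \<cdot>\<^bsub>Q\<^esub> h)))"

text \<open>For \<^term>\<open>q\<close> from \<^term>\<open>Y\<close> to \<^term>\<open>X\<close>, the arrow \<^term>\<open>span_converse Q q\<close> from
  \<^term>\<open>X\<close> to \<^term>\<open>Y\<close>.\<close>

definition span_converse :: "('o, 'a, 'm) quantaloid_scheme \<Rightarrow> 'a \<Rightarrow> 'a"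
  where "span_converse Q q = \<Squnion>\<^bsub>hom_lattice Q (Cod Q q) (Dom Q q)\<^esub>
    {g \<cdot>\<^bsub>Q\<^esub> radj Q f | f g.
      (f, g) \<in> spans (Map Q) (Dom Q q) (Cod Q q) \<and> f \<cdot>\<^bsub>Q\<^esub> radj Q g \<preceq>\<^bsub>Q\<^esub> q}"


section \<open>Cribles\<close>

definition is_crible ::
  "('o, 'a, 'm) category_scheme \<Rightarrow> 'o \<Rightarrow> 'o \<Rightarrow> ('a \<times> 'a) set \<Rightarrow> bool"
  where "is_crible C X Y R \<longleftrightarrow> R \<subseteq> spans C X Y \<and>
    (\<forall>(f, g)\<in>R. \<forall>h\<in>Arr C. Cod C h = Dom C f \<longrightarrow> (f \<cdot>\<^bsub>C\<^esub> h, g \<cdot>\<^bsub>C\<^esub> h) \<in> R)"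

text \<open>A crible is tagged with its source and target, since the same set of spans (e.g. the empty
  one) can be a crible between different pairs of objects.\<close>

type_synonym ('o, 'a) crible = "'o \<times> ('a \<times> 'a) set \<times> 'o"

definition cribles :: "('o, 'a, 'm) category_scheme \<Rightarrow> ('o, ('o, 'a) crible) quantaloid"
  where "cribles C = \<lparr>
    Ob = Ob C,
    Arr = {(X, R, Y). X \<in> Ob C \<and> Y \<in> Ob C \<and> is_crible C X Y R},
    Dom = (\<lambda>(X, R, Y). X),
    Cod = (\<lambda>(X, R, Y). Y),
    Ident = (\<lambda>X. (X, {(f, f) | f. f \<in> Arr C \<and> Cod C f = X}, X)),
    Comp = (\<lambda>(Y', S, Z) (X, R, Y). (X, {(f, g). \<exists>t\<in>Arr C. (f, t) \<in> S \<and> (t, g) \<in> R}, Z)),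
    Leq = (\<lambda>(X, R, Y) (X', S, Y'). X = X' \<and> Y = Y' \<and> R \<subseteq> S)\<rparr>"

text \<open>The quantaloid of \<^term>\<open>j\<close>-closed arrows of a nucleus \<^term>\<open>j\<close>. Its suprema, being those
  of the induced order, are the closures of the suprema in \<^term>\<open>Q\<close>.\<close>

definition nucleus_quantaloid ::
  "('o, 'a) quantaloid \<Rightarrow> ('a \<Rightarrow> 'a) \<Rightarrow> ('o, 'a) quantaloid"
  where "nucleus_quantaloid Q j = \<lparr>Ob = Ob Q, Arr = {f \<in> Arr Q. j f = f},
    Dom = Dom Q, Cod = Cod Q, Ident = (\<lambda>X. j (Ident Q X)),
    Comp = (\<lambda>g f. j (g \<cdot>\<^bsub>Q\<^esub> f)), Leq = Leq Q\<rparr>"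

definition sieve :: "('o, 'a, 'm) category_scheme \<Rightarrow> 'o \<Rightarrow> 'a set \<Rightarrow> bool"
  where "sieve C X S \<longleftrightarrow> S \<subseteq> {f \<in> Arr C. Cod C f = X} \<and>
    (\<forall>f\<in>S. \<forall>h\<in>Arr C. Cod C h = Dom C f \<longrightarrow> f \<cdot>\<^bsub>C\<^esub> h \<in> S)"

definition pullback_sieve :: "('o, 'a, 'm) category_scheme \<Rightarrow> 'a \<Rightarrow> 'a set \<Rightarrow> 'a set"
  where "pullback_sieve C f S = {h \<in> Arr C. Cod C h = Dom C f \<and> f \<cdot>\<^bsub>C\<^esub> h \<in> S}"

text \<open>A small category with a Grothendieck topology; the values of \<^term>\<open>J\<close> outside the objects
  of \<^term>\<open>C\<close> are irrelevant.\<close>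

locale site = category C
  for C :: "('o, 'a, 'm) category_scheme" (structure) and J :: "'o \<Rightarrow> 'a set set" +
  assumes covering_sieve: "X \<in> Ob C \<Longrightarrow> S \<in> J X \<Longrightarrow> sieve C X S"
    and covering_maximal: "X \<in> Ob C \<Longrightarrow> {f \<in> Arr C. Cod C f = X} \<in> J X"
    and covering_pullback: "X \<in> Ob C \<Longrightarrow> S \<in> J X \<Longrightarrow> f \<in> Hom C Y X \<Longrightarrow>
          pullback_sieve C f S \<in> J Y"
    and covering_local: "X \<in> Ob C \<Longrightarrow> S \<in> J X \<Longrightarrow> sieve C X T \<Longrightarrow>
          (\<And>f. f \<in> S \<Longrightarrow> pullback_sieve C f T \<in> J (Dom C f)) \<Longrightarrow> T \<in> J X"

definition crible_closure ::
  "('o, 'a, 'm) category_scheme \<Rightarrow> ('o \<Rightarrow> 'a set set) \<Rightarrow> ('o, 'a) crible \<Rightarrow> ('o, 'a) crible"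
  where "crible_closure C J = (\<lambda>(X, R, Y).
    (X, {(f, g) \<in> spans C X Y. \<exists>S\<in>J (Dom C f). \<forall>s\<in>S. (f \<cdot>\<^bsub>C\<^esub> s, g \<cdot>\<^bsub>C\<^esub> s) \<in> R}, Y))"

definition closed_cribles ::
  "('o, 'a, 'm) category_scheme \<Rightarrow> ('o \<Rightarrow> 'a set set) \<Rightarrow> ('o, ('o, 'a) crible) quantaloid"
  where "closed_cribles C J = nucleus_quantaloid (cribles C) (crible_closure C J)"

text \<open>HOL cannot quantify over types inside a formula, so the types \<^typ>\<open>'c\<close> of objects and
  \<^typ>\<open>'b\<close> of arrows of the representing site are parameters of the notion.\<close>

definition quantaloid_of_closed_cribles ::
  "'c itself \<Rightarrow> 'b itself \<Rightarrow> ('o, 'a, 'm) quantaloid_scheme \<Rightarrow> bool"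
  where "quantaloid_of_closed_cribles _ _ Q \<longleftrightarrow> quantaloid Q \<and>
    (\<exists>(C :: ('c, 'b) category) J. site C J \<and> quantaloid_equivalent Q (closed_cribles C J))"


section \<open>The comparison functor and the topology on maps\<close>

definition crible_join :: "('o, 'a, 'm) quantaloid_scheme \<Rightarrow> ('o, 'a) crible \<Rightarrow> 'a"
  where "crible_join Q = (\<lambda>(X, R, Y).
    \<Squnion>\<^bsub>hom_lattice Q X Y\<^esub> {f \<cdot>\<^bsub>Q\<^esub> radj Q g | f g. (f, g) \<in> R})"

definition map_topology :: "('o, 'a, 'm) quantaloid_scheme \<Rightarrow> 'o \<Rightarrow> 'a set set"
  where "map_topology Q X = {S. sieve (Map Q) X S \<and>
    Ident Q X = \<Squnion>\<^bsub>hom_lattice Q X X\<^esub> ((\<lambda>s. s \<cdot>\<^bsub>Q\<^esub> radj Q s) ` S)}"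

end

(*
  The functor F has a right adjoint G on homs, G q being the crible of all spans (f, g) with
  f g* <= q. Weak tabularity says F G = 1, i.e. fullness; together with map-discreteness it turns
  an inequality h k* <= g* m into a commutative square g h = m k of maps, which makes F preserve
  composition and, with weak modularity and local localicity, binary meets.

  If F is left exact, the closure G F is the nucleus of the topology J on maps: f g* <= F R means
  that 1 <= f* (F R) g, and meeting the crible behind the right-hand side with the identity
  crible yields the sieve of all s with (f s, g s) in R, which therefore covers. So the arrows of
  Q are the J-closed cribles.

  Quantaloids of closed cribles are locally localic, weakly tabular (the closed graphs of the
  arrows of the site are left adjoints) and modular for the converse of cribles, and these
  properties transfer along equivalences. In a modular quantaloid f* is the converse of f, whence
  map-discreteness, weak modularity, and the formula for the involution.
*)

theory Submission
  imports Defs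
begin

section \<open>Quantaloids via least upper bounds\<close>

text \<open>In a quantaloid of closed cribles the left adjoints are not known explicitly: closed
  graphs of arrows of the site are left adjoints, but others may exist. Weak tabularity only asks
  for enough of them, whereas map-discreteness and weak modularity quantify over all. These two are
  therefore drawn from the modular law, which computes every right adjoint as a converse, whatever
  the left adjoint looks like. Weak tabularity is handled as a separation property:
  \<open>q \<preceq> u\<close> once \<open>f \<preceq> q g\<close> implies
  \<open>f \<preceq> u g\<close> for all spans of maps. This mentions neither right adjoints nor
  suprema, so it survives passage along an equivalence. Residuation of \<open>F\<close> and the
  inequality \<open>F(S R) \<preceq> F(S) F(R)\<close> are formal. The reverse inequality and finite
  infima are where a span inside a crible has to be extracted from an inequality between arrows, and
  commuting squares of maps supply it. No quotient by a nucleus is constructed in general: closed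
  cribles receive their quantaloid structure from \<open>Q\<close> along bijections on homs, or from
  the Sup-functors of a given equivalence.\<close>

context category
begin

lemma Hom_objects: "f \<in> Hom C X Y \<Longrightarrow> X \<in> Ob C \<and> Y \<in> Ob C"
  using Dom_in_Ob Cod_in_Ob by (auto simp: Hom_def)

lemma Arr_Hom: "f \<in> Arr C \<longleftrightarrow> f \<in> Hom C (Dom C f) (Cod C f)"
  by (auto simp: Hom_def)

end

lemma Hom_Dom_Cod: "f \<in> Hom C X Y \<Longrightarrow> f \<in> Arr C \<and> Dom C f = X \<and> Cod C f = Y"
  by (auto simp: Hom_def)

text \<open>Only suprema have to be supplied: the infimum of a set is the supremum of its lower
  bounds.\<close>

lemma complete_latticeI_lub:
  fixes L :: "'a gorder" and S :: "'a set \<Rightarrow> 'a"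
  assumes eq: "eq L = (=)"
    and refl: "\<And>a. a \<in> carrier L \<Longrightarrow> le L a a"
    and antisym: "\<And>a b. a \<in> carrier L \<Longrightarrow> b \<in> carrier L \<Longrightarrow> le L a b \<Longrightarrow> le L b a \<Longrightarrow> a = b"
    and trans: "\<And>a b c. a \<in> carrier L \<Longrightarrow> b \<in> carrier L \<Longrightarrow> c \<in> carrier L \<Longrightarrow>
      le L a b \<Longrightarrow> le L b c \<Longrightarrow> le L a c"
    and closed: "\<And>A. A \<subseteq> carrier L \<Longrightarrow> S A \<in> carrier L"
    and upper: "\<And>A a. A \<subseteq> carrier L \<Longrightarrow> a \<in> A \<Longrightarrow> le L a (S A)"
    and least: "\<And>A u. A \<subseteq> carrier L \<Longrightarrow> u \<in> carrier L \<Longrightarrow> (\<And>a. a \<in> A \<Longrightarrow> le L a u) \<Longrightarrow> le L (S A) u"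
  shows "complete_lattice L"
proof -
  have po: "partial_order L"
    by unfold_locales (auto simp: eq intro: refl antisym trans)
  interpret partial_order L by (rule po)
  have sup: "least L (S A) (Upper L A)" if "A \<subseteq> carrier L" for A
    using that closed[OF that] upper[OF that]
    by (auto simp: least_def Upper_def subset_iff intro!: assms(7))
  show ?thesis
  proof (intro complete_lattice.intro po complete_lattice_axioms.intro)
    fix A assume A: "A \<subseteq> carrier L"
    show "\<exists>s. least L s (Upper L A)" using sup[OF A] by blast
    have L: "Lower L A \<subseteq> carrier L" by (auto simp: Lower_def)
    have "greatest L (S (Lower L A)) (Lower L A)"
      using L A closed[OF L] upper[OF L] by (auto simp: greatest_def Lower_def intro!: assms(7))
    then show "\<exists>i. greatest L i (Lower L A)" by blast
  qed
qed

context quantaloid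
begin

lemma carrier_hom_lattice: "carrier (hom_lattice Q X Y) = Hom Q X Y"
  by (simp add: hom_lattice_def)

lemma le_hom_lattice: "le (hom_lattice Q X Y) = Leq Q"
  by (simp add: hom_lattice_def)

lemma
  shows Leq_refl: "f \<in> Hom Q X Y \<Longrightarrow> f \<preceq> f"
    and Leq_antisym: "f \<in> Hom Q X Y \<Longrightarrow> g \<in> Hom Q X Y \<Longrightarrow> f \<preceq> g \<Longrightarrow> g \<preceq> f \<Longrightarrow> f = g"
    and Leq_trans: "f \<preceq> g \<Longrightarrow> g \<preceq> h \<Longrightarrow> f \<in> Hom Q X Y \<Longrightarrow> g \<in> Hom Q X Y \<Longrightarrow> h \<in> Hom Q X Y \<Longrightarrow>
      f \<preceq> h"
proof -
  have L: "partial_order (hom_lattice Q X Y)" if "f \<in> Hom Q X Y" for f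
    using that Hom_objects complete_lattice_Hom by (blast intro: complete_lattice.axioms)
  note [simp] = carrier_hom_lattice le_hom_lattice
  show "f \<in> Hom Q X Y \<Longrightarrow> f \<preceq> f"
    using weak_partial_order.le_refl[OF partial_order.axioms(1)[OF L], of f f] by simp
  show "f \<in> Hom Q X Y \<Longrightarrow> g \<in> Hom Q X Y \<Longrightarrow> f \<preceq> g \<Longrightarrow> g \<preceq> f \<Longrightarrow> f = g"
    using partial_order.le_antisym[OF L, of f f g] by simp
  show "f \<preceq> g \<Longrightarrow> g \<preceq> h \<Longrightarrow> f \<in> Hom Q X Y \<Longrightarrow> g \<in> Hom Q X Y \<Longrightarrow> h \<in> Hom Q X Y \<Longrightarrow> f \<preceq> h"
    using weak_partial_order.le_trans[OF partial_order.axioms(1)[OF L], of f f g h] by simp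
qed

section \<open>Joins and meets in homs by their universal properties\<close>

abbreviation Join :: "'o \<Rightarrow> 'o \<Rightarrow> 'a set \<Rightarrow> 'a"
  where "Join X Y A \<equiv> \<Squnion>\<^bsub>hom_lattice Q X Y\<^esub> A"

abbreviation Meet :: "'o \<Rightarrow> 'o \<Rightarrow> 'a \<Rightarrow> 'a \<Rightarrow> 'a"
  where "Meet X Y f g \<equiv> f \<sqinter>\<^bsub>hom_lattice Q X Y\<^esub> g"

lemma assumes "X \<in> Ob Q" and "Y \<in> Ob Q"
  shows Join_in_Hom: "A \<subseteq> Hom Q X Y \<Longrightarrow> Join X Y A \<in> Hom Q X Y"
    and Join_upper: "A \<subseteq> Hom Q X Y \<Longrightarrow> a \<in> A \<Longrightarrow> a \<preceq> Join X Y A"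
    and Join_least: "A \<subseteq> Hom Q X Y \<Longrightarrow> u \<in> Hom Q X Y \<Longrightarrow> (\<And>a. a \<in> A \<Longrightarrow> a \<preceq> u) \<Longrightarrow> Join X Y A \<preceq> u"
    and Meet_in_Hom: "f \<in> Hom Q X Y \<Longrightarrow> g \<in> Hom Q X Y \<Longrightarrow> Meet X Y f g \<in> Hom Q X Y"
    and Meet_left: "f \<in> Hom Q X Y \<Longrightarrow> g \<in> Hom Q X Y \<Longrightarrow> Meet X Y f g \<preceq> f"
    and Meet_right: "f \<in> Hom Q X Y \<Longrightarrow> g \<in> Hom Q X Y \<Longrightarrow> Meet X Y f g \<preceq> g"
    and Meet_greatest: "f \<in> Hom Q X Y \<Longrightarrow> g \<in> Hom Q X Y \<Longrightarrow> u \<in> Hom Q X Y \<Longrightarrow>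
      u \<preceq> f \<Longrightarrow> u \<preceq> g \<Longrightarrow> u \<preceq> Meet X Y f g"
    and Inf_in_Hom: "A \<subseteq> Hom Q X Y \<Longrightarrow> \<Sqinter>\<^bsub>hom_lattice Q X Y\<^esub> A \<in> Hom Q X Y"
    and Inf_lower: "A \<subseteq> Hom Q X Y \<Longrightarrow> a \<in> A \<Longrightarrow> \<Sqinter>\<^bsub>hom_lattice Q X Y\<^esub> A \<preceq> a"
    and Inf_greatest: "A \<subseteq> Hom Q X Y \<Longrightarrow> u \<in> Hom Q X Y \<Longrightarrow> (\<And>a. a \<in> A \<Longrightarrow> u \<preceq> a) \<Longrightarrow>
      u \<preceq> \<Sqinter>\<^bsub>hom_lattice Q X Y\<^esub> A"
proof -
  interpret L: complete_lattice "hom_lattice Q X Y"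
    using assms by (rule complete_lattice_Hom)
  note [simp] = carrier_hom_lattice le_hom_lattice
  show "A \<subseteq> Hom Q X Y \<Longrightarrow> Join X Y A \<in> Hom Q X Y"
    using L.sup_closed by simp
  show "A \<subseteq> Hom Q X Y \<Longrightarrow> a \<in> A \<Longrightarrow> a \<preceq> Join X Y A"
    using L.sup_upper[of A a] by simp
  show "A \<subseteq> Hom Q X Y \<Longrightarrow> u \<in> Hom Q X Y \<Longrightarrow> (\<And>a. a \<in> A \<Longrightarrow> a \<preceq> u) \<Longrightarrow> Join X Y A \<preceq> u"
    using L.sup_least[of A u] by simp
  show "f \<in> Hom Q X Y \<Longrightarrow> g \<in> Hom Q X Y \<Longrightarrow> Meet X Y f g \<in> Hom Q X Y"
    using L.meet_closed[of f g] by simp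
  show "f \<in> Hom Q X Y \<Longrightarrow> g \<in> Hom Q X Y \<Longrightarrow> Meet X Y f g \<preceq> f"
    using L.meet_left[of f g] by simp
  show "f \<in> Hom Q X Y \<Longrightarrow> g \<in> Hom Q X Y \<Longrightarrow> Meet X Y f g \<preceq> g"
    using L.meet_right[of f g] by simp
  show "f \<in> Hom Q X Y \<Longrightarrow> g \<in> Hom Q X Y \<Longrightarrow> u \<in> Hom Q X Y \<Longrightarrow>
      u \<preceq> f \<Longrightarrow> u \<preceq> g \<Longrightarrow> u \<preceq> Meet X Y f g"
    using L.meet_le[of u f g] by simp
  show "A \<subseteq> Hom Q X Y \<Longrightarrow> \<Sqinter>\<^bsub>hom_lattice Q X Y\<^esub> A \<in> Hom Q X Y"
    using L.inf_closed by simp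
  show "A \<subseteq> Hom Q X Y \<Longrightarrow> a \<in> A \<Longrightarrow> \<Sqinter>\<^bsub>hom_lattice Q X Y\<^esub> A \<preceq> a"
    using L.inf_lower[of A a] by simp
  show "A \<subseteq> Hom Q X Y \<Longrightarrow> u \<in> Hom Q X Y \<Longrightarrow> (\<And>a. a \<in> A \<Longrightarrow> u \<preceq> a) \<Longrightarrow>
      u \<preceq> \<Sqinter>\<^bsub>hom_lattice Q X Y\<^esub> A"
    using L.inf_greatest[of A u] by simp
qed

lemma Join_eqI:
  assumes "s \<in> Hom Q X Y" and "A \<subseteq> Hom Q X Y" and "\<And>a. a \<in> A \<Longrightarrow> a \<preceq> s"
    and "\<And>u. u \<in> Hom Q X Y \<Longrightarrow> (\<And>a. a \<in> A \<Longrightarrow> a \<preceq> u) \<Longrightarrow> s \<preceq> u"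
  shows "Join X Y A = s"
  using Hom_objects[OF assms(1)] assms
  by (intro Leq_antisym[of _ X Y]) (auto intro: Join_in_Hom Join_least Join_upper)

lemma Meet_eqI:
  assumes "f \<in> Hom Q X Y" and "g \<in> Hom Q X Y" and "s \<in> Hom Q X Y" and "s \<preceq> f" and "s \<preceq> g"
    and "\<And>u. u \<in> Hom Q X Y \<Longrightarrow> u \<preceq> f \<Longrightarrow> u \<preceq> g \<Longrightarrow> u \<preceq> s"
  shows "Meet X Y f g = s"
  using Hom_objects[OF assms(1)] assms
  by (intro Leq_antisym[of _ X Y]) (auto intro: Meet_in_Hom Meet_greatest Meet_left Meet_right)

lemma Inf_eqI:
  assumes "s \<in> Hom Q X Y" and "A \<subseteq> Hom Q X Y" and "\<And>a. a \<in> A \<Longrightarrow> s \<preceq> a"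
    and "\<And>u. u \<in> Hom Q X Y \<Longrightarrow> (\<And>a. a \<in> A \<Longrightarrow> u \<preceq> a) \<Longrightarrow> u \<preceq> s"
  shows "\<Sqinter>\<^bsub>hom_lattice Q X Y\<^esub> A = s"
  using Hom_objects[OF assms(1)] assms
  by (intro Leq_antisym[of _ X Y]) (auto intro: Inf_in_Hom Inf_greatest Inf_lower)

lemma Join_pair: "f \<in> Hom Q X Y \<Longrightarrow> g \<in> Hom Q X Y \<Longrightarrow> f \<preceq> g \<Longrightarrow> Join X Y {f, g} = g"
  by (rule Join_eqI) (auto intro: Leq_refl)

text \<open>Monotonicity of composition is hidden in the preservation of suprema: for
  \<open>f \<preceq> f'\<close> the join of the pair \<open>{f, f'}\<close> is \<open>f'\<close>,
  and composing with \<open>g\<close> carries this over.\<close>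

lemma Comp_mono_right:
  assumes "f \<preceq> f'" and "f \<in> Hom Q X Y" and "f' \<in> Hom Q X Y" and "g \<in> Hom Q Y Z"
  shows "g \<cdot> f \<preceq> g \<cdot> f'"
proof -
  have ob: "X \<in> Ob Q" "Z \<in> Ob Q" using assms Hom_objects by blast+
  have "g \<cdot> f' = Join X Z {g \<cdot> f, g \<cdot> f'}"
    using Comp_Sup_right[of Z X g Y "{f, f'}"] Join_pair[of f X Y f'] assms ob by simp
  moreover have "g \<cdot> f \<preceq> Join X Z {g \<cdot> f, g \<cdot> f'}"
    using assms ob by (intro Join_upper) (auto intro: Comp_in_Hom)
  ultimately show ?thesis by simp
qed

lemma Comp_mono_left:
  assumes "g \<preceq> g'" and "g \<in> Hom Q Y Z" and "g' \<in> Hom Q Y Z" and "f \<in> Hom Q X Y"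
  shows "g \<cdot> f \<preceq> g' \<cdot> f"
proof -
  have ob: "X \<in> Ob Q" "Z \<in> Ob Q" using assms Hom_objects by blast+
  have "g' \<cdot> f = Join X Z {g \<cdot> f, g' \<cdot> f}"
    using Comp_Sup_left[of Z X f Y "{g, g'}"] Join_pair[of g Y Z g'] assms ob by simp
  moreover have "g \<cdot> f \<preceq> Join X Z {g \<cdot> f, g' \<cdot> f}"
    using assms ob by (intro Join_upper) (auto intro: Comp_in_Hom)
  ultimately show ?thesis by simp
qed

lemma Comp_Join_le:
  assumes "g \<in> Hom Q Y Z" and "A \<subseteq> Hom Q X Y" and "u \<in> Hom Q X Z" and "\<And>a. a \<in> A \<Longrightarrow> g \<cdot> a \<preceq> u"
  shows "g \<cdot> Join X Y A \<preceq> u"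
proof -
  have ob: "X \<in> Ob Q" "Z \<in> Ob Q" using assms Hom_objects by blast+
  show ?thesis unfolding Comp_Sup_right[OF ob(2,1) assms(1,2)]
    using assms ob by (intro Join_least) (auto intro: Comp_in_Hom)
qed

lemma Join_Comp_le:
  assumes "f \<in> Hom Q X Y" and "A \<subseteq> Hom Q Y Z" and "u \<in> Hom Q X Z" and "\<And>a. a \<in> A \<Longrightarrow> a \<cdot> f \<preceq> u"
  shows "Join Y Z A \<cdot> f \<preceq> u"
proof -
  have ob: "X \<in> Ob Q" "Z \<in> Ob Q" using assms Hom_objects by blast+
  show ?thesis unfolding Comp_Sup_left[OF ob(2,1) assms(1,2)]
    using assms ob by (intro Join_least) (auto intro: Comp_in_Hom)
qed

text \<open>Weak tabularity and covering sieves both exhibit the middle factor of a triple composite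
  as a supremum; this is the form in which either is used.\<close>

lemma Comp_Join_Comp_le:
  assumes A: "A \<subseteq> Hom Q X Y" and p: "p \<in> Hom Q Y Z" and n: "n \<in> Hom Q W X" and u: "u \<in> Hom Q W Z"
    and le: "\<And>a. a \<in> A \<Longrightarrow> p \<cdot> (a \<cdot> n) \<preceq> u"
  shows "p \<cdot> (Join X Y A \<cdot> n) \<preceq> u"
proof -
  have "W \<in> Ob Q" "Y \<in> Ob Q" using p n Hom_objects by blast+
  then have "Join X Y A \<cdot> n = Join W Y ((\<lambda>a. a \<cdot> n) ` A)"
    using Comp_Sup_left[OF _ _ n A] by simp
  moreover have "p \<cdot> Join W Y ((\<lambda>a. a \<cdot> n) ` A) \<preceq> u"
    using A n le by (intro Comp_Join_le[OF p _ u]) (auto intro: Comp_in_Hom)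
  ultimately show ?thesis by simp
qed

end

text \<open>\<open>S\<close> is any candidate for the supremum, so that explicit formulas such as
  unions can be used. Given monotonicity, distributivity over \<open>S\<close> reduces to one
  inequality in each variable, tested against upper bounds \<open>u\<close>.\<close>

lemma quantaloidI:
  fixes Q :: "('o, 'a, 'm) quantaloid_scheme" (structure)
    and S :: "'o \<Rightarrow> 'o \<Rightarrow> 'a set \<Rightarrow> 'a"
  assumes cat: "category Q"
    and refl: "\<And>X Y f. f \<in> Hom Q X Y \<Longrightarrow> f \<preceq> f"
    and antisym: "\<And>X Y f g. f \<in> Hom Q X Y \<Longrightarrow> g \<in> Hom Q X Y \<Longrightarrow> f \<preceq> g \<Longrightarrow> g \<preceq> f \<Longrightarrow> f = g"
    and trans: "\<And>X Y f g h. f \<in> Hom Q X Y \<Longrightarrow> g \<in> Hom Q X Y \<Longrightarrow> h \<in> Hom Q X Y \<Longrightarrow>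
      f \<preceq> g \<Longrightarrow> g \<preceq> h \<Longrightarrow> f \<preceq> h"
    and closed: "\<And>X Y A. X \<in> Ob Q \<Longrightarrow> Y \<in> Ob Q \<Longrightarrow> A \<subseteq> Hom Q X Y \<Longrightarrow> S X Y A \<in> Hom Q X Y"
    and upper: "\<And>X Y A a. X \<in> Ob Q \<Longrightarrow> Y \<in> Ob Q \<Longrightarrow> A \<subseteq> Hom Q X Y \<Longrightarrow> a \<in> A \<Longrightarrow> a \<preceq> S X Y A"
    and least: "\<And>X Y A u. X \<in> Ob Q \<Longrightarrow> Y \<in> Ob Q \<Longrightarrow> A \<subseteq> Hom Q X Y \<Longrightarrow> u \<in> Hom Q X Y \<Longrightarrow>
      (\<And>a. a \<in> A \<Longrightarrow> a \<preceq> u) \<Longrightarrow> S X Y A \<preceq> u"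
    and mono_right: "\<And>X Y Z f f' g. f \<in> Hom Q X Y \<Longrightarrow> f' \<in> Hom Q X Y \<Longrightarrow> g \<in> Hom Q Y Z \<Longrightarrow>
      f \<preceq> f' \<Longrightarrow> g \<cdot> f \<preceq> g \<cdot> f'"
    and mono_left: "\<And>X Y Z f g g'. f \<in> Hom Q X Y \<Longrightarrow> g \<in> Hom Q Y Z \<Longrightarrow> g' \<in> Hom Q Y Z \<Longrightarrow>
      g \<preceq> g' \<Longrightarrow> g \<cdot> f \<preceq> g' \<cdot> f"
    and S_right: "\<And>X Y Z A g u. g \<in> Hom Q Y Z \<Longrightarrow> X \<in> Ob Q \<Longrightarrow> A \<subseteq> Hom Q X Y \<Longrightarrow> u \<in> Hom Q X Z \<Longrightarrow>
      (\<And>a. a \<in> A \<Longrightarrow> g \<cdot> a \<preceq> u) \<Longrightarrow> g \<cdot> S X Y A \<preceq> u"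
    and S_left: "\<And>X Y Z A f u. f \<in> Hom Q X Y \<Longrightarrow> Z \<in> Ob Q \<Longrightarrow> A \<subseteq> Hom Q Y Z \<Longrightarrow> u \<in> Hom Q X Z \<Longrightarrow>
      (\<And>a. a \<in> A \<Longrightarrow> a \<cdot> f \<preceq> u) \<Longrightarrow> S Y Z A \<cdot> f \<preceq> u"
  shows "quantaloid Q"
proof -
  interpret category Q by (rule cat)
  have cl: "complete_lattice (hom_lattice Q X Y)" if "X \<in> Ob Q" "Y \<in> Ob Q" for X Y
    using that by (intro complete_latticeI_lub[where S = "S X Y"])
      (auto simp: hom_lattice_def intro: refl closed upper least dest: antisym trans)
  have eq: "\<Squnion>\<^bsub>hom_lattice Q X Y\<^esub> A = s"
    if "X \<in> Ob Q" "Y \<in> Ob Q" "A \<subseteq> Hom Q X Y" "s \<in> Hom Q X Y" "\<And>a. a \<in> A \<Longrightarrow> a \<preceq> s"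
      "\<And>u. u \<in> Hom Q X Y \<Longrightarrow> (\<And>a. a \<in> A \<Longrightarrow> a \<preceq> u) \<Longrightarrow> s \<preceq> u" for X Y A s
  proof -
    interpret L: complete_lattice "hom_lattice Q X Y" using that cl by blast
    have "\<Squnion>\<^bsub>hom_lattice Q X Y\<^esub> A \<in> Hom Q X Y"
      using L.sup_closed[of A] that(3) by (simp add: hom_lattice_def)
    moreover have "\<And>a. a \<in> A \<Longrightarrow> a \<preceq> \<Squnion>\<^bsub>hom_lattice Q X Y\<^esub> A"
      using L.sup_upper[of A] that(3) by (simp add: hom_lattice_def)
    moreover have "\<Squnion>\<^bsub>hom_lattice Q X Y\<^esub> A \<preceq> s"
      using L.sup_least[of A s] that by (simp add: hom_lattice_def)
    ultimately show ?thesis using that by (intro antisym[of _ X Y]) auto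
  qed
  have S_eq: "\<Squnion>\<^bsub>hom_lattice Q X Y\<^esub> A = S X Y A"
    if "X \<in> Ob Q" "Y \<in> Ob Q" "A \<subseteq> Hom Q X Y" for X Y A
    using that by (intro eq closed upper least) auto
  show ?thesis
  proof (intro quantaloid.intro cat quantaloid_axioms.intro cl)
    fix X Y Z g A
    assume *: "Z \<in> Ob Q" "X \<in> Ob Q" "g \<in> Hom Q Y Z" "A \<subseteq> Hom Q X Y"
    then have "Y \<in> Ob Q" using Hom_objects by blast
    then show "g \<cdot> (\<Squnion>\<^bsub>hom_lattice Q X Y\<^esub> A) = \<Squnion>\<^bsub>hom_lattice Q X Z\<^esub> ((\<lambda>f. g \<cdot> f) ` A)"
      using * closed[of X Y A] upper[of X Y A] S_eq[of X Y A]
      by (intro eq[symmetric]) (auto intro: Comp_in_Hom mono_right S_right)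
  next
    fix X Y Z f A
    assume *: "Z \<in> Ob Q" "X \<in> Ob Q" "f \<in> Hom Q X Y" "A \<subseteq> Hom Q Y Z"
    then have "Y \<in> Ob Q" using Hom_objects by blast
    then show "(\<Squnion>\<^bsub>hom_lattice Q Y Z\<^esub> A) \<cdot> f = \<Squnion>\<^bsub>hom_lattice Q X Z\<^esub> ((\<lambda>g. g \<cdot> f) ` A)"
      using * closed[of Y Z A] upper[of Y Z A] S_eq[of Y Z A]
      by (intro eq[symmetric]) (auto intro: Comp_in_Hom mono_left S_left)
  qed
qed

section \<open>Sup-functors\<close>

context sup_functor
begin

lemma Leq_map:
  assumes "f \<preceq>\<^bsub>Q\<^esub> g" and "f \<in> Hom Q X Y" and "g \<in> Hom Q X Y"
  shows "FA f \<preceq>\<^bsub>R\<^esub> FA g"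
proof -
  have ob: "X \<in> Ob Q" "Y \<in> Ob Q" using assms dom.Hom_objects by blast+
  have "FA g = cod.Join (FO X) (FO Y) {FA f, FA g}"
    using Sup_map[of X Y "{f, g}"] assms ob dom.Join_pair[of f X Y g] by simp
  moreover have "FA f \<preceq>\<^bsub>R\<^esub> cod.Join (FO X) (FO Y) {FA f, FA g}"
    using assms ob by (intro cod.Join_upper) (auto intro: Hom_map Ob_map)
  ultimately show ?thesis by simp
qed

end

text \<open>A map of complete lattices with a right adjoint preserves suprema. The right adjoint is
  asked for pointwise, as the largest arrow sent below \<open>u\<close>.\<close>

lemma sup_functorI_residuated:
  fixes Q :: "('o, 'a, 'm) quantaloid_scheme" and R :: "('p, 'b, 'n) quantaloid_scheme"
  assumes "quantaloid Q" and "quantaloid R" and "category_functor Q R FO FA"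
    and res: "\<And>X Y u. X \<in> Ob Q \<Longrightarrow> Y \<in> Ob Q \<Longrightarrow> u \<in> Hom R (FO X) (FO Y) \<Longrightarrow>
      \<exists>r\<in>Hom Q X Y. \<forall>q\<in>Hom Q X Y. FA q \<preceq>\<^bsub>R\<^esub> u \<longleftrightarrow> q \<preceq>\<^bsub>Q\<^esub> r"
  shows "sup_functor Q R FO FA"
proof -
  interpret dom: quantaloid Q by fact
  interpret cod: quantaloid R by fact
  interpret category_functor Q R FO FA by fact
  show ?thesis
  proof unfold_locales
    fix X Y A assume A: "X \<in> Ob Q" "Y \<in> Ob Q" "A \<subseteq> Hom Q X Y"
    have J: "dom.Join X Y A \<in> Hom Q X Y" using A by (rule dom.Join_in_Hom)
    show "FA (dom.Join X Y A) = cod.Join (FO X) (FO Y) (FA ` A)"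
    proof (rule cod.Join_eqI[symmetric])
      show "FA (dom.Join X Y A) \<in> Hom R (FO X) (FO Y)" using J by (rule Hom_map)
      show "FA ` A \<subseteq> Hom R (FO X) (FO Y)" using A Hom_map by blast
      \<comment> \<open>Monotonicity of \<open>FA\<close> has to be recovered: residuating at
        \<open>FA\<close> of the join itself puts the join, hence every member of \<open>A\<close>,
        below \<open>r\<close>.\<close>
      obtain r where r: "r \<in> Hom Q X Y" "\<forall>q\<in>Hom Q X Y. FA q \<preceq>\<^bsub>R\<^esub> FA (dom.Join X Y A) \<longleftrightarrow> q \<preceq>\<^bsub>Q\<^esub> r"
        using res[OF A(1,2) Hom_map[OF J]] by blast
      have "dom.Join X Y A \<preceq>\<^bsub>Q\<^esub> r" using r J cod.Leq_refl[OF Hom_map[OF J]] by blast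
      then show "b \<preceq>\<^bsub>R\<^esub> FA (dom.Join X Y A)" if "b \<in> FA ` A" for b
        using that r J A dom.Join_upper[OF A] dom.Leq_trans[of _ "dom.Join X Y A" r X Y] by blast
      fix u assume u: "u \<in> Hom R (FO X) (FO Y)" "\<And>b. b \<in> FA ` A \<Longrightarrow> b \<preceq>\<^bsub>R\<^esub> u"
      obtain r where r: "r \<in> Hom Q X Y" "\<forall>q\<in>Hom Q X Y. FA q \<preceq>\<^bsub>R\<^esub> u \<longleftrightarrow> q \<preceq>\<^bsub>Q\<^esub> r"
        using res[OF A(1,2) u(1)] by blast
      then have "dom.Join X Y A \<preceq>\<^bsub>Q\<^esub> r"
        using u A by (intro dom.Join_least) auto
      then show "FA (dom.Join X Y A) \<preceq>\<^bsub>R\<^esub> u" using r J by blast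
    qed
  qed
qed

section \<open>Left adjoints\<close>

context quantaloid
begin

lemma adjoint_iff:
  "f \<in> Hom Q X Y \<Longrightarrow> adjoint Q f g \<longleftrightarrow>
    g \<in> Hom Q Y X \<and> Ident Q X \<preceq> g \<cdot> f \<and> f \<cdot> g \<preceq> Ident Q Y"
  by (auto simp: adjoint_def Hom_def)

text \<open>The unit and the counit of \<open>g\<close> give the two directions. Together with
  \<open>adjoint_mate_left\<close> this is how right adjoints are moved across inequalities in what
  follows.\<close>

lemma adjoint_mate_right:
  assumes g: "g \<in> Hom Q U X" and adj: "adjoint Q g g'" and p: "p \<in> Hom Q U Y" and q: "q \<in> Hom Q X Y"
  shows "p \<cdot> g' \<preceq> q \<longleftrightarrow> p \<preceq> q \<cdot> g"
proof -
  have g': "g' \<in> Hom Q X U" "Ident Q U \<preceq> g' \<cdot> g" "g \<cdot> g' \<preceq> Ident Q X"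
    using adj adjoint_iff[OF g] by auto
  have ob: "U \<in> Ob Q" "X \<in> Ob Q" using g Hom_objects by blast+
  note [intro] = Comp_in_Hom Ident_in_Hom
  show ?thesis
  proof
    assume "p \<cdot> g' \<preceq> q"
    then have "(p \<cdot> g') \<cdot> g \<preceq> q \<cdot> g" using p g g'(1) q by (auto intro!: Comp_mono_left)
    moreover have "p \<cdot> Ident Q U \<preceq> p \<cdot> (g' \<cdot> g)"
      using p g g' ob by (intro Comp_mono_right) auto
    ultimately show "p \<preceq> q \<cdot> g"
      using Comp_assoc[OF g g'(1) p] Comp_Ident_right[OF p] p q g g'(1)
      by (auto intro!: Leq_trans[of p "p \<cdot> (g' \<cdot> g)" _ U Y])
  next
    assume "p \<preceq> q \<cdot> g"
    then have "p \<cdot> g' \<preceq> (q \<cdot> g) \<cdot> g'" using p g g'(1) q by (auto intro!: Comp_mono_left)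
    moreover have "q \<cdot> (g \<cdot> g') \<preceq> q \<cdot> Ident Q X"
      using q g g' ob by (intro Comp_mono_right) auto
    ultimately show "p \<cdot> g' \<preceq> q"
      using Comp_assoc[OF g'(1) g q] Comp_Ident_right[OF q] p q g g'(1)
      by (auto intro!: Leq_trans[of _ "q \<cdot> (g \<cdot> g')" q X Y])
  qed
qed

lemma adjoint_mate_left:
  assumes f: "f \<in> Hom Q U Y" and adj: "adjoint Q f f'" and p: "p \<in> Hom Q X U" and q: "q \<in> Hom Q X Y"
  shows "f \<cdot> p \<preceq> q \<longleftrightarrow> p \<preceq> f' \<cdot> q"
proof -
  have f': "f' \<in> Hom Q Y U" "Ident Q U \<preceq> f' \<cdot> f" "f \<cdot> f' \<preceq> Ident Q Y"
    using adj adjoint_iff[OF f] by auto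
  have ob: "U \<in> Ob Q" "Y \<in> Ob Q" using f Hom_objects by blast+
  note [intro] = Comp_in_Hom Ident_in_Hom
  show ?thesis
  proof
    assume "f \<cdot> p \<preceq> q"
    then have "f' \<cdot> (f \<cdot> p) \<preceq> f' \<cdot> q" using p f f'(1) q by (auto intro!: Comp_mono_right)
    moreover have "Ident Q U \<cdot> p \<preceq> (f' \<cdot> f) \<cdot> p"
      using p f f' ob by (intro Comp_mono_left) auto
    ultimately show "p \<preceq> f' \<cdot> q"
      using Comp_assoc[OF p f f'(1)] Comp_Ident_left[OF p] p q f f'(1)
      by (auto intro!: Leq_trans[of p "f' \<cdot> (f \<cdot> p)" _ X U])
  next
    assume "p \<preceq> f' \<cdot> q"
    then have "f \<cdot> p \<preceq> f \<cdot> (f' \<cdot> q)" using p f f'(1) q by (auto intro!: Comp_mono_right)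
    moreover have "(f \<cdot> f') \<cdot> q \<preceq> Ident Q Y \<cdot> q"
      using q f f' ob by (intro Comp_mono_left) auto
    ultimately show "f \<cdot> p \<preceq> q"
      using Comp_assoc[OF q f'(1) f] Comp_Ident_left[OF q] p q f f'(1)
      by (auto intro!: Leq_trans[of _ "f \<cdot> (f' \<cdot> q)" q X Y])
  qed
qed

text \<open>From \<open>f \<preceq> g\<close> follows
  \<open>f g' \<preceq> g g' \<preceq> 1\<close>, whose mate is the claim. The case
  \<open>f = g\<close> is uniqueness of right adjoints.\<close>

lemma adjoint_antimono:
  assumes "f \<in> Hom Q X Y" and "g \<in> Hom Q X Y" and "adjoint Q f f'" and "adjoint Q g g'" and "f \<preceq> g"
  shows "g' \<preceq> f'"
proof -
  have g': "g' \<in> Hom Q Y X" and le: "g \<cdot> g' \<preceq> Ident Q Y" using assms adjoint_iff by auto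
  have Y: "Y \<in> Ob Q" and f': "f' \<in> Hom Q Y X" using assms Hom_objects adjoint_iff by blast+
  have "f \<cdot> g' \<preceq> Ident Q Y"
    using assms g' Y le
    by (intro Leq_trans[OF Comp_mono_left[of f g X Y g' Y] le]) (auto intro: Comp_in_Hom Ident_in_Hom)
  then have "g' \<preceq> f' \<cdot> Ident Q Y"
    using adjoint_mate_left[of f X Y f' g' Y "Ident Q Y"] assms g' Y Ident_in_Hom by blast
  then show ?thesis using Comp_Ident_right[OF f'] by simp
qed

lemma adjoint_unique:
  assumes "adjoint Q f g" and "adjoint Q f h"
  shows "g = h"
proof -
  have f: "f \<in> Hom Q (Dom Q f) (Cod Q f)" using assms by (auto simp: adjoint_def Hom_def)
  have "g \<preceq> h" "h \<preceq> g" using adjoint_antimono[OF f f] Leq_refl[OF f] assms by blast+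
  then show ?thesis using adjoint_iff[OF f] assms Leq_antisym by blast
qed

lemma radj_eq: "adjoint Q f g \<Longrightarrow> radj Q f = g"
  unfolding radj_def using adjoint_unique by blast

lemma adjoint_Ident: "X \<in> Ob Q \<Longrightarrow> adjoint Q (Ident Q X) (Ident Q X)"
  using adjoint_iff[OF Ident_in_Hom[of X]] Comp_Ident_left[OF Ident_in_Hom[of X]]
    Leq_refl[OF Ident_in_Hom[of X]] Ident_in_Hom[of X]
  by simp

lemma adjoint_Comp:
  assumes f: "f \<in> Hom Q X Y" "adjoint Q f f'" and g: "g \<in> Hom Q Y Z" "adjoint Q g g'"
  shows "adjoint Q (g \<cdot> f) (f' \<cdot> g')"
proof -
  have H: "f' \<in> Hom Q Y X" "g' \<in> Hom Q Z Y" and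
    u: "Ident Q X \<preceq> f' \<cdot> f" "g \<cdot> g' \<preceq> Ident Q Z"
    using assms adjoint_iff by auto
  have ob: "X \<in> Ob Q" "Z \<in> Ob Q" using assms Hom_objects by blast+
  note [intro] = Comp_in_Hom Ident_in_Hom
  have gf: "g \<cdot> f \<in> Hom Q X Z" and g'f': "f' \<cdot> g' \<in> Hom Q Z X" using f g H by auto
  have "f \<preceq> g' \<cdot> (g \<cdot> f)"
    using adjoint_mate_left[of g Y Z g' f X "g \<cdot> f"] f g gf Leq_refl[OF gf] by blast
  then have "f \<cdot> Ident Q X \<preceq> g' \<cdot> (g \<cdot> f)" using Comp_Ident_right[OF f(1)] by simp
  then have "Ident Q X \<preceq> f' \<cdot> (g' \<cdot> (g \<cdot> f))"
    using adjoint_mate_left[of f X Y f' "Ident Q X" X "g' \<cdot> (g \<cdot> f)"] f g H ob by blast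
  moreover have "f \<cdot> (f' \<cdot> g') \<preceq> g'"
    using adjoint_mate_left[of f X Y f' "f' \<cdot> g'" Z g'] f H Leq_refl[OF g'f'] by blast
  then have "f \<cdot> (f' \<cdot> g') \<preceq> g' \<cdot> Ident Q Z" using Comp_Ident_right[OF H(2)] by simp
  then have "g \<cdot> (f \<cdot> (f' \<cdot> g')) \<preceq> Ident Q Z"
    using adjoint_mate_left[of g Y Z g' "f \<cdot> (f' \<cdot> g')" Z "Ident Q Z"] f g H ob by blast
  ultimately show ?thesis
    using adjoint_iff[OF gf] g'f' Comp_assoc[OF gf H(2) H(1)] Comp_assoc[OF g'f' f(1) g(1)] by simp
qed

section \<open>The category of left adjoints\<close>

lemma Hom_Map: "f \<in> Hom (Map Q) X Y \<longleftrightarrow> f \<in> Hom Q X Y \<and> left_adjoint Q f"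
  by (auto simp: Hom_def Map_def)

lemma Hom_MapI: "f \<in> Hom Q X Y \<Longrightarrow> adjoint Q f g \<Longrightarrow> f \<in> Hom (Map Q) X Y"
  by (auto simp: Hom_Map left_adjoint_def)

lemma Map_Hom: "f \<in> Hom (Map Q) X Y \<Longrightarrow> f \<in> Hom Q X Y"
  by (simp add: Hom_Map)

lemma Map_adjoint: "f \<in> Hom (Map Q) X Y \<Longrightarrow> adjoint Q f (radj Q f)"
  using radj_eq by (auto simp: Hom_Map left_adjoint_def)

lemma Map_radj: "f \<in> Hom (Map Q) X Y \<Longrightarrow> radj Q f \<in> Hom Q Y X"
  using Map_adjoint Map_Hom adjoint_iff by blast

lemma Map_unit: "f \<in> Hom (Map Q) X Y \<Longrightarrow> Ident Q X \<preceq> radj Q f \<cdot> f"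
  using Map_adjoint Map_Hom adjoint_iff by blast

lemma Map_counit: "f \<in> Hom (Map Q) X Y \<Longrightarrow> f \<cdot> radj Q f \<preceq> Ident Q Y"
  using Map_adjoint Map_Hom adjoint_iff by blast

lemma Map_simps [simp]: "Ob (Map Q) = Ob Q" "Ident (Map Q) = Ident Q" "Comp (Map Q) = Comp Q"
  "Dom (Map Q) = Dom Q" "Cod (Map Q) = Cod Q"
  by (simp_all add: Map_def)

lemma Map_Comp: "f \<in> Hom (Map Q) X Y \<Longrightarrow> g \<in> Hom (Map Q) Y Z \<Longrightarrow> g \<cdot> f \<in> Hom (Map Q) X Z"
  by (meson Map_adjoint Map_Hom adjoint_Comp Hom_MapI Comp_in_Hom)

lemma radj_Comp:
  "f \<in> Hom (Map Q) X Y \<Longrightarrow> g \<in> Hom (Map Q) Y Z \<Longrightarrow> radj Q (g \<cdot> f) = radj Q f \<cdot> radj Q g"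
  by (meson Map_adjoint Map_Hom adjoint_Comp radj_eq)

lemma Map_Ident: "X \<in> Ob Q \<Longrightarrow> Ident Q X \<in> Hom (Map Q) X X"
  using adjoint_Ident Hom_MapI Ident_in_Hom by blast

lemma radj_Ident: "X \<in> Ob Q \<Longrightarrow> radj Q (Ident Q X) = Ident Q X"
  using adjoint_Ident radj_eq by blast

lemma category_Map: "category (Map Q)"
proof
  show "\<And>f. f \<in> Arr (Map Q) \<Longrightarrow> Dom (Map Q) f \<in> Ob (Map Q)"
    and "\<And>f. f \<in> Arr (Map Q) \<Longrightarrow> Cod (Map Q) f \<in> Ob (Map Q)"
    using Dom_in_Ob Cod_in_Ob by (auto simp: Map_def)
qed (auto intro: Map_Ident Map_Comp Comp_assoc Comp_Ident_left Comp_Ident_right dest: Map_Hom)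

lemma Map_mate_right:
  "g \<in> Hom (Map Q) U X \<Longrightarrow> p \<in> Hom Q U Y \<Longrightarrow> q \<in> Hom Q X Y \<Longrightarrow> p \<cdot> radj Q g \<preceq> q \<longleftrightarrow> p \<preceq> q \<cdot> g"
  using adjoint_mate_right Map_adjoint Map_Hom by blast

lemma Map_mate_left:
  "f \<in> Hom (Map Q) U Y \<Longrightarrow> p \<in> Hom Q X U \<Longrightarrow> q \<in> Hom Q X Y \<Longrightarrow> f \<cdot> p \<preceq> q \<longleftrightarrow> p \<preceq> radj Q f \<cdot> q"
  using adjoint_mate_left Map_adjoint Map_Hom by blast

lemma span_in_Hom:
  "f \<in> Hom (Map Q) U Y \<Longrightarrow> g \<in> Hom (Map Q) U X \<Longrightarrow> f \<cdot> radj Q g \<in> Hom Q X Y"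
  using Map_radj Map_Hom Comp_in_Hom by blast

end

lemma spans_iff: "(f, g) \<in> spans C X Y \<longleftrightarrow> (\<exists>U. f \<in> Hom C U Y \<and> g \<in> Hom C U X)"
  by (auto simp: spans_def Hom_def)

section \<open>Cribles\<close>

lemma is_cribleI:
  assumes "\<And>f g. (f, g) \<in> R \<Longrightarrow> \<exists>U. f \<in> Hom C U Y \<and> g \<in> Hom C U X"
    and "\<And>f g h U V. (f, g) \<in> R \<Longrightarrow> f \<in> Hom C U Y \<Longrightarrow> g \<in> Hom C U X \<Longrightarrow> h \<in> Hom C V U \<Longrightarrow>
      (f \<cdot>\<^bsub>C\<^esub> h, g \<cdot>\<^bsub>C\<^esub> h) \<in> R"
  shows "is_crible C X Y R"
proof -
  have "R \<subseteq> spans C X Y" using assms(1) spans_iff by fast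
  moreover have "(f \<cdot>\<^bsub>C\<^esub> h, g \<cdot>\<^bsub>C\<^esub> h) \<in> R"
    if "(f, g) \<in> R" "h \<in> Arr C" "Cod C h = Dom C f" for f g h
    using assms(1)[OF that(1)] assms(2)[OF that(1), of _ h "Dom C h"] that(2,3) by (auto simp: Hom_def)
  ultimately show ?thesis by (auto simp: is_crible_def)
qed

lemma crible_span: "is_crible C X Y R \<Longrightarrow> (f, g) \<in> R \<Longrightarrow> \<exists>U. f \<in> Hom C U Y \<and> g \<in> Hom C U X"
  using spans_iff by (fastforce simp: is_crible_def)

lemma crible_Comp:
  "is_crible C X Y R \<Longrightarrow> (f, g) \<in> R \<Longrightarrow> f \<in> Hom C U Z \<Longrightarrow> h \<in> Hom C V U \<Longrightarrow>
    (f \<cdot>\<^bsub>C\<^esub> h, g \<cdot>\<^bsub>C\<^esub> h) \<in> R"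
  by (fastforce simp: is_crible_def Hom_def)

lemma cribles_simps [simp]:
  "Ob (cribles C) = Ob C"
  "Ident (cribles C) X = (X, {(f, f) | f. f \<in> Arr C \<and> Cod C f = X}, X)"
  "(X, R, Y) \<preceq>\<^bsub>cribles C\<^esub> (X', S, Y') \<longleftrightarrow> X = X' \<and> Y = Y' \<and> R \<subseteq> S"
  "Dom (cribles C) (X, R, Y) = X"
  "Cod (cribles C) (X, R, Y) = Y"
  by (simp_all add: cribles_def)

text \<open>The intermediate arrow \<open>t\<close> is automatically in \<open>Arr C\<close> because
  \<open>R\<close> consists of spans. As the first leg of a span is the one into the target,
  composition of cribles is relational composition in the same order, and associativity is
  \<open>O_assoc\<close>.\<close>

lemma Comp_cribles [simp]:
  "is_crible C X Y R \<Longrightarrow> (Y', S, Z) \<cdot>\<^bsub>cribles C\<^esub> (X, R, Y) = (X, S O R, Z)"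
  by (fastforce simp: cribles_def is_crible_def spans_def)

lemma Hom_cribles:
  "r \<in> Hom (cribles C) X Y \<longleftrightarrow> (\<exists>R. r = (X, R, Y) \<and> X \<in> Ob C \<and> Y \<in> Ob C \<and> is_crible C X Y R)"
  by (auto simp: Hom_def cribles_def)

lemma Hom_cribles_triple [simp]:
  "(X', R, Y') \<in> Hom (cribles C) X Y \<longleftrightarrow> X' = X \<and> Y' = Y \<and> X \<in> Ob C \<and> Y \<in> Ob C \<and> is_crible C X Y R"
  by (auto simp: Hom_cribles)

lemma is_crible_Union: "(\<And>R. R \<in> \<R> \<Longrightarrow> is_crible C X Y R) \<Longrightarrow> is_crible C X Y (\<Union>\<R>)"
  unfolding is_crible_def by blast

lemma is_crible_Int: "is_crible C X Y R \<Longrightarrow> is_crible C X Y S \<Longrightarrow> is_crible C X Y (R \<inter> S)"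
  unfolding is_crible_def by blast

context category
begin

lemma is_crible_Ident: "is_crible C X X {(f, f) | f. f \<in> Arr C \<and> Cod C f = X}"
proof (rule is_cribleI)
  fix f g h U V assume "(f, g) \<in> {(f, f) |f. f \<in> Arr C \<and> Cod C f = X}" "f \<in> Hom C U X" "h \<in> Hom C V U"
  then show "(f \<cdot> h, g \<cdot> h) \<in> {(f, f) |f. f \<in> Arr C \<and> Cod C f = X}"
    using Comp_in_Hom[of h V U f X] by (auto simp: Hom_def)
qed (auto simp: Hom_def)

lemma is_crible_relcomp:
  assumes R: "is_crible C X Y R" and S: "is_crible C Y Z S"
  shows "is_crible C X Z (S O R)"
proof (rule is_cribleI)
  fix f g assume "(f, g) \<in> S O R"
  then obtain t where t: "(f, t) \<in> S" "(t, g) \<in> R" by blast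
  then show "\<exists>U. f \<in> Hom C U Z \<and> g \<in> Hom C U X"
    using crible_span[OF S t(1)] crible_span[OF R t(2)] by (auto simp: Hom_def)
next
  fix f g h U V assume *: "(f, g) \<in> S O R" "f \<in> Hom C U Z" "h \<in> Hom C V U"
  then obtain t where t: "(f, t) \<in> S" "(t, g) \<in> R" by blast
  have "t \<in> Hom C U Y" using crible_span[OF S t(1)] *(2) by (auto simp: Hom_def)
  then show "(f \<cdot> h, g \<cdot> h) \<in> S O R"
    using crible_Comp[OF S t(1) *(2,3)] crible_Comp[OF R t(2) _ *(3)] by blast
qed

lemma category_cribles: "category (cribles C)"
proof (rule category.intro)
  show "\<And>f. f \<in> Arr (cribles C) \<Longrightarrow> Dom (cribles C) f \<in> Ob (cribles C)"
    and "\<And>f. f \<in> Arr (cribles C) \<Longrightarrow> Cod (cribles C) f \<in> Ob (cribles C)"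
    by (auto simp: cribles_def)
next
  fix X Y r assume "r \<in> Hom (cribles C) X Y"
  then obtain R where r: "r = (X, R, Y)" "X \<in> Ob C" "Y \<in> Ob C" "is_crible C X Y R"
    by (auto simp: Hom_cribles)
  have "f \<in> Arr C \<and> g \<in> Arr C \<and> Cod C f = Y \<and> Cod C g = X" if "(f, g) \<in> R" for f g
    using crible_span[OF r(4) that] by (auto simp: Hom_def)
  then have "{(f, f) |f. f \<in> Arr C \<and> Cod C f = Y} O R = R" "R O {(f, f) |f. f \<in> Arr C \<and> Cod C f = X} = R"
    by (auto simp: relcomp_unfold)
  then show "Ident (cribles C) Y \<cdot>\<^bsub>cribles C\<^esub> r = r" "r \<cdot>\<^bsub>cribles C\<^esub> Ident (cribles C) X = r"
    using r is_crible_Ident by simp_all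
qed (auto simp: Hom_cribles is_crible_Ident is_crible_relcomp O_assoc)

lemma quantaloid_cribles: "quantaloid (cribles C)"
proof (rule quantaloidI[where S = "\<lambda>X Y A. (X, \<Union>((\<lambda>(X, R, Y). R) ` A), Y)"])
  fix X Y A assume "X \<in> Ob (cribles C)" "Y \<in> Ob (cribles C)" "A \<subseteq> Hom (cribles C) X Y"
  then show "(X, \<Union>((\<lambda>(X, R, Y). R) ` A), Y) \<in> Hom (cribles C) X Y"
    by (fastforce simp: Hom_cribles intro!: is_crible_Union)
next
  fix X Y Z A g u assume *: "g \<in> Hom (cribles C) Y Z" "A \<subseteq> Hom (cribles C) X Y" "u \<in> Hom (cribles C) X Z"
    "\<And>a. a \<in> A \<Longrightarrow> g \<cdot>\<^bsub>cribles C\<^esub> a \<preceq>\<^bsub>cribles C\<^esub> u"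
  have "is_crible C X Y (\<Union>((\<lambda>(X, R, Y). R) ` A))"
    using * by (fastforce simp: Hom_cribles intro!: is_crible_Union)
  then show "g \<cdot>\<^bsub>cribles C\<^esub> (X, \<Union>((\<lambda>(X, R, Y). R) ` A), Y) \<preceq>\<^bsub>cribles C\<^esub> u"
    using * by (fastforce simp: Hom_cribles)
next
  fix X Y Z A f u assume *: "f \<in> Hom (cribles C) X Y" "A \<subseteq> Hom (cribles C) Y Z" "u \<in> Hom (cribles C) X Z"
    "\<And>a. a \<in> A \<Longrightarrow> a \<cdot>\<^bsub>cribles C\<^esub> f \<preceq>\<^bsub>cribles C\<^esub> u"
  then show "(Y, \<Union>((\<lambda>(X, R, Y). R) ` A), Z) \<cdot>\<^bsub>cribles C\<^esub> f \<preceq>\<^bsub>cribles C\<^esub> u"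
    by (fastforce simp: Hom_cribles)
qed (use category_cribles in \<open>fastforce simp: Hom_cribles\<close>)+

end

section \<open>The comparison functor\<close>

definition crible_below :: "('o, 'a, 'm) quantaloid_scheme \<Rightarrow> 'a \<Rightarrow> ('o, 'a) crible"
  where "crible_below Q q = (Dom Q q,
    {(f, g) \<in> spans (Map Q) (Dom Q q) (Cod Q q). f \<cdot>\<^bsub>Q\<^esub> radj Q g \<preceq>\<^bsub>Q\<^esub> q}, Cod Q q)"

context quantaloid
begin

interpretation maps: category "Map Q" by (rule category_Map)
interpretation cr: quantaloid "cribles (Map Q)" by (rule maps.quantaloid_cribles)

lemma crible_below_eq: "q \<in> Hom Q X Y \<Longrightarrow>
    crible_below Q q = (X, {(f, g) \<in> spans (Map Q) X Y. f \<cdot> radj Q g \<preceq> q}, Y)"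
  by (auto simp: crible_below_def Hom_def)

lemma mem_crible_below:
  "(f, g) \<in> {(f, g) \<in> spans (Map Q) X Y. f \<cdot> radj Q g \<preceq> q} \<longleftrightarrow>
    (\<exists>U. f \<in> Hom (Map Q) U Y \<and> g \<in> Hom (Map Q) U X \<and> f \<cdot> radj Q g \<preceq> q)"
  by (auto simp: spans_iff)

text \<open>Isolates the factor \<open>h \<cdot> radj Q k\<close> in the middle of a composed span,
  where weak tabularity, a covering sieve or a counit can act on it.\<close>

lemma span_Comp_eq:
  assumes f: "f \<in> Hom (Map Q) U Y" and h: "h \<in> Hom (Map Q) V U"
    and k: "k \<in> Hom (Map Q) V U'" and g': "g' \<in> Hom (Map Q) U' X'"
  shows "(f \<cdot> h) \<cdot> radj Q (g' \<cdot> k) = f \<cdot> ((h \<cdot> radj Q k) \<cdot> radj Q g')"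
proof -
  have H: "f \<in> Hom Q U Y" "h \<in> Hom Q V U" "radj Q k \<in> Hom Q U' V" "radj Q g' \<in> Hom Q X' U'"
    using assms Map_Hom Map_radj by blast+
  then show ?thesis
    using radj_Comp[OF k g'] Comp_assoc[OF Comp_in_Hom[OF H(4,3)] H(2,1)] Comp_assoc[OF H(4,3,2)] by simp
qed

text \<open>By the counit of \<open>h\<close>; this is why the spans below a given arrow are closed
  under precomposition.\<close>

lemma span_Comp_le:
  assumes f: "f \<in> Hom (Map Q) U Y" and g: "g \<in> Hom (Map Q) U X" and h: "h \<in> Hom (Map Q) V U"
  shows "(f \<cdot> h) \<cdot> radj Q (g \<cdot> h) \<preceq> f \<cdot> radj Q g"
proof -
  have H: "f \<in> Hom Q U Y" "radj Q g \<in> Hom Q X U" "h \<cdot> radj Q h \<in> Hom Q U U" "U \<in> Ob Q"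
    using assms Map_Hom Map_radj span_in_Hom Hom_objects by blast+
  have "(h \<cdot> radj Q h) \<cdot> radj Q g \<preceq> Ident Q U \<cdot> radj Q g"
    using Map_counit[OF h] H by (intro Comp_mono_left) (auto intro: Ident_in_Hom)
  then have "f \<cdot> ((h \<cdot> radj Q h) \<cdot> radj Q g) \<preceq> f \<cdot> radj Q g"
    using H Comp_Ident_left[OF H(2)] by (intro Comp_mono_right) (auto intro: Comp_in_Hom)
  then show ?thesis using span_Comp_eq[OF f h h g] by simp
qed

lemma crible_below_in_Hom:
  assumes "q \<in> Hom Q X Y"
  shows "crible_below Q q \<in> Hom (cribles (Map Q)) X Y"
proof -
  have "is_crible (Map Q) X Y {(f, g) \<in> spans (Map Q) X Y. f \<cdot> radj Q g \<preceq> q}"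
  proof (rule is_cribleI)
    fix f g h U V
    assume *: "(f, g) \<in> {(f, g) \<in> spans (Map Q) X Y. f \<cdot> radj Q g \<preceq> q}"
      "f \<in> Hom (Map Q) U Y" "g \<in> Hom (Map Q) U X" "h \<in> Hom (Map Q) V U"
    then have "f \<cdot> radj Q g \<preceq> q" by blast
    then have "(f \<cdot> h) \<cdot> radj Q (g \<cdot> h) \<preceq> q"
      using Leq_trans[OF span_Comp_le[OF *(2-4)], of q X Y] assms * span_in_Hom Map_Comp by blast
    then show "(f \<cdot>\<^bsub>Map Q\<^esub> h, g \<cdot>\<^bsub>Map Q\<^esub> h) \<in> {(f, g) \<in> spans (Map Q) X Y. f \<cdot> radj Q g \<preceq> q}"
      unfolding mem_crible_below Map_simps using *(2-4) by (meson Map_Comp)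
  qed (auto simp: spans_iff)
  then show ?thesis using crible_below_eq[OF assms] Hom_objects[OF assms] by simp
qed

lemma span_set_subset:
  assumes "is_crible (Map Q) X Y R"
  shows "{f \<cdot> radj Q g | f g. (f, g) \<in> R} \<subseteq> Hom Q X Y"
  using crible_span[OF assms] span_in_Hom by blast

lemma crible_join_in_Hom:
  assumes "r \<in> Hom (cribles (Map Q)) X Y"
  shows "crible_join Q r \<in> Hom Q X Y"
  using assms by (auto simp: Hom_cribles crible_join_def intro!: Join_in_Hom dest!: span_set_subset)

lemma crible_join_eq: "crible_join Q (X, R, Y) = Join X Y {f \<cdot> radj Q g | f g. (f, g) \<in> R}"
  by (simp add: crible_join_def)

lemma span_le_crible_join:
  assumes R: "(X, R, Y) \<in> Hom (cribles (Map Q)) X Y" and fg: "(f, g) \<in> R"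
  shows "f \<cdot> radj Q g \<preceq> crible_join Q (X, R, Y)"
  using R fg span_set_subset[of X Y R] unfolding crible_join_def
  by (auto intro!: Join_upper)

lemma crible_join_le:
  assumes R: "(X, R, Y) \<in> Hom (cribles (Map Q)) X Y" and u: "u \<in> Hom Q X Y"
    and le: "\<And>U f g. f \<in> Hom (Map Q) U Y \<Longrightarrow> g \<in> Hom (Map Q) U X \<Longrightarrow> (f, g) \<in> R \<Longrightarrow> f \<cdot> radj Q g \<preceq> u"
  shows "crible_join Q (X, R, Y) \<preceq> u"
proof -
  have "f \<cdot> radj Q g \<preceq> u" if "(f, g) \<in> R" for f g
    using R that le crible_span[of "Map Q" X Y R f g] by auto
  then show ?thesis
    using R u span_set_subset[of X Y R] unfolding crible_join_def by (auto intro!: Join_least)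
qed

lemma crible_join_le_iff:
  assumes r: "r \<in> Hom (cribles (Map Q)) X Y" and q: "q \<in> Hom Q X Y"
  shows "crible_join Q r \<preceq> q \<longleftrightarrow> r \<preceq>\<^bsub>cribles (Map Q)\<^esub> crible_below Q q"
proof -
  obtain R where R: "r = (X, R, Y)" "is_crible (Map Q) X Y R" using r by (auto simp: Hom_cribles)
  have H: "(X, R, Y) \<in> Hom (cribles (Map Q)) X Y" using R r by simp
  have iff: "r \<preceq>\<^bsub>cribles (Map Q)\<^esub> crible_below Q q \<longleftrightarrow> (\<forall>(f, g)\<in>R. f \<cdot> radj Q g \<preceq> q)"
    using R(2) unfolding crible_below_eq[OF q] R(1) is_crible_def by auto
  show ?thesis
  proof
    assume "crible_join Q r \<preceq> q"
    then have "f \<cdot> radj Q g \<preceq> q" if "(f, g) \<in> R" for f g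
      using span_le_crible_join[OF H that] R crible_join_in_Hom[OF r] q crible_span[OF R(2) that]
      by (auto intro: Leq_trans[of _ "crible_join Q r" _ X Y] span_in_Hom)
    then show "r \<preceq>\<^bsub>cribles (Map Q)\<^esub> crible_below Q q" using iff by auto
  next
    assume "r \<preceq>\<^bsub>cribles (Map Q)\<^esub> crible_below Q q"
    then show "crible_join Q r \<preceq> q"
      using iff crible_join_le[OF H q] R(1) by blast
  qed
qed

lemma weakly_tabular_iff:
  "weakly_tabular Q \<longleftrightarrow> (\<forall>X Y. \<forall>q\<in>Hom Q X Y. crible_join Q (crible_below Q q) = q)"
proof -
  have "crible_join Q (crible_below Q q) = Join X Y {f \<cdot> radj Q g | f g.
      (f, g) \<in> spans (Map Q) X Y \<and> f \<cdot> radj Q g \<preceq> q}" if "q \<in> Hom Q X Y" for X Y q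
    unfolding crible_below_eq[OF that] by (simp add: crible_join_def)
  then show ?thesis unfolding weakly_tabular_def by (metis (no_types, lifting))
qed

text \<open>The condition \<open>f \<cdot> radj Q g \<preceq> q\<close> is replaced by its mate, and
  the supremum by a test against all \<open>u\<close>. The criterion asks which arrows are left
  adjoints, not what their right adjoints are; \<open>weakly_tabular_Leq\<close> is its
  converse.\<close>

lemma weakly_tabularI:
  assumes "\<And>X Y q u. q \<in> Hom Q X Y \<Longrightarrow> u \<in> Hom Q X Y \<Longrightarrow>
    (\<And>U f g. f \<in> Hom (Map Q) U Y \<Longrightarrow> g \<in> Hom (Map Q) U X \<Longrightarrow> f \<preceq> q \<cdot> g \<Longrightarrow> f \<preceq> u \<cdot> g) \<Longrightarrow> q \<preceq> u"
  shows "weakly_tabular Q"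
  unfolding weakly_tabular_iff
proof (intro allI ballI)
  fix X Y q assume q: "q \<in> Hom Q X Y"
  let ?u = "crible_join Q (crible_below Q q)"
  have H: "crible_below Q q \<in> Hom (cribles (Map Q)) X Y" using q by (rule crible_below_in_Hom)
  have u: "?u \<in> Hom Q X Y" using H by (rule crible_join_in_Hom)
  have "?u \<preceq> q" using crible_join_le_iff[OF H q] cr.Leq_refl[OF H] by blast
  moreover have "q \<preceq> ?u"
  proof (rule assms[OF q u])
    fix U f g assume *: "f \<in> Hom (Map Q) U Y" "g \<in> Hom (Map Q) U X" "f \<preceq> q \<cdot> g"
    then have "f \<cdot> radj Q g \<preceq> q" using Map_mate_right q Map_Hom by blast
    then have "f \<cdot> radj Q g \<preceq> ?u"
      using span_le_crible_join[of X "{(f, g) \<in> spans (Map Q) X Y. f \<cdot> radj Q g \<preceq> q}" Y f g] H *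
      unfolding crible_below_eq[OF q] mem_crible_below by blast
    then show "f \<preceq> ?u \<cdot> g" using Map_mate_right * u Map_Hom by blast
  qed
  ultimately show "?u = q" using Leq_antisym u q by blast
qed

lemma weakly_tabular_Leq:
  assumes "weakly_tabular Q" and q: "q \<in> Hom Q X Y" and u: "u \<in> Hom Q X Y"
    and le: "\<And>U f g. f \<in> Hom (Map Q) U Y \<Longrightarrow> g \<in> Hom (Map Q) U X \<Longrightarrow> f \<preceq> q \<cdot> g \<Longrightarrow> f \<preceq> u \<cdot> g"
  shows "q \<preceq> u"
proof -
  have "crible_join Q (crible_below Q q) \<preceq> u"
    unfolding crible_below_eq[OF q]
  proof (rule crible_join_le[OF _ u])
    show "(X, {(f, g) \<in> spans (Map Q) X Y. f \<cdot> radj Q g \<preceq> q}, Y) \<in> Hom (cribles (Map Q)) X Y"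
      using crible_below_in_Hom[OF q] unfolding crible_below_eq[OF q] .
    fix U f g assume f: "f \<in> Hom (Map Q) U Y" and g: "g \<in> Hom (Map Q) U X"
      and "(f, g) \<in> {(f, g) \<in> spans (Map Q) X Y. f \<cdot> radj Q g \<preceq> q}"
    then have "f \<cdot> radj Q g \<preceq> q" by blast
    then show "f \<cdot> radj Q g \<preceq> u"
      using le[OF f g] Map_mate_right[OF g Map_Hom[OF f] q] Map_mate_right[OF g Map_Hom[OF f] u] by blast
  qed
  then show ?thesis using assms(1) q unfolding weakly_tabular_iff by auto
qed

text \<open>An inequality for \<open>q\<close> inside a composite may be checked on the spans below
  \<open>q\<close>. Applied with \<open>q\<close> of the form \<open>radj Q g \<cdot> m\<close>, or
  a meet of two such, it produces the squares from which functoriality and preservation of meets are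
  read off.\<close>

lemma weakly_tabular_sandwich:
  assumes "weakly_tabular Q" and q: "q \<in> Hom Q X Y" and p: "p \<in> Hom Q Y Z" and n: "n \<in> Hom Q W X"
    and u: "u \<in> Hom Q W Z"
    and le: "\<And>U f g. f \<in> Hom (Map Q) U Y \<Longrightarrow> g \<in> Hom (Map Q) U X \<Longrightarrow> f \<cdot> radj Q g \<preceq> q \<Longrightarrow>
      p \<cdot> ((f \<cdot> radj Q g) \<cdot> n) \<preceq> u"
  shows "p \<cdot> (q \<cdot> n) \<preceq> u"
proof -
  let ?A = "{f \<cdot> radj Q g | f g. (f, g) \<in> spans (Map Q) X Y \<and> f \<cdot> radj Q g \<preceq> q}"
  have A: "?A \<subseteq> Hom Q X Y" using span_in_Hom by (auto simp: spans_iff)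
  have "q = Join X Y ?A" using assms(1) q by (auto simp: weakly_tabular_def)
  moreover have "p \<cdot> (Join X Y ?A \<cdot> n) \<preceq> u"
    using le by (intro Comp_Join_Comp_le[OF A p n u]) (auto simp: spans_iff)
  ultimately show ?thesis by simp
qed

section \<open>Identities and composition under the comparison\<close>

lemma crible_join_Ident:
  assumes X: "X \<in> Ob Q"
  shows "crible_join Q (Ident (cribles (Map Q)) X) = Ident Q X"
proof -
  let ?I = "{(f, f) | f. f \<in> Arr (Map Q) \<and> Cod (Map Q) f = X}"
  have H: "(X, ?I, X) \<in> Hom (cribles (Map Q)) X X" using cr.Ident_in_Hom[of X] X by simp
  have "crible_join Q (X, ?I, X) \<preceq> Ident Q X"
    using Map_counit Ident_in_Hom[OF X] by (intro crible_join_le[OF H]) auto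
  moreover have "Ident Q X \<cdot> radj Q (Ident Q X) \<preceq> crible_join Q (X, ?I, X)"
    using Map_Ident[OF X] by (intro span_le_crible_join[OF H]) (auto simp: Hom_def)
  ultimately show ?thesis
    using radj_Ident[OF X] Ident_in_Hom[OF X] Comp_Ident_left[OF Ident_in_Hom[OF X]]
      crible_join_in_Hom[OF H] Leq_antisym by fastforce
qed

text \<open>For \<open>(f, t)\<close> in \<open>S\<close> and \<open>(t, g)\<close> in
  \<open>R\<close>, pass to mates: \<open>f \<preceq> F(S) t\<close> and
  \<open>t \<preceq> F(R) g\<close> chain to \<open>f \<preceq> F(S) F(R) g\<close>.\<close>

lemma crible_join_Comp_le:
  assumes R: "(X, R, Y) \<in> Hom (cribles (Map Q)) X Y" and S: "(Y, S, Z) \<in> Hom (cribles (Map Q)) Y Z"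
  shows "crible_join Q (X, S O R, Z) \<preceq> crible_join Q (Y, S, Z) \<cdot> crible_join Q (X, R, Y)"
proof (rule crible_join_le)
  show "(X, S O R, Z) \<in> Hom (cribles (Map Q)) X Z" using R S maps.is_crible_relcomp by auto
  have J: "crible_join Q (Y, S, Z) \<in> Hom Q Y Z" "crible_join Q (X, R, Y) \<in> Hom Q X Y"
    using R S crible_join_in_Hom by blast+
  then show C: "crible_join Q (Y, S, Z) \<cdot> crible_join Q (X, R, Y) \<in> Hom Q X Z" using Comp_in_Hom by blast
  fix U f g assume f: "f \<in> Hom (Map Q) U Z" and g: "g \<in> Hom (Map Q) U X" and "(f, g) \<in> S O R"
  then obtain t where t: "(f, t) \<in> S" "(t, g) \<in> R" by blast
  then have tH: "t \<in> Hom (Map Q) U Y"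
    using crible_span[of "Map Q" Y Z S f t] S Hom_Dom_Cod[OF f]
    by (auto dest: Hom_Dom_Cod)
  have le: "f \<preceq> crible_join Q (Y, S, Z) \<cdot> t" "t \<preceq> crible_join Q (X, R, Y) \<cdot> g"
    using span_le_crible_join[OF S t(1)] span_le_crible_join[OF R t(2)]
      Map_mate_right[OF tH Map_Hom[OF f] J(1)] Map_mate_right[OF g Map_Hom[OF tH] J(2)] by blast+
  have "f \<preceq> crible_join Q (Y, S, Z) \<cdot> (crible_join Q (X, R, Y) \<cdot> g)"
    using Comp_mono_right[OF le(2) Map_Hom[OF tH] Comp_in_Hom[OF Map_Hom[OF g] J(2)] J(1)]
      Map_Hom[OF f] Map_Hom[OF g] Map_Hom[OF tH] J
    by (blast intro: Leq_trans[OF le(1), of _ U Z] Comp_in_Hom)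
  then show "f \<cdot> radj Q g \<preceq> crible_join Q (Y, S, Z) \<cdot> crible_join Q (X, R, Y)"
    using Map_mate_right[OF g Map_Hom[OF f] C] Comp_assoc[OF Map_Hom[OF g] J(2,1)] by simp
qed

lemma map_eqI:
  assumes "map_discrete Q" and "f \<in> Hom (Map Q) X Y" and "g \<in> Hom (Map Q) X Y" and "f \<preceq> g"
  shows "f = g"
  using assms by (auto simp: map_discrete_def Hom_Map)

text \<open>Moving \<open>radj Q k\<close> and \<open>radj Q g\<close> to the other side turns the
  hypothesis into \<open>g h \<preceq> m k\<close>, an inequality between two maps.\<close>

lemma span_le_radj_Comp:
  assumes d: "map_discrete Q" and h: "h \<in> Hom (Map Q) W U" and k: "k \<in> Hom (Map Q) W V"
    and g: "g \<in> Hom (Map Q) U Y" and m: "m \<in> Hom (Map Q) V Y"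
    and le: "h \<cdot> radj Q k \<preceq> radj Q g \<cdot> m"
  shows "g \<cdot> h = m \<cdot> k"
proof (rule map_eqI[OF d])
  show gh: "g \<cdot> h \<in> Hom (Map Q) W Y" and "m \<cdot> k \<in> Hom (Map Q) W Y" using h k g m Map_Comp by blast+
  note H = h[THEN Map_Hom] k[THEN Map_Hom] g[THEN Map_Hom] m[THEN Map_Hom] Map_radj[OF g]
  have "h \<preceq> (radj Q g \<cdot> m) \<cdot> k"
    using le Map_mate_right[OF k H(1) Comp_in_Hom[OF H(4,5)]] by blast
  then have "h \<preceq> radj Q g \<cdot> (m \<cdot> k)" using Comp_assoc[OF H(2,4,5)] by simp
  then show "g \<cdot> h \<preceq> m \<cdot> k" using Map_mate_left[OF g H(1) Comp_in_Hom[OF H(2,4)]] by blast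
qed

text \<open>For \<open>(f, g)\<close> in \<open>S\<close> and \<open>(m, n)\<close> in
  \<open>R\<close>, the factor \<open>radj Q g \<cdot> m\<close> is resolved into spans
  \<open>(h, k)\<close>. The common value \<open>g h = m k\<close> is then the intermediate arrow
  that puts \<open>(f h, n k)\<close> into \<open>S O R\<close>.\<close>

lemma crible_join_Comp:
  assumes d: "map_discrete Q" and wt: "weakly_tabular Q"
    and R: "(X, R, Y) \<in> Hom (cribles (Map Q)) X Y" and S: "(Y, S, Z) \<in> Hom (cribles (Map Q)) Y Z"
  shows "crible_join Q (X, S O R, Z) = crible_join Q (Y, S, Z) \<cdot> crible_join Q (X, R, Y)"
proof -
  let ?u = "crible_join Q (X, S O R, Z)"
  have SR: "(X, S O R, Z) \<in> Hom (cribles (Map Q)) X Z" using R S maps.is_crible_relcomp by auto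
  then have u: "?u \<in> Hom Q X Z" by (rule crible_join_in_Hom)
  have J: "crible_join Q (Y, S, Z) \<in> Hom Q Y Z" "crible_join Q (X, R, Y) \<in> Hom Q X Y"
    using R S crible_join_in_Hom by blast+
  have cr: "is_crible (Map Q) X Y R" "is_crible (Map Q) Y Z S" using R S by simp_all
  have span: "(f \<cdot> radj Q g) \<cdot> (m \<cdot> radj Q n) \<preceq> ?u" if fg: "(f, g) \<in> S" and mn: "(m, n) \<in> R" for f g m n
  proof -
    obtain U V where f: "f \<in> Hom (Map Q) U Z" and g: "g \<in> Hom (Map Q) U Y"
      and m: "m \<in> Hom (Map Q) V Y" and n: "n \<in> Hom (Map Q) V X"
      using crible_span[OF cr(2) fg] crible_span[OF cr(1) mn] by blast
    note H = f[THEN Map_Hom] g[THEN Map_radj] m[THEN Map_Hom] n[THEN Map_radj]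
    have "f \<cdot> ((radj Q g \<cdot> m) \<cdot> radj Q n) \<preceq> ?u"
    proof (rule weakly_tabular_sandwich[OF wt Comp_in_Hom[OF H(3,2)] H(1,4) u])
      fix W h k assume h: "h \<in> Hom (Map Q) W U" and k: "k \<in> Hom (Map Q) W V"
        and "h \<cdot> radj Q k \<preceq> radj Q g \<cdot> m"
      then have "g \<cdot> h = m \<cdot> k" using span_le_radj_Comp[OF d h k g m] by blast
      then have fh: "(f \<cdot> h, n \<cdot> k) \<in> S O R"
        using crible_Comp[OF cr(2) fg f h] crible_Comp[OF cr(1) mn m k] by auto
      then show "f \<cdot> ((h \<cdot> radj Q k) \<cdot> radj Q n) \<preceq> ?u"
        using span_le_crible_join[OF SR fh] span_Comp_eq[OF f h k n] by simp
    qed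
    then show ?thesis
      using Comp_assoc[OF Comp_in_Hom[OF H(4,3)] H(2,1)] Comp_assoc[OF H(4,3,2)] by simp
  qed
  have "crible_join Q (Y, S, Z) \<cdot> crible_join Q (X, R, Y) \<preceq> ?u"
  proof -
    have "(f \<cdot> radj Q g) \<cdot> crible_join Q (X, R, Y) \<preceq> ?u" if fg: "(f, g) \<in> S" for f g
    proof -
      have "f \<cdot> radj Q g \<in> Hom Q Y Z" using fg span_set_subset[OF cr(2)] by blast
      then show ?thesis unfolding crible_join_eq[of X R Y]
        using span[OF fg] by (intro Comp_Join_le[OF _ span_set_subset[OF cr(1)] u]) auto
    qed
    then show ?thesis
      using span_set_subset[OF cr(2)] J(2) u
      by (auto simp: crible_join_eq[of Y S Z] intro!: Join_Comp_le)
  qed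
  then show ?thesis
    using crible_join_Comp_le[OF R S] u J Comp_in_Hom Leq_antisym by blast
qed

lemma sup_functor_crible_join:
  assumes "map_discrete Q" and "weakly_tabular Q"
  shows "sup_functor (cribles (Map Q)) Q id (crible_join Q)"
proof (rule sup_functorI_residuated)
  show "category_functor (cribles (Map Q)) Q id (crible_join Q)"
  proof
    fix r s X Y Z assume "r \<in> Hom (cribles (Map Q)) X Y" "s \<in> Hom (cribles (Map Q)) Y Z"
    then show "crible_join Q (s \<cdot>\<^bsub>cribles (Map Q)\<^esub> r) = crible_join Q s \<cdot> crible_join Q r"
      using crible_join_Comp[OF assms] by (auto simp: Hom_cribles)
  qed (use crible_join_Ident crible_join_in_Hom in auto)
  fix X Y u assume "u \<in> Hom Q (id X) (id Y)"
  then show "\<exists>r\<in>Hom (cribles (Map Q)) X Y. \<forall>q\<in>Hom (cribles (Map Q)) X Y.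
      crible_join Q q \<preceq> u \<longleftrightarrow> q \<preceq>\<^bsub>cribles (Map Q)\<^esub> r"
    using crible_below_in_Hom crible_join_le_iff by auto
qed unfold_locales

text \<open>By residuation a value \<open>F r\<close> is fixed by \<open>F\<close> after
  \<open>crible_below\<close>, since \<open>r\<close> lies below
  \<open>crible_below Q (F r)\<close>. So surjectivity on homs makes every arrow a fixed point, and
  conversely a fixed point is a value.\<close>

lemma full_crible_join_iff:
  "full_functor (cribles (Map Q)) Q id (crible_join Q) \<longleftrightarrow> weakly_tabular Q"
proof
  assume full: "full_functor (cribles (Map Q)) Q id (crible_join Q)"
  show "weakly_tabular Q" unfolding weakly_tabular_iff
  proof (intro allI ballI)
    fix X Y q assume q: "q \<in> Hom Q X Y"
    then have "q \<in> crible_join Q ` Hom (cribles (Map Q)) X Y"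
      using full Hom_objects[OF q] by (auto simp: full_functor_def)
    then obtain r where r: "r \<in> Hom (cribles (Map Q)) X Y" "q = crible_join Q r" by blast
    let ?b = "crible_below Q q"
    have b: "?b \<in> Hom (cribles (Map Q)) X Y" using q by (rule crible_below_in_Hom)
    have J: "crible_join Q ?b \<in> Hom Q X Y" using b by (rule crible_join_in_Hom)
    have "crible_join Q ?b \<preceq> q" using crible_join_le_iff[OF b q] cr.Leq_refl[OF b] by blast
    moreover have "r \<preceq>\<^bsub>cribles (Map Q)\<^esub> ?b" "?b \<preceq>\<^bsub>cribles (Map Q)\<^esub> crible_below Q (crible_join Q ?b)"
      using crible_join_le_iff[OF r(1) q] crible_join_le_iff[OF b J] Leq_refl[OF q] Leq_refl[OF J] r(2)
      by simp_all
    then have "r \<preceq>\<^bsub>cribles (Map Q)\<^esub> crible_below Q (crible_join Q ?b)"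
      using cr.Leq_trans r(1) b crible_below_in_Hom[OF J] by blast
    then have "q \<preceq> crible_join Q ?b" using crible_join_le_iff[OF r(1) J] r(2) by blast
    ultimately show "crible_join Q ?b = q" using q J Leq_antisym by blast
  qed
next
  assume "weakly_tabular Q"
  then have "q \<in> crible_join Q ` Hom (cribles (Map Q)) X Y" if "q \<in> Hom Q X Y" for q X Y
    using that crible_below_in_Hom[OF that] unfolding weakly_tabular_iff by (metis imageI)
  then show "full_functor (cribles (Map Q)) Q id (crible_join Q)"
    using crible_join_in_Hom by (auto simp: full_functor_def)
qed

section \<open>Local localicity and finite infima\<close>

lemma locally_localicI:
  assumes "\<And>X Y f A u. f \<in> Hom Q X Y \<Longrightarrow> A \<subseteq> Hom Q X Y \<Longrightarrow> u \<in> Hom Q X Y \<Longrightarrow>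
    (\<And>a. a \<in> A \<Longrightarrow> Meet X Y f a \<preceq> u) \<Longrightarrow> Meet X Y f (Join X Y A) \<preceq> u"
  shows "locally_localic Q"
  unfolding locally_localic_def
proof (intro ballI frame.intro frame_axioms.intro complete_lattice_Hom)
  fix X Y f A assume ob: "X \<in> Ob Q" "Y \<in> Ob Q" and "f \<in> carrier (hom_lattice Q X Y)"
    and "A \<subseteq> carrier (hom_lattice Q X Y)"
  then have f: "f \<in> Hom Q X Y" and A: "A \<subseteq> Hom Q X Y" by (simp_all add: carrier_hom_lattice)
  have J: "Join X Y A \<in> Hom Q X Y" using ob A by (rule Join_in_Hom)
  have MJ: "Meet X Y f (Join X Y A) \<in> Hom Q X Y" using ob f J by (rule Meet_in_Hom)
  have M: "Meet X Y f a \<in> Hom Q X Y" if "a \<in> A" for a using that A Meet_in_Hom[OF ob f] by blast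
  show "Meet X Y f (Join X Y A) = Join X Y ((\<lambda>a. Meet X Y f a) ` A)"
  proof (rule Join_eqI[symmetric])
    show "Meet X Y f (Join X Y A) \<preceq> u"
      if "u \<in> Hom Q X Y" "\<And>b. b \<in> (\<lambda>a. Meet X Y f a) ` A \<Longrightarrow> b \<preceq> u" for u
      using assms[OF f A] that by blast
    fix b assume "b \<in> (\<lambda>a. Meet X Y f a) ` A"
    then obtain a where a: "a \<in> A" "b = Meet X Y f a" by blast
    have aH: "a \<in> Hom Q X Y" using a A by blast
    show "b \<preceq> Meet X Y f (Join X Y A)"
      using M[OF a(1)] Leq_trans[OF Meet_right[OF ob f aH] Join_upper[OF ob A a(1)] _ aH J]
        Meet_left[OF ob f aH] unfolding a(2)
      by (intro Meet_greatest[OF ob f J]) auto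
  qed (use MJ M in auto)
qed

lemma locally_localic_Meet_Join_le:
  assumes "locally_localic Q" and f: "f \<in> Hom Q X Y" and A: "A \<subseteq> Hom Q X Y" and u: "u \<in> Hom Q X Y"
    and le: "\<And>a. a \<in> A \<Longrightarrow> Meet X Y f a \<preceq> u"
  shows "Meet X Y f (Join X Y A) \<preceq> u"
proof -
  have ob: "X \<in> Ob Q" "Y \<in> Ob Q" using f Hom_objects by blast+
  interpret frame "hom_lattice Q X Y" using assms(1) ob by (auto simp: locally_localic_def)
  have "Meet X Y f (Join X Y A) = Join X Y ((\<lambda>a. Meet X Y f a) ` A)"
    using meet_Sup_distrib f A by (simp add: carrier_hom_lattice)
  also have "\<dots> \<preceq> u" using le f A ob u Meet_in_Hom by (intro Join_least) auto
  finally show ?thesis .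
qed

lemma Meet_commute: "f \<in> Hom Q X Y \<Longrightarrow> g \<in> Hom Q X Y \<Longrightarrow> Meet X Y f g = Meet X Y g f"
  using Hom_objects by (intro Meet_eqI) (blast intro: Meet_in_Hom Meet_left Meet_right Meet_greatest)+

text \<open>Weak modularity bounds the meet of two spans by a composite whose middle factor is a
  meet. A span \<open>(h, k)\<close> below that meet makes two squares commute,
  \<open>g h = n k\<close> and \<open>f h = m k\<close>, so \<open>(f h, n k)\<close> is a
  restriction of \<open>(f, g)\<close> and of \<open>(m, n)\<close> at once.\<close>

lemma crible_join_Int_ge:
  assumes ll: "locally_localic Q" and d: "map_discrete Q" and wt: "weakly_tabular Q"
    and wm: "weakly_modular Q"
    and R: "(X, R, Y) \<in> Hom (cribles (Map Q)) X Y" and S: "(X, S, Y) \<in> Hom (cribles (Map Q)) X Y"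
  shows "Meet X Y (crible_join Q (X, R, Y)) (crible_join Q (X, S, Y)) \<preceq> crible_join Q (X, R \<inter> S, Y)"
proof -
  let ?u = "crible_join Q (X, R \<inter> S, Y)"
  have ob: "X \<in> Ob Q" "Y \<in> Ob Q" using R by simp_all
  have RS: "(X, R \<inter> S, Y) \<in> Hom (cribles (Map Q)) X Y" using R S is_crible_Int by auto
  then have u: "?u \<in> Hom Q X Y" by (rule crible_join_in_Hom)
  have J: "crible_join Q (X, R, Y) \<in> Hom Q X Y" "crible_join Q (X, S, Y) \<in> Hom Q X Y"
    using R S crible_join_in_Hom by blast+
  have cr: "is_crible (Map Q) X Y R" "is_crible (Map Q) X Y S" using R S by simp_all
  have span: "Meet X Y (f \<cdot> radj Q g) (m \<cdot> radj Q n) \<preceq> ?u"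
    if fg: "(f, g) \<in> R" and mn: "(m, n) \<in> S" for f g m n
  proof -
    obtain U V where f: "f \<in> Hom (Map Q) U Y" and g: "g \<in> Hom (Map Q) U X"
      and m: "m \<in> Hom (Map Q) V Y" and n: "n \<in> Hom (Map Q) V X"
      using crible_span[OF cr(1) fg] crible_span[OF cr(2) mn] by blast
    note H = f[THEN Map_Hom] g[THEN Map_radj] m[THEN Map_Hom] n[THEN Map_radj] n[THEN Map_Hom]
      f[THEN Map_radj]
    have ob': "U \<in> Ob Q" "V \<in> Ob Q" using H Hom_objects by blast+
    have DU: "Dom Q f = U" "Dom Q m = V" using Hom_Dom_Cod[OF H(1)] Hom_Dom_Cod[OF H(3)] by simp_all
    let ?q = "Meet V U (radj Q g \<cdot> n) (radj Q f \<cdot> m)"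
    have gn: "radj Q g \<cdot> n \<in> Hom Q V U" and fm: "radj Q f \<cdot> m \<in> Hom Q V U" using H Comp_in_Hom by blast+
    then have q: "?q \<in> Hom Q V U" using ob' Meet_in_Hom by blast
    have "f \<cdot> (?q \<cdot> radj Q n) \<preceq> ?u"
    proof (rule weakly_tabular_sandwich[OF wt q H(1,4) u])
      fix W h k assume h: "h \<in> Hom (Map Q) W U" and k: "k \<in> Hom (Map Q) W V" and le: "h \<cdot> radj Q k \<preceq> ?q"
      have "h \<cdot> radj Q k \<preceq> radj Q g \<cdot> n" "h \<cdot> radj Q k \<preceq> radj Q f \<cdot> m"
        using Leq_trans[OF le Meet_left[OF ob'(2,1) gn fm]] Leq_trans[OF le Meet_right[OF ob'(2,1) gn fm]]
          span_in_Hom[OF h k] q gn fm by blast+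
      then have "g \<cdot> h = n \<cdot> k" "f \<cdot> h = m \<cdot> k"
        using span_le_radj_Comp[OF d h k] g n f m by blast+
      then have fh: "(f \<cdot> h, n \<cdot> k) \<in> R \<inter> S"
        using crible_Comp[OF cr(1) fg f h] crible_Comp[OF cr(2) mn m k] by auto
      then show "f \<cdot> ((h \<cdot> radj Q k) \<cdot> radj Q n) \<preceq> ?u"
        using span_le_crible_join[OF RS fh] span_Comp_eq[OF f h k n] by simp
    qed
    moreover have "Meet X Y (f \<cdot> radj Q g) (m \<cdot> radj Q n) \<preceq> f \<cdot> (?q \<cdot> radj Q n)"
      using wm ob f g m n DU unfolding weakly_modular_def by (fastforce simp: spans_iff)
    ultimately show ?thesis
      using Leq_trans u Meet_in_Hom[OF ob] span_in_Hom[OF f g] span_in_Hom[OF m n]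
        Comp_in_Hom[OF Comp_in_Hom[OF H(4) q] H(1)] by blast
  qed
  \<comment> \<open>The frame law distributes over the second argument of a meet, so the arguments
    are exchanged in order to expand the join of \<open>R\<close> as well.\<close>
  have "Meet X Y (crible_join Q (X, S, Y)) (f \<cdot> radj Q g) \<preceq> ?u" if fg: "(f, g) \<in> R" for f g
  proof -
    have fgH: "f \<cdot> radj Q g \<in> Hom Q X Y" using fg span_set_subset[OF cr(1)] by blast
    have "Meet X Y (f \<cdot> radj Q g) (crible_join Q (X, S, Y)) \<preceq> ?u"
      using span[OF fg] span_set_subset[OF cr(2)] fgH u
      by (auto simp: crible_join_eq[of X S Y]
          intro!: locally_localic_Meet_Join_le[OF ll])
    then show ?thesis using Meet_commute[OF fgH J(2)] by simp
  qed
  then have "Meet X Y (crible_join Q (X, S, Y)) (crible_join Q (X, R, Y)) \<preceq> ?u"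
    using span_set_subset[OF cr(1)] J(2) u
    by (auto simp: crible_join_eq[of X R Y]
        intro!: locally_localic_Meet_Join_le[OF ll])
  then show ?thesis using Meet_commute[OF J] by simp
qed

lemma locally_left_exact_crible_join:
  assumes ll: "locally_localic Q" and d: "map_discrete Q" and wt: "weakly_tabular Q"
    and wm: "weakly_modular Q"
  shows "locally_left_exact (cribles (Map Q)) Q id (crible_join Q)"
proof -
  interpret F: sup_functor "cribles (Map Q)" Q id "crible_join Q"
    using sup_functor_crible_join[OF d wt] .
  let ?I = "\<lambda>X Y A. \<Sqinter>\<^bsub>hom_lattice (cribles (Map Q)) X Y\<^esub> A"
  have ge: "q \<preceq> crible_join Q (?I X Y A)"
    if ob: "X \<in> Ob Q" "Y \<in> Ob Q" and fin: "finite A" and "A \<subseteq> Hom (cribles (Map Q)) X Y"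
      and q: "q \<in> Hom Q X Y" and "\<And>a. a \<in> A \<Longrightarrow> q \<preceq> crible_join Q a" for X Y A q
    using fin that(4,6)
  proof (induction A)
    \<comment> \<open>The empty infimum is the top crible; every \<open>q\<close> lies below its
      image because \<open>q\<close> is itself the image of \<open>crible_below Q q\<close>.\<close>
    case empty
    have "crible_below Q q \<preceq>\<^bsub>cribles (Map Q)\<^esub> ?I X Y {}"
      using ob crible_below_in_Hom[OF q] by (intro cr.Inf_greatest) auto
    then have "crible_join Q (crible_below Q q) \<preceq> crible_join Q (?I X Y {})"
      using F.Leq_map crible_below_in_Hom[OF q] cr.Inf_in_Hom[of X Y "{}"] ob by auto
    then show ?case using wt q unfolding weakly_tabular_iff by simp
  next
    case (insert a A)
    have A: "A \<subseteq> Hom (cribles (Map Q)) X Y" "a \<in> Hom (cribles (Map Q)) X Y" using insert by auto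
    have I: "?I X Y A \<in> Hom (cribles (Map Q)) X Y" using cr.Inf_in_Hom[of X Y A] A ob by simp
    obtain R S where R: "a = (X, R, Y)" and S: "?I X Y A = (X, S, Y)"
      using A I by (auto simp: Hom_cribles)
    have J: "crible_join Q a \<in> Hom Q X Y" "crible_join Q (?I X Y A) \<in> Hom Q X Y"
      using crible_join_in_Hom A I by blast+
    have RS: "(X, R \<inter> S, Y) \<in> Hom (cribles (Map Q)) X Y" using A I R S is_crible_Int by auto
    have "q \<preceq> Meet X Y (crible_join Q a) (crible_join Q (?I X Y A))"
      using insert A J q ob by (intro Meet_greatest) auto
    moreover have "Meet X Y (crible_join Q a) (crible_join Q (?I X Y A)) \<preceq> crible_join Q (X, R \<inter> S, Y)"
      using crible_join_Int_ge[OF assms, of X R Y S] A I R S by simp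
    moreover have "crible_join Q (X, R \<inter> S, Y) \<preceq> crible_join Q (?I X Y (insert a A))"
    proof (rule F.Leq_map)
      show "(X, R \<inter> S, Y) \<preceq>\<^bsub>cribles (Map Q)\<^esub> ?I X Y (insert a A)"
      proof (rule cr.Inf_greatest)
        fix b assume b: "b \<in> insert a A"
        show "(X, R \<inter> S, Y) \<preceq>\<^bsub>cribles (Map Q)\<^esub> b"
        proof (cases "b = a")
          case True then show ?thesis using R by simp
        next
          case False
          then have "(X, S, Y) \<preceq>\<^bsub>cribles (Map Q)\<^esub> b"
            using cr.Inf_lower[of X Y A b] A b ob S by simp
          moreover obtain B where "b = (X, B, Y)"
            using b insert.prems(1) Hom_cribles[of b "Map Q" X Y] by blast
          ultimately show ?thesis by auto
        qed
      qed (use insert RS ob in auto)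
      show "?I X Y (insert a A) \<in> Hom (cribles (Map Q)) X Y"
        using cr.Inf_in_Hom[of X Y "insert a A"] insert ob by simp
    qed (rule RS)
    moreover have "crible_join Q (?I X Y (insert a A)) \<in> Hom Q X Y"
      using cr.Inf_in_Hom[of X Y "insert a A"] insert ob by (intro crible_join_in_Hom) simp
    ultimately show ?case
      using Leq_trans q Meet_in_Hom[OF ob J] crible_join_in_Hom[OF RS] by meson
  qed
  show ?thesis unfolding locally_left_exact_def
  proof (intro ballI allI impI)
    fix X Y A assume *: "X \<in> Ob (cribles (Map Q))" "Y \<in> Ob (cribles (Map Q))"
      "finite A \<and> A \<subseteq> Hom (cribles (Map Q)) X Y"
    have I: "?I X Y A \<in> Hom (cribles (Map Q)) X Y" using cr.Inf_in_Hom[of X Y A] * by simp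
    show "crible_join Q (?I X Y A) = \<Sqinter>\<^bsub>hom_lattice Q (id X) (id Y)\<^esub> (crible_join Q ` A)"
    proof (rule Inf_eqI[symmetric])
      show "crible_join Q (?I X Y A) \<in> Hom Q (id X) (id Y)" "crible_join Q ` A \<subseteq> Hom Q (id X) (id Y)"
        using I * crible_join_in_Hom by auto
      show "crible_join Q (?I X Y A) \<preceq> a" if "a \<in> crible_join Q ` A" for a
        using that F.Leq_map[OF cr.Inf_lower[of X Y A]] I * by auto
    qed (use ge * in auto)
  qed
qed

end

text \<open>The crible generated by the span \<open>(f, 1)\<close>: the arrow \<open>f\<close>
  regarded as a functional relation from its domain to its codomain.\<close>

definition graph_crible :: "('o, 'a, 'm) category_scheme \<Rightarrow> 'a \<Rightarrow> ('a \<times> 'a) set"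
  where "graph_crible C f = {(f \<cdot>\<^bsub>C\<^esub> h, h) | h. h \<in> Arr C \<and> Cod C h = Dom C f}"

lemma is_crible_converse: "is_crible C X Y R \<Longrightarrow> is_crible C Y X (R\<inverse>)"
  by (fastforce simp: is_crible_def spans_def)

context category
begin

lemma mem_graph_crible:
  "f \<in> Hom C U Y \<Longrightarrow> (k, h) \<in> graph_crible C f \<longleftrightarrow> k = f \<cdot> h \<and> (\<exists>V. h \<in> Hom C V U)"
  by (auto simp: graph_crible_def Hom_def)

lemma is_crible_graph:
  assumes f: "f \<in> Hom C U Y"
  shows "is_crible C U Y (graph_crible C f)"
proof (rule is_cribleI)
  fix k h assume "(k, h) \<in> graph_crible C f"
  then show "\<exists>V. k \<in> Hom C V Y \<and> h \<in> Hom C V U"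
    using Comp_in_Hom f unfolding mem_graph_crible[OF f] by blast
next
  fix k h l V W assume *: "(k, h) \<in> graph_crible C f" "h \<in> Hom C V U" "l \<in> Hom C W V"
  then show "(k \<cdot> l, h \<cdot> l) \<in> graph_crible C f"
    using Comp_assoc[OF *(3,2) f] Comp_in_Hom[OF *(3,2)] unfolding mem_graph_crible[OF f] by auto
qed

lemma mem_graph_crible_Ident: "f \<in> Hom C U Y \<Longrightarrow> (f, Ident C U) \<in> graph_crible C f"
  using Ident_in_Hom[of U] Comp_Ident_right[of f U Y] Hom_objects[of f U Y] by (auto simp: mem_graph_crible)

lemma is_crible_Id_on: "sieve C X S \<Longrightarrow> is_crible C X X (Id_on S)"
  by (fastforce simp: sieve_def is_crible_def spans_def)

lemma Meet_cribles:
  assumes R: "(X, R, Y) \<in> Hom (cribles C) X Y" and S: "(X, S, Y) \<in> Hom (cribles C) X Y"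
  shows "(X, R, Y) \<sqinter>\<^bsub>hom_lattice (cribles C) X Y\<^esub> (X, S, Y) = (X, R \<inter> S, Y)"
  using R S is_crible_Int by (intro quantaloid.Meet_eqI[OF quantaloid_cribles]) (auto simp: Hom_cribles)

end

context quantaloid
begin

interpretation maps: category "Map Q" by (rule category_Map)
interpretation cr: quantaloid "cribles (Map Q)" by (rule maps.quantaloid_cribles)

section \<open>The topology on maps\<close>

text \<open>A sieve is read as a crible below the identity, namely its diagonal
  \<open>Id_on S\<close>. Covering then says that the comparison does not distinguish this crible
  from the identity, and the facts about \<open>crible_join\<close> apply to it.\<close>

lemma map_topology_iff:
  "S \<in> map_topology Q X \<longleftrightarrow> sieve (Map Q) X S \<and> crible_join Q (X, Id_on S, X) = Ident Q X"
proof -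
  have "{f \<cdot> radj Q g |f g. (f, g) \<in> Id_on S} = (\<lambda>s. s \<cdot> radj Q s) ` S" by auto
  then show ?thesis by (auto simp: map_topology_def crible_join_eq)
qed

lemma Id_on_sieve_in_Hom:
  "X \<in> Ob Q \<Longrightarrow> sieve (Map Q) X S \<Longrightarrow> (X, Id_on S, X) \<in> Hom (cribles (Map Q)) X X"
  using maps.is_crible_Id_on by simp

text \<open>Insert the identity of \<open>U\<close> between \<open>f\<close> and
  \<open>radj Q g\<close> in the form given by the cover: each summand comes from the span
  \<open>(f s, g s)\<close>, which lies in \<open>R\<close>.\<close>

lemma span_le_crible_join_if_covered:
  assumes S: "S \<in> map_topology Q U" and f: "f \<in> Hom (Map Q) U Y" and g: "g \<in> Hom (Map Q) U X"
    and R: "(X, R, Y) \<in> Hom (cribles (Map Q)) X Y" and RS: "\<And>s. s \<in> S \<Longrightarrow> (f \<cdot> s, g \<cdot> s) \<in> R"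
  shows "f \<cdot> radj Q g \<preceq> crible_join Q (X, R, Y)"
proof -
  let ?A = "(\<lambda>s. s \<cdot> radj Q s) ` S"
  note H = Map_Hom[OF f] Map_radj[OF g]
  have U: "U \<in> Ob Q" using H Hom_objects by blast
  have sieve: "sieve (Map Q) U S" and eq: "Ident Q U = Join U U ?A"
    using S by (auto simp: map_topology_def)
  have SH: "s \<in> Hom (Map Q) (Dom Q s) U" if "s \<in> S" for s
    using sieve that by (auto simp: sieve_def Hom_def)
  have "f \<cdot> (Join U U ?A \<cdot> radj Q g) \<preceq> crible_join Q (X, R, Y)"
  proof (rule Comp_Join_Comp_le[OF _ H crible_join_in_Hom[OF R]])
    show "?A \<subseteq> Hom Q U U" using SH span_in_Hom by blast
    fix a assume "a \<in> ?A"
    then obtain s where s: "s \<in> S" "a = s \<cdot> radj Q s" by blast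
    show "f \<cdot> (a \<cdot> radj Q g) \<preceq> crible_join Q (X, R, Y)"
      using span_le_crible_join[OF R RS[OF s(1)]] span_Comp_eq[OF f SH[OF s(1)] SH[OF s(1)] g] s(2)
      by simp
  qed
  then show ?thesis unfolding eq[symmetric] using Comp_Ident_left[OF H(2)] by simp
qed

text \<open>The sieve is the diagonal part of the crible composed of \<open>R\<close> with the graph of \<open>g\<close> and the
  converse graph of \<open>f\<close>; that composite is sent to an arrow above the identity, and left exactness
  applies to its meet with the identity.\<close>

lemma covered_if_span_le_crible_join:
  assumes sf: "sup_functor (cribles (Map Q)) Q id (crible_join Q)"
    and lex: "locally_left_exact (cribles (Map Q)) Q id (crible_join Q)"
    and f: "f \<in> Hom (Map Q) U Y" and g: "g \<in> Hom (Map Q) U X"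
    and R: "(X, R, Y) \<in> Hom (cribles (Map Q)) X Y" and le: "f \<cdot> radj Q g \<preceq> crible_join Q (X, R, Y)"
  shows "{s \<in> Arr (Map Q). Cod Q s = U \<and> (f \<cdot> s, g \<cdot> s) \<in> R} \<in> map_topology Q U"
proof -
  interpret F: sup_functor "cribles (Map Q)" Q id "crible_join Q" by (rule sf)
  let ?F = "crible_join Q"
  let ?S = "{s \<in> Arr (Map Q). Cod Q s = U \<and> (f \<cdot> s, g \<cdot> s) \<in> R}"
  let ?f = "(graph_crible (Map Q) f)\<inverse>" and ?g = "graph_crible (Map Q) g"
  let ?E = "?f O (R O ?g)"
  let ?I = "{(h, h) | h. h \<in> Arr (Map Q) \<and> Cod (Map Q) h = U}"
  note H = Map_Hom[OF f] Map_radj[OF f] Map_Hom[OF g] Map_radj[OF g]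
  have ob: "U \<in> Ob Q" "X \<in> Ob Q" "Y \<in> Ob Q" using H Hom_objects by blast+
  have cr: "is_crible (Map Q) X Y R" using R by simp
  have fH: "(Y, ?f, U) \<in> Hom (cribles (Map Q)) Y U" and gH: "(U, ?g, X) \<in> Hom (cribles (Map Q)) U X"
    using maps.is_crible_graph[OF f] maps.is_crible_graph[OF g] is_crible_converse ob by auto
  have RgH: "(U, R O ?g, Y) \<in> Hom (cribles (Map Q)) U Y" and EH: "(U, ?E, U) \<in> Hom (cribles (Map Q)) U U"
    using maps.is_crible_relcomp[OF maps.is_crible_graph[OF g] cr] fH ob
      maps.is_crible_relcomp[OF maps.is_crible_relcomp[OF maps.is_crible_graph[OF g] cr], of U ?f]
    by simp_all
  have IH: "(U, ?I, U) \<in> Hom (cribles (Map Q)) U U" using cr.Ident_in_Hom[of U] ob by simp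
  have J: "?F (Y, ?f, U) \<in> Hom Q Y U" "?F (U, ?g, X) \<in> Hom Q U X" "?F (X, R, Y) \<in> Hom Q X Y"
    using fH gH R crible_join_in_Hom by blast+
  have IdU: "Ident Q U \<in> Hom Q U U" "Ident Q U \<in> Hom (Map Q) U U" using ob Ident_in_Hom Map_Ident by blast+
  \<comment> \<open>Lower bounds for the images of the two graphs suffice, and the generating spans
    \<open>(1, f)\<close> and \<open>(g, 1)\<close> provide them.\<close>
  have f_le: "radj Q f \<preceq> ?F (Y, ?f, U)"
    using span_le_crible_join[OF fH, of "Ident Q U" f] maps.mem_graph_crible_Ident[OF f]
      Comp_Ident_left[OF H(2)] by simp
  have g_le: "g \<preceq> ?F (U, ?g, X)"
    using span_le_crible_join[OF gH, of g "Ident Q U"] maps.mem_graph_crible_Ident[OF g]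
      radj_Ident[OF ob(1)] Comp_Ident_right[OF H(3)] by simp
  have "f \<preceq> ?F (X, R, Y) \<cdot> g" using le Map_mate_right[OF g H(1) J(3)] by blast
  then have "f \<preceq> ?F (X, R, Y) \<cdot> ?F (U, ?g, X)"
    using Leq_trans[OF _ Comp_mono_right[OF g_le H(3) J(2,3)]] Comp_in_Hom[OF _ J(3)] H J by blast
  then have "f \<preceq> ?F (U, R O ?g, Y)"
    using F.Comp_map[OF gH R] gH by simp
  then have "Ident Q U \<preceq> radj Q f \<cdot> ?F (U, R O ?g, Y)"
    using Map_mate_left[OF f IdU(1) crible_join_in_Hom[OF RgH]] Comp_Ident_right[OF H(1)] by simp
  moreover have "radj Q f \<cdot> ?F (U, R O ?g, Y) \<preceq> ?F (Y, ?f, U) \<cdot> ?F (U, R O ?g, Y)"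
    using Comp_mono_left[OF f_le H(2) J(1) crible_join_in_Hom[OF RgH]] .
  moreover have "?F (Y, ?f, U) \<cdot> ?F (U, R O ?g, Y) = ?F (U, ?E, U)"
    using F.Comp_map[OF RgH fH] RgH by simp
  ultimately have E: "Ident Q U \<preceq> ?F (U, ?E, U)"
    using Leq_trans[of "Ident Q U"] IdU(1) Comp_in_Hom[OF crible_join_in_Hom[OF RgH]] H(2) J(1) by metis
  have SI: "Id_on ?S = ?I \<inter> ?E"
  proof -
    have "(h, h) \<in> ?E \<longleftrightarrow> (f \<cdot> h, g \<cdot> h) \<in> R" if "h \<in> Hom (Map Q) V U" for h V
      using that maps.mem_graph_crible[OF f] maps.mem_graph_crible[OF g] by fastforce
    then show ?thesis by (fastforce simp: Hom_def)
  qed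
  have sieve: "sieve (Map Q) U ?S"
    unfolding sieve_def
  proof (intro conjI ballI impI)
    fix s h assume s: "s \<in> ?S" and h: "h \<in> Arr (Map Q)" "Cod (Map Q) h = Dom (Map Q) s"
    have sH: "s \<in> Hom (Map Q) (Dom Q s) U" and hH: "h \<in> Hom (Map Q) (Dom Q h) (Dom Q s)"
      using s h by (auto simp: Hom_def)
    have "(f \<cdot> s, g \<cdot> s) \<in> R" using s by blast
    then have "((f \<cdot> s) \<cdot> h, (g \<cdot> s) \<cdot> h) \<in> R"
      using crible_Comp[OF cr _ _ hH] Map_Comp[OF sH f] by auto
    then have "(f \<cdot> (s \<cdot> h), g \<cdot> (s \<cdot> h)) \<in> R"
      using maps.Comp_assoc[OF hH sH f] maps.Comp_assoc[OF hH sH g] by simp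
    then show "s \<cdot>\<^bsub>Map Q\<^esub> h \<in> ?S" using Map_Comp[OF hH sH] by (auto simp: Hom_def)
  qed auto
  have meet: "\<Sqinter>\<^bsub>hom_lattice (cribles (Map Q)) U U\<^esub> {(U, ?I, U), (U, ?E, U)} = (U, Id_on ?S, U)"
    unfolding SI using maps.Meet_cribles[OF IH EH] by (simp add: meet_def)
  have "?F (U, Id_on ?S, U) = \<Sqinter>\<^bsub>hom_lattice Q U U\<^esub> (?F ` {(U, ?I, U), (U, ?E, U)})"
    using lex[unfolded locally_left_exact_def, rule_format, of U U "{(U, ?I, U), (U, ?E, U)}"]
      ob IH EH unfolding meet id_apply by auto
  also have "\<dots> = \<Sqinter>\<^bsub>hom_lattice Q U U\<^esub> {Ident Q U, ?F (U, ?E, U)}"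
    using crible_join_Ident[OF ob(1)] by simp
  also have "\<dots> = Ident Q U"
    using E IdU(1) crible_join_in_Hom[OF EH] Leq_refl by (intro Inf_eqI) auto
  finally show ?thesis using sieve map_topology_iff by blast
qed

text \<open>Pullback stability is \<open>covered_if_span_le_crible_join\<close> for the span
  \<open>(f, f)\<close> and the diagonal of \<open>S\<close>, whose image is the identity and so
  lies above \<open>f \<cdot> radj Q f\<close>. For local character, the local covers put every
  \<open>f \<cdot> radj Q f\<close> with \<open>f\<close> in \<open>S\<close> below the image of the
  diagonal of \<open>T\<close>, so the identity is below it too.\<close>

lemma site_map_topology:
  assumes sf: "sup_functor (cribles (Map Q)) Q id (crible_join Q)"
    and lex: "locally_left_exact (cribles (Map Q)) Q id (crible_join Q)"
  shows "site (Map Q) (map_topology Q)"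
proof
  interpret F: sup_functor "cribles (Map Q)" Q id "crible_join Q" by (rule sf)
  fix X assume "X \<in> Ob (Map Q)"
  then have X: "X \<in> Ob Q" by simp
  show "{f \<in> Arr (Map Q). Cod (Map Q) f = X} \<in> map_topology Q X"
  proof -
    have "sieve (Map Q) X {f \<in> Arr (Map Q). Cod (Map Q) f = X}"
      using Map_Comp by (fastforce simp: sieve_def Hom_def)
    moreover have "Id_on {f \<in> Arr (Map Q). Cod (Map Q) f = X} = {(f, f) |f. f \<in> Arr (Map Q) \<and> Cod (Map Q) f = X}"
      by auto
    ultimately show ?thesis using crible_join_Ident[OF X] map_topology_iff by simp
  qed
  fix S assume S: "S \<in> map_topology Q X"
  then show sv: "sieve (Map Q) X S" by (simp add: map_topology_iff)
  have SH: "(X, Id_on S, X) \<in> Hom (cribles (Map Q)) X X" using Id_on_sieve_in_Hom[OF X sv] .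
  have IdS: "crible_join Q (X, Id_on S, X) = Ident Q X" using S by (simp add: map_topology_iff)
  show "pullback_sieve (Map Q) f S \<in> map_topology Q Y" if f: "f \<in> Hom (Map Q) Y X" for f Y
  proof -
    have "{s \<in> Arr (Map Q). Cod Q s = Y \<and> (f \<cdot> s, f \<cdot> s) \<in> Id_on S} \<in> map_topology Q Y"
      using covered_if_span_le_crible_join[OF sf lex f f SH] Map_counit[OF f] IdS by simp
    moreover have "pullback_sieve (Map Q) f S = {s \<in> Arr (Map Q). Cod Q s = Y \<and> (f \<cdot> s, f \<cdot> s) \<in> Id_on S}"
      using Hom_Dom_Cod[OF f] by (auto simp: pullback_sieve_def)
    ultimately show ?thesis by simp
  qed
  fix T assume T: "sieve (Map Q) X T"
    and loc: "\<And>f. f \<in> S \<Longrightarrow> pullback_sieve (Map Q) f T \<in> map_topology Q (Dom (Map Q) f)"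
  have TH: "(X, Id_on T, X) \<in> Hom (cribles (Map Q)) X X" using Id_on_sieve_in_Hom[OF X T] .
  have "crible_join Q (X, Id_on S, X) \<preceq> crible_join Q (X, Id_on T, X)"
  proof (rule crible_join_le[OF SH crible_join_in_Hom[OF TH]])
    fix U f g assume *: "f \<in> Hom (Map Q) U X" "g \<in> Hom (Map Q) U X" "(f, g) \<in> Id_on S"
    have "f \<in> S" "g = f" using *(3) by auto
    then show "f \<cdot> radj Q g \<preceq> crible_join Q (X, Id_on T, X)"
      using span_le_crible_join_if_covered[OF loc[of f], of f X f X "Id_on T"] TH *(1) Hom_Dom_Cod[OF *(1)]
      by (auto simp: pullback_sieve_def)
  qed
  moreover have "crible_join Q (X, Id_on T, X) \<preceq> Ident Q X"
    using Map_counit Ident_in_Hom[OF X] by (intro crible_join_le[OF TH]) auto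
  ultimately show "T \<in> map_topology Q X"
    using IdS T Leq_antisym[OF crible_join_in_Hom[OF TH] Ident_in_Hom[OF X]] by (simp add: map_topology_iff)
qed

lemma crible_closure_map_topology:
  assumes sf: "sup_functor (cribles (Map Q)) Q id (crible_join Q)"
    and lex: "locally_left_exact (cribles (Map Q)) Q id (crible_join Q)"
    and r: "r \<in> Hom (cribles (Map Q)) X Y"
  shows "crible_closure (Map Q) (map_topology Q) r = crible_below Q (crible_join Q r)"
proof -
  obtain R where R: "r = (X, R, Y)" "is_crible (Map Q) X Y R" using r by (auto simp: Hom_cribles)
  have RH: "(X, R, Y) \<in> Hom (cribles (Map Q)) X Y" using r R by simp
  have "(\<exists>S\<in>map_topology Q (Dom Q f). \<forall>s\<in>S. (f \<cdot> s, g \<cdot> s) \<in> R) \<longleftrightarrow> f \<cdot> radj Q g \<preceq> crible_join Q r"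
    if fg: "(f, g) \<in> spans (Map Q) X Y" for f g
  proof -
    obtain U where f: "f \<in> Hom (Map Q) U Y" and g: "g \<in> Hom (Map Q) U X" using fg unfolding spans_iff by blast
    have D: "Dom Q f = U" using Hom_Dom_Cod[OF f] by simp
    show ?thesis
    proof
      assume "\<exists>S\<in>map_topology Q (Dom Q f). \<forall>s\<in>S. (f \<cdot> s, g \<cdot> s) \<in> R"
      then show "f \<cdot> radj Q g \<preceq> crible_join Q r"
        using span_le_crible_join_if_covered[OF _ f g RH] by (auto simp: D R(1))
    next
      assume "f \<cdot> radj Q g \<preceq> crible_join Q r"
      then have "{s \<in> Arr (Map Q). Cod Q s = U \<and> (f \<cdot> s, g \<cdot> s) \<in> R} \<in> map_topology Q U"
        using covered_if_span_le_crible_join[OF sf lex f g RH] by (simp add: R(1))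
      then show "\<exists>S\<in>map_topology Q (Dom Q f). \<forall>s\<in>S. (f \<cdot> s, g \<cdot> s) \<in> R"
        unfolding D by (rule bexI[rotated]) simp
    qed
  qed
  then show ?thesis
    unfolding crible_below_eq[OF crible_join_in_Hom[OF r]] by (auto simp: crible_closure_def R(1))
qed

end

section \<open>Isomorphisms and equivalences\<close>

text \<open>\<open>R\<close> is raw data here, and its laws are derived by applying
  \<open>FA\<close>, which is injective on homs. Composition is given as \<open>GA\<close> of a
  composite in \<open>Q\<close> because composites of closed arrows have this shape when the closure
  is \<open>GA\<close> after \<open>FA\<close>.\<close>

lemma quantaloid_transport:
  fixes Q :: "('o, 'a, 'm) quantaloid_scheme" and R :: "('o, 'b, 'n) quantaloid_scheme"
  assumes Q: "quantaloid Q" and Ob: "Ob R = Ob Q"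
    and DC: "\<And>r. r \<in> Arr R \<Longrightarrow> Dom R r \<in> Ob R \<and> Cod R r \<in> Ob R"
    and FA: "\<And>X Y r. r \<in> Hom R X Y \<Longrightarrow> FA r \<in> Hom Q X Y"
    and GA: "\<And>X Y q. q \<in> Hom Q X Y \<Longrightarrow> GA q \<in> Hom R X Y"
    and GF: "\<And>X Y r. r \<in> Hom R X Y \<Longrightarrow> GA (FA r) = r"
    and FG: "\<And>X Y q. q \<in> Hom Q X Y \<Longrightarrow> FA (GA q) = q"
    and Leq: "\<And>X Y r s. r \<in> Hom R X Y \<Longrightarrow> s \<in> Hom R X Y \<Longrightarrow> r \<preceq>\<^bsub>R\<^esub> s \<longleftrightarrow> FA r \<preceq>\<^bsub>Q\<^esub> FA s"
    and Ident: "\<And>X. X \<in> Ob Q \<Longrightarrow> Ident R X = GA (Ident Q X)"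
    and Comp: "\<And>X Y Z r s. r \<in> Hom R X Y \<Longrightarrow> s \<in> Hom R Y Z \<Longrightarrow> s \<cdot>\<^bsub>R\<^esub> r = GA (FA s \<cdot>\<^bsub>Q\<^esub> FA r)"
  shows "sup_functor R Q id FA \<and> sup_functor Q R id GA"
proof -
  interpret Q: quantaloid Q by (rule Q)
  have FComp: "FA (s \<cdot>\<^bsub>R\<^esub> r) = FA s \<cdot>\<^bsub>Q\<^esub> FA r" if "r \<in> Hom R X Y" "s \<in> Hom R Y Z" for r s X Y Z
    using Comp[OF that] FG[OF Q.Comp_in_Hom[OF that[THEN FA]]] by simp
  have CompH: "s \<cdot>\<^bsub>R\<^esub> r \<in> Hom R X Z" if "r \<in> Hom R X Y" "s \<in> Hom R Y Z" for r s X Y Z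
    using Comp[OF that] GA[OF Q.Comp_in_Hom[OF that[THEN FA]]] by simp
  have IdH: "Ident R X \<in> Hom R X X" if "X \<in> Ob R" for X
    using that Ob Ident GA[OF Q.Ident_in_Hom] by simp
  have FId: "FA (Ident R X) = Ident Q X" if "X \<in> Ob R" for X
    using that Ob Ident FG[OF Q.Ident_in_Hom] by simp
  have inj: "r = s" if "FA r = FA s" "r \<in> Hom R X Y" "s \<in> Hom R X Y" for r s X Y
    using that GF by metis
  have cat: "category R"
  proof
    fix W X Y Z f g h assume *: "f \<in> Hom R W X" "g \<in> Hom R X Y" "h \<in> Hom R Y Z"
    show "(h \<cdot>\<^bsub>R\<^esub> g) \<cdot>\<^bsub>R\<^esub> f = h \<cdot>\<^bsub>R\<^esub> g \<cdot>\<^bsub>R\<^esub> f"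
      using Q.Comp_assoc[OF *[THEN FA]] FComp CompH * by (intro inj[of _ _ W Z]) metis+
  next
    fix X Y f assume *: "f \<in> Hom R X Y"
    then have ob: "X \<in> Ob R" "Y \<in> Ob R" using DC by (auto simp: Hom_def)
    show "Ident R Y \<cdot>\<^bsub>R\<^esub> f = f"
      using Q.Comp_Ident_left[OF FA[OF *]] FComp[OF *] CompH[OF *] IdH[OF ob(2)] FId[OF ob(2)] *
      by (intro inj[of _ _ X Y]) auto
    show "f \<cdot>\<^bsub>R\<^esub> Ident R X = f"
      using Q.Comp_Ident_right[OF FA[OF *]] FComp[OF _ *] CompH[OF _ *] IdH[OF ob(1)] FId[OF ob(1)] *
      by (intro inj[of _ _ X Y]) auto
  qed (use DC CompH IdH in auto)
  have R: "quantaloid R"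
  proof (rule quantaloidI[where S = "\<lambda>X Y A. GA (Q.Join X Y (FA ` A))", OF cat])
    fix X Y f assume "f \<in> Hom R X Y"
    then show "f \<preceq>\<^bsub>R\<^esub> f" using Leq FA Q.Leq_refl by blast
  next
    fix X Y f g assume *: "f \<in> Hom R X Y" "g \<in> Hom R X Y" "f \<preceq>\<^bsub>R\<^esub> g" "g \<preceq>\<^bsub>R\<^esub> f"
    then show "f = g"
      using Q.Leq_antisym[OF FA[OF *(1)] FA[OF *(2)]] Leq by (intro inj[OF _ *(1,2)]) blast
  next
    fix X Y f g h assume *: "f \<in> Hom R X Y" "g \<in> Hom R X Y" "h \<in> Hom R X Y" "f \<preceq>\<^bsub>R\<^esub> g" "g \<preceq>\<^bsub>R\<^esub> h"
    then show "f \<preceq>\<^bsub>R\<^esub> h"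
      using Q.Leq_trans[OF _ _ *(1-3)[THEN FA]] Leq by blast
  next
    fix X Y Z f f' g assume *: "f \<in> Hom R X Y" "f' \<in> Hom R X Y" "g \<in> Hom R Y Z" "f \<preceq>\<^bsub>R\<^esub> f'"
    then show "g \<cdot>\<^bsub>R\<^esub> f \<preceq>\<^bsub>R\<^esub> g \<cdot>\<^bsub>R\<^esub> f'"
      using Q.Comp_mono_right[OF _ *(1-3)[THEN FA]] Leq[OF *(1,2)]
        Leq[OF CompH[OF *(1,3)] CompH[OF *(2,3)]] FComp[OF *(1,3)] FComp[OF *(2,3)] by simp
  next
    fix X Y Z f g g' assume *: "f \<in> Hom R X Y" "g \<in> Hom R Y Z" "g' \<in> Hom R Y Z" "g \<preceq>\<^bsub>R\<^esub> g'"
    then show "g \<cdot>\<^bsub>R\<^esub> f \<preceq>\<^bsub>R\<^esub> g' \<cdot>\<^bsub>R\<^esub> f"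
      using Q.Comp_mono_left[OF _ *(2,3,1)[THEN FA]] Leq[OF *(2,3)]
        Leq[OF CompH[OF *(1,2)] CompH[OF *(1,3)]] FComp[OF *(1,2)] FComp[OF *(1,3)] by simp
  next
    fix X Y A assume *: "X \<in> Ob R" "Y \<in> Ob R" "A \<subseteq> Hom R X Y"
    then have sub: "FA ` A \<subseteq> Hom Q X Y" using FA by blast
    then have J: "Q.Join X Y (FA ` A) \<in> Hom Q X Y" using * Ob Q.Join_in_Hom by simp
    then show S: "GA (Q.Join X Y (FA ` A)) \<in> Hom R X Y" by (rule GA)
    show "a \<preceq>\<^bsub>R\<^esub> GA (Q.Join X Y (FA ` A))" if "a \<in> A" for a
      using that * Ob sub S Leq[of a X Y] FG[OF J] Q.Join_upper[OF _ _ sub] by auto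
    fix u assume u: "u \<in> Hom R X Y" "\<And>a. a \<in> A \<Longrightarrow> a \<preceq>\<^bsub>R\<^esub> u"
    have "FA a \<preceq>\<^bsub>Q\<^esub> FA u" if "a \<in> A" for a
      using u(2)[OF that] Leq[OF _ u(1)] *(3) that by blast
    then have "Q.Join X Y (FA ` A) \<preceq>\<^bsub>Q\<^esub> FA u"
      using * Ob FA[OF u(1)] by (intro Q.Join_least[OF _ _ sub]) auto
    then show "GA (Q.Join X Y (FA ` A)) \<preceq>\<^bsub>R\<^esub> u" using Leq[OF S u(1)] FG[OF J] by simp
  next
    fix X Y Z A g u assume *: "g \<in> Hom R Y Z" "X \<in> Ob R" "A \<subseteq> Hom R X Y" "u \<in> Hom R X Z"
      "\<And>a. a \<in> A \<Longrightarrow> g \<cdot>\<^bsub>R\<^esub> a \<preceq>\<^bsub>R\<^esub> u"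
    have sub: "FA ` A \<subseteq> Hom Q X Y" using * FA by blast
    have "Y \<in> Ob Q" using Q.Hom_objects[OF FA[OF *(1)]] by blast
    then have J: "Q.Join X Y (FA ` A) \<in> Hom Q X Y" using * Ob sub Q.Join_in_Hom by simp
    have "FA g \<cdot>\<^bsub>Q\<^esub> Q.Join X Y (FA ` A) \<preceq>\<^bsub>Q\<^esub> FA u"
    proof (rule Q.Comp_Join_le[OF FA[OF *(1)] sub FA[OF *(4)]])
      fix b assume "b \<in> FA ` A"
      then obtain a where a: "a \<in> A" "b = FA a" by blast
      have "a \<in> Hom R X Y" using a * by blast
      then show "FA g \<cdot>\<^bsub>Q\<^esub> b \<preceq>\<^bsub>Q\<^esub> FA u"
        using *(5)[OF a(1)] FComp[OF _ *(1)] Leq[OF CompH[OF _ *(1)] *(4)] a(2) by simp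
    qed
    then show "g \<cdot>\<^bsub>R\<^esub> GA (Q.Join X Y (FA ` A)) \<preceq>\<^bsub>R\<^esub> u"
      using FComp[OF GA[OF J] *(1)] Leq[OF CompH[OF GA[OF J] *(1)] *(4)] FG[OF J] by simp
  next
    fix X Y Z A f u assume *: "f \<in> Hom R X Y" "Z \<in> Ob R" "A \<subseteq> Hom R Y Z" "u \<in> Hom R X Z"
      "\<And>a. a \<in> A \<Longrightarrow> a \<cdot>\<^bsub>R\<^esub> f \<preceq>\<^bsub>R\<^esub> u"
    have sub: "FA ` A \<subseteq> Hom Q Y Z" using * FA by blast
    have "Y \<in> Ob Q" using Q.Hom_objects[OF FA[OF *(1)]] by blast
    then have J: "Q.Join Y Z (FA ` A) \<in> Hom Q Y Z" using * Ob sub Q.Join_in_Hom by simp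
    have "Q.Join Y Z (FA ` A) \<cdot>\<^bsub>Q\<^esub> FA f \<preceq>\<^bsub>Q\<^esub> FA u"
    proof (rule Q.Join_Comp_le[OF FA[OF *(1)] sub FA[OF *(4)]])
      fix b assume "b \<in> FA ` A"
      then obtain a where a: "a \<in> A" "b = FA a" by blast
      have "a \<in> Hom R Y Z" using a * by blast
      then show "b \<cdot>\<^bsub>Q\<^esub> FA f \<preceq>\<^bsub>Q\<^esub> FA u"
        using *(5)[OF a(1)] FComp[OF *(1)] Leq[OF CompH[OF *(1)] *(4)] a(2) by simp
    qed
    then show "GA (Q.Join Y Z (FA ` A)) \<cdot>\<^bsub>R\<^esub> f \<preceq>\<^bsub>R\<^esub> u"
      using FComp[OF *(1) GA[OF J]] Leq[OF CompH[OF *(1) GA[OF J]] *(4)] FG[OF J] by simp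
  qed
  have "sup_functor R Q id FA"
  proof (rule sup_functorI_residuated[OF R Q])
    show "category_functor R Q id FA"
      using cat Q.category_axioms Ob FA FId FComp
      by (simp add: category_functor_def category_functor_axioms_def)
    fix X Y u assume "u \<in> Hom Q (id X) (id Y)"
    then have u: "u \<in> Hom Q X Y" by simp
    show "\<exists>r\<in>Hom R X Y. \<forall>q\<in>Hom R X Y. FA q \<preceq>\<^bsub>Q\<^esub> u \<longleftrightarrow> q \<preceq>\<^bsub>R\<^esub> r"
      using Leq[OF _ GA[OF u]] FG[OF u] GA[OF u] by auto
  qed
  moreover have "sup_functor Q R id GA"
  proof (rule sup_functorI_residuated[OF Q R])
    show "category_functor Q R id GA"
      using cat Q.category_axioms Ob GA Ident Comp[OF GA GA] FG
      by (simp add: category_functor_def category_functor_axioms_def)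
    fix X Y u assume "u \<in> Hom R (id X) (id Y)"
    then have u: "u \<in> Hom R X Y" by simp
    show "\<exists>r\<in>Hom Q X Y. \<forall>q\<in>Hom Q X Y. GA q \<preceq>\<^bsub>R\<^esub> u \<longleftrightarrow> q \<preceq>\<^bsub>Q\<^esub> r"
      using Leq[OF GA u] FG FA[OF u] by auto
  qed
  ultimately show ?thesis by blast
qed

text \<open>Functions on objects and arrows are total, while mutually inverse functors compose to
  the identity on \<open>Ob C\<close> and \<open>Arr C\<close> only; hence the assumptions are
  relative to these sets.\<close>

lemma (in category) naturally_isomorphic_id:
  assumes "\<And>X. X \<in> Ob C \<Longrightarrow> FO X = X" and "\<And>f. f \<in> Arr C \<Longrightarrow> FA f = f"
  shows "naturally_isomorphic C C FO FA id id"
  unfolding naturally_isomorphic_def iso_arrow_def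
proof (intro exI[of _ "Ident C"] conjI ballI allI)
  fix X Y f assume f: "f \<in> Hom C X Y"
  then show "Ident C Y \<cdot> FA f = id f \<cdot> Ident C X"
    using assms(2)[of f] Comp_Ident_left Comp_Ident_right Hom_Dom_Cod[OF f] by simp
next
  fix X assume X: "X \<in> Ob C"
  then show "Ident C X \<in> Hom C (FO X) (id X)"
    and "\<exists>g\<in>Hom C (id X) (FO X). g \<cdot> Ident C X = Ident C (FO X) \<and> Ident C X \<cdot> g = Ident C (id X)"
    using assms(1)[OF X] Ident_in_Hom[OF X] Comp_Ident_left[OF Ident_in_Hom[OF X]] by auto
qed

lemma quantaloid_isomorphic_imp_equivalent:
  assumes "quantaloid_isomorphic Q R"
  shows "quantaloid_equivalent Q R"
proof -
  obtain FO FA GO GA where *: "sup_functor Q R FO FA" "sup_functor R Q GO GA"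
    "\<forall>X\<in>Ob Q. GO (FO X) = X" "\<forall>f\<in>Arr Q. GA (FA f) = f"
    "\<forall>X\<in>Ob R. FO (GO X) = X" "\<forall>f\<in>Arr R. FA (GA f) = f"
    using assms by (auto simp: quantaloid_isomorphic_def)
  interpret F: sup_functor Q R FO FA by fact
  have "naturally_isomorphic Q Q (GO \<circ> FO) (GA \<circ> FA) id id"
    "naturally_isomorphic R R (FO \<circ> GO) (FA \<circ> GA) id id"
    using * by (auto intro: F.dom.naturally_isomorphic_id F.cod.naturally_isomorphic_id)
  then show ?thesis using * unfolding quantaloid_equivalent_def by blast
qed

lemma Hom_closed_cribles:
  "r \<in> Hom (closed_cribles C J) X Y \<longleftrightarrow> r \<in> Hom (cribles C) X Y \<and> crible_closure C J r = r"
  by (auto simp: closed_cribles_def nucleus_quantaloid_def Hom_def)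

lemma closed_cribles_simps [simp]:
  "Ob (closed_cribles C J) = Ob C"
  "Ident (closed_cribles C J) X = crible_closure C J (Ident (cribles C) X)"
  "s \<cdot>\<^bsub>closed_cribles C J\<^esub> r = crible_closure C J (s \<cdot>\<^bsub>cribles C\<^esub> r)"
  "Leq (closed_cribles C J) = Leq (cribles C)"
  by (simp_all add: closed_cribles_def nucleus_quantaloid_def)

section \<open>The representation of \<open>Q\<close> by closed cribles\<close>

context quantaloid
begin

interpretation maps: category "Map Q" by (rule category_Map)
interpretation cr: quantaloid "cribles (Map Q)" by (rule maps.quantaloid_cribles)

lemma quantaloid_isomorphic_closed_cribles:
  assumes sf: "sup_functor (cribles (Map Q)) Q id (crible_join Q)"
    and full: "full_functor (cribles (Map Q)) Q id (crible_join Q)"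
    and lex: "locally_left_exact (cribles (Map Q)) Q id (crible_join Q)"
  shows "quantaloid_isomorphic Q (closed_cribles (Map Q) (map_topology Q))"
proof -
  let ?K = "closed_cribles (Map Q) (map_topology Q)"
  interpret F: sup_functor "cribles (Map Q)" Q id "crible_join Q" by (rule sf)
  have FG: "crible_join Q (crible_below Q q) = q" if "q \<in> Hom Q X Y" for q X Y
    using that full full_crible_join_iff weakly_tabular_iff by blast
  have GF: "crible_below Q (crible_join Q r) = r" if "r \<in> Hom ?K X Y" for r X Y
    using that crible_closure_map_topology[OF sf lex, of r X Y] by (simp add: Hom_closed_cribles)
  have KH: "r \<in> Hom (cribles (Map Q)) X Y" if "r \<in> Hom ?K X Y" for r X Y
    using that by (simp add: Hom_closed_cribles)
  have FH: "crible_join Q r \<in> Hom Q X Y" if "r \<in> Hom ?K X Y" for r X Y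
    using crible_join_in_Hom[OF KH[OF that]] .
  have GH: "crible_below Q q \<in> Hom ?K X Y" if "q \<in> Hom Q X Y" for q X Y
    using crible_below_in_Hom[OF that] FG[OF that]
      crible_closure_map_topology[OF sf lex crible_below_in_Hom[OF that]]
    by (simp add: Hom_closed_cribles)
  have sfs: "sup_functor ?K Q id (crible_join Q) \<and> sup_functor Q ?K id (crible_below Q)"
  proof (rule quantaloid_transport[OF quantaloid_axioms])
    fix X Y Z r s assume "r \<in> Hom ?K X Y" "s \<in> Hom ?K Y Z"
    note H = this[THEN KH]
    \<comment> \<open>The composite of closed cribles is the closure of the crible composite, and
      this closure is \<open>crible_below\<close> after \<open>crible_join\<close>; functoriality of
      the latter finishes.\<close>
    show "s \<cdot>\<^bsub>?K\<^esub> r = crible_below Q (crible_join Q s \<cdot> crible_join Q r)"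
      using crible_closure_map_topology[OF sf lex cr.Comp_in_Hom[OF H]] F.Comp_map[OF H] by simp
  next
    fix X assume X: "X \<in> Ob Q"
    show "Ident ?K X = crible_below Q (Ident Q X)"
      using crible_closure_map_topology[OF sf lex cr.Ident_in_Hom[of X]] crible_join_Ident[OF X] X by simp
  next
    fix X Y r s assume r: "r \<in> Hom ?K X Y" and s: "s \<in> Hom ?K X Y"
    show "r \<preceq>\<^bsub>?K\<^esub> s \<longleftrightarrow> crible_join Q r \<preceq> crible_join Q s"
      using crible_join_le_iff[OF KH[OF r] FH[OF s]] GF[OF s] by simp
  next
    fix r assume "r \<in> Arr ?K"
    then show "Dom ?K r \<in> Ob ?K \<and> Cod ?K r \<in> Ob ?K"
      by (auto simp: closed_cribles_def nucleus_quantaloid_def cribles_def)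
  qed (use FG GF FH GH in auto)
  then interpret K: quantaloid ?K by (auto dest: sup_functor.axioms(1))
  have "crible_join Q (crible_below Q q) = q" if "q \<in> Arr Q" for q
    using FG that Arr_Hom by blast
  moreover have "crible_below Q (crible_join Q r) = r" if "r \<in> Arr ?K" for r
    using GF that K.Arr_Hom by blast
  ultimately show ?thesis unfolding quantaloid_isomorphic_def
    using sfs by (intro exI[of _ id] exI[of _ "crible_join Q"] exI[of _ "crible_below Q"]) auto
qed

end

section \<open>Modular quantaloids\<close>

lemma Hom_op: "Hom (op_quantaloid Q) X Y = Hom Q Y X"
  by (auto simp: Hom_def op_quantaloid_def)

lemma op_quantaloid_simps [simp]:
  "Ob (op_quantaloid Q) = Ob Q"
  "Ident (op_quantaloid Q) = Ident Q"
  "g \<cdot>\<^bsub>op_quantaloid Q\<^esub> f = f \<cdot>\<^bsub>Q\<^esub> g"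
  "Leq (op_quantaloid Q) = Leq Q"
  by (simp_all add: op_quantaloid_def)

lemma hom_lattice_op: "hom_lattice (op_quantaloid Q) X Y = hom_lattice Q Y X"
  by (simp add: hom_lattice_def Hom_op)

context quantaloid
begin

lemma quantaloid_op: "quantaloid (op_quantaloid Q)"
proof (intro quantaloid.intro category.intro quantaloid_axioms.intro)
  show "\<And>f. f \<in> Arr (op_quantaloid Q) \<Longrightarrow> Dom (op_quantaloid Q) f \<in> Ob (op_quantaloid Q)"
    and "\<And>f. f \<in> Arr (op_quantaloid Q) \<Longrightarrow> Cod (op_quantaloid Q) f \<in> Ob (op_quantaloid Q)"
    using Dom_in_Ob Cod_in_Ob by (auto simp: op_quantaloid_def)
qed (auto simp: Hom_op hom_lattice_op Comp_assoc Comp_Ident_left Comp_Ident_right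
    Comp_Sup_left Comp_Sup_right intro: Ident_in_Hom Comp_in_Hom complete_lattice_Hom)

text \<open>Preservation of suprema comes for free: a monotone self-inverse map is its own residual,
  as \<open>i q \<preceq> u\<close> amounts to \<open>q \<preceq> i u\<close>.\<close>

lemma involutionI:
  assumes H: "\<And>X Y f. f \<in> Hom Q X Y \<Longrightarrow> i f \<in> Hom Q Y X"
    and Id: "\<And>X. X \<in> Ob Q \<Longrightarrow> i (Ident Q X) = Ident Q X"
    and C: "\<And>X Y Z f g. f \<in> Hom Q X Y \<Longrightarrow> g \<in> Hom Q Y Z \<Longrightarrow> i (g \<cdot> f) = i f \<cdot> i g"
    and mono: "\<And>X Y f g. f \<in> Hom Q X Y \<Longrightarrow> g \<in> Hom Q X Y \<Longrightarrow> f \<preceq> g \<Longrightarrow> i f \<preceq> i g"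
    and inv: "\<And>X Y f. f \<in> Hom Q X Y \<Longrightarrow> i (i f) = f"
  shows "involution Q i"
proof -
  have "sup_functor (op_quantaloid Q) Q id i"
  proof (rule sup_functorI_residuated[OF quantaloid_op quantaloid_axioms])
    show "category_functor (op_quantaloid Q) Q id i"
      using quantaloid.axioms(1)[OF quantaloid_op] category_axioms H Id C
      by (simp add: category_functor_def category_functor_axioms_def Hom_op)
    fix X Y u assume "u \<in> Hom Q (id X) (id Y)"
    then have u: "u \<in> Hom Q X Y" by simp
    have "i q \<preceq> u \<longleftrightarrow> q \<preceq> i u" if "q \<in> Hom Q Y X" for q
      using mono[OF H[OF that] u] mono[OF that H[OF u]] inv[OF u] inv[OF that] by auto
    then show "\<exists>r\<in>Hom (op_quantaloid Q) X Y. \<forall>q\<in>Hom (op_quantaloid Q) X Y.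
        i q \<preceq> u \<longleftrightarrow> q \<preceq>\<^bsub>op_quantaloid Q\<^esub> r"
      using H[OF u] by (auto simp: Hom_op)
  qed
  then show ?thesis using inv Arr_Hom by (auto simp: involution_def)
qed

lemma
  assumes inv: "involution Q i"
  shows involution_in_Hom: "f \<in> Hom Q X Y \<Longrightarrow> i f \<in> Hom Q Y X"
    and involution_Ident: "X \<in> Ob Q \<Longrightarrow> i (Ident Q X) = Ident Q X"
    and involution_Comp: "f \<in> Hom Q X Y \<Longrightarrow> g \<in> Hom Q Y Z \<Longrightarrow> i (g \<cdot> f) = i f \<cdot> i g"
    and involution_mono: "f \<preceq> g \<Longrightarrow> f \<in> Hom Q X Y \<Longrightarrow> g \<in> Hom Q X Y \<Longrightarrow> i f \<preceq> i g"
    and involution_invol: "f \<in> Hom Q X Y \<Longrightarrow> i (i f) = f"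
    and involution_Join: "X \<in> Ob Q \<Longrightarrow> Y \<in> Ob Q \<Longrightarrow> A \<subseteq> Hom Q X Y \<Longrightarrow> i (Join X Y A) = Join Y X (i ` A)"
proof -
  interpret I: sup_functor "op_quantaloid Q" Q id i
    using inv by (simp add: involution_def)
  show "f \<in> Hom Q X Y \<Longrightarrow> i f \<in> Hom Q Y X"
    using I.Hom_map[of f Y X] by (simp add: Hom_op)
  show "X \<in> Ob Q \<Longrightarrow> i (Ident Q X) = Ident Q X"
    using I.Ident_map[of X] by simp
  show "f \<in> Hom Q X Y \<Longrightarrow> g \<in> Hom Q Y Z \<Longrightarrow> i (g \<cdot> f) = i f \<cdot> i g"
    using I.Comp_map[of g Z Y f X] by (simp add: Hom_op)
  show "f \<preceq> g \<Longrightarrow> f \<in> Hom Q X Y \<Longrightarrow> g \<in> Hom Q X Y \<Longrightarrow> i f \<preceq> i g"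
    using I.Leq_map[of f g Y X] by (simp add: Hom_op)
  show "f \<in> Hom Q X Y \<Longrightarrow> i (i f) = f"
    using inv Arr_Hom Hom_Dom_Cod by (fastforce simp: involution_def)
  show "X \<in> Ob Q \<Longrightarrow> Y \<in> Ob Q \<Longrightarrow> A \<subseteq> Hom Q X Y \<Longrightarrow> i (Join X Y A) = Join Y X (i ` A)"
    using I.Sup_map[of Y X A] by (simp add: Hom_op hom_lattice_op)
qed

lemma involution_Meet:
  assumes inv: "involution Q i" and f: "f \<in> Hom Q X Y" and g: "g \<in> Hom Q X Y"
  shows "i (Meet X Y f g) = Meet Y X (i f) (i g)"
proof -
  note H = involution_in_Hom[OF inv]
  have ob: "X \<in> Ob Q" "Y \<in> Ob Q" using f Hom_objects by blast+
  have M: "Meet X Y f g \<in> Hom Q X Y" using ob f g by (rule Meet_in_Hom)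
  show ?thesis
  proof (rule Meet_eqI[symmetric])
    show "i (Meet X Y f g) \<preceq> i f" "i (Meet X Y f g) \<preceq> i g"
      using involution_mono[OF inv Meet_left[OF ob f g] M f]
        involution_mono[OF inv Meet_right[OF ob f g] M g] .
    fix u assume u: "u \<in> Hom Q Y X" "u \<preceq> i f" "u \<preceq> i g"
    have "i u \<preceq> Meet X Y f g"
      using involution_mono[OF inv u(2,1) H[OF f]] involution_mono[OF inv u(3,1) H[OF g]]
        involution_invol[OF inv f] involution_invol[OF inv g] H[OF u(1)] ob f g
      by (intro Meet_greatest) auto
    then show "u \<preceq> i (Meet X Y f g)"
      using involution_mono[OF inv _ H[OF u(1)] M] involution_invol[OF inv u(1)] by simp
  qed (use H f g M in blast)+
qed

lemma involution_cong:
  assumes inv: "involution Q i" and eq: "\<And>f. f \<in> Arr Q \<Longrightarrow> i' f = i f"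
  shows "involution Q i'"
proof -
  have E: "i' f = i f" if "f \<in> Hom Q X Y" for f X Y using eq Hom_Dom_Cod[OF that] by blast
  note H = involution_in_Hom[OF inv]
  show ?thesis
  proof (rule involutionI)
    show "\<And>X Y f. f \<in> Hom Q X Y \<Longrightarrow> i' f \<in> Hom Q Y X" using E H by simp
    show "\<And>X. X \<in> Ob Q \<Longrightarrow> i' (Ident Q X) = Ident Q X"
      using E[OF Ident_in_Hom] involution_Ident[OF inv] by simp
    show "\<And>X Y Z f g. f \<in> Hom Q X Y \<Longrightarrow> g \<in> Hom Q Y Z \<Longrightarrow> i' (g \<cdot> f) = i' f \<cdot> i' g"
      using E[OF Comp_in_Hom] E involution_Comp[OF inv] by simp
    show "\<And>X Y f g. f \<in> Hom Q X Y \<Longrightarrow> g \<in> Hom Q X Y \<Longrightarrow> f \<preceq> g \<Longrightarrow> i' f \<preceq> i' g"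
      using E involution_mono[OF inv] by simp
    show "\<And>X Y f. f \<in> Hom Q X Y \<Longrightarrow> i' (i' f) = f"
      using E E[OF H] involution_invol[OF inv] by simp
  qed
qed

section \<open>Modular quantaloids: right adjoints are converses\<close>

lemma modular_involution: "modular Q i \<Longrightarrow> involution Q i"
  by (simp add: modular_def)

lemma modular_law:
  "modular Q i \<Longrightarrow> f \<in> Hom Q X Y \<Longrightarrow> g \<in> Hom Q Y Z \<Longrightarrow> h \<in> Hom Q X Z \<Longrightarrow>
    Meet X Z (g \<cdot> f) h \<preceq> g \<cdot> Meet X Y f (i g \<cdot> h)"
  by (simp add: modular_def)

text \<open>The modular law for the converses, read back through the involution, which exchanges the
  two factors of a composite and preserves meets.\<close>

lemma modular_law_dual:
  assumes m: "modular Q i" and f: "f \<in> Hom Q X Y" and g: "g \<in> Hom Q Y Z" and h: "h \<in> Hom Q X Z"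
  shows "Meet X Z (g \<cdot> f) h \<preceq> Meet Y Z g (h \<cdot> i f) \<cdot> f"
proof -
  note inv = modular_involution[OF m]
  note H = involution_in_Hom[OF inv]
  have ob: "X \<in> Ob Q" "Y \<in> Ob Q" "Z \<in> Ob Q" using f g Hom_objects by blast+
  have gf: "g \<cdot> f \<in> Hom Q X Z" using f g Comp_in_Hom by blast
  have hf: "h \<cdot> i f \<in> Hom Q Y Z" using H[OF f] h Comp_in_Hom by blast
  have fh: "f \<cdot> i h \<in> Hom Q Z Y" using H[OF h] f Comp_in_Hom by blast
  have "Meet Z X (i f \<cdot> i g) (i h) \<preceq> i f \<cdot> Meet Z Y (i g) (i (i f) \<cdot> i h)"
    using modular_law[OF m H[OF g] H[OF f] H[OF h]] .
  then have le: "Meet Z X (i f \<cdot> i g) (i h) \<preceq> i f \<cdot> Meet Z Y (i g) (f \<cdot> i h)"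
    using involution_invol[OF inv f] by simp
  have M: "Meet Z Y (i g) (f \<cdot> i h) \<in> Hom Q Z Y" using ob H[OF g] fh by (intro Meet_in_Hom)
  have fg: "i f \<cdot> i g \<in> Hom Q Z X" using H f g Comp_in_Hom by blast
  have "i (Meet Z X (i f \<cdot> i g) (i h)) \<preceq> i (i f \<cdot> Meet Z Y (i g) (f \<cdot> i h))"
    using involution_mono[OF inv le Meet_in_Hom[OF ob(3,1) fg H[OF h]] Comp_in_Hom[OF M H[OF f]]] .
  moreover have "i (Meet Z X (i f \<cdot> i g) (i h)) = Meet X Z (g \<cdot> f) h"
    using involution_Meet[OF inv fg H[OF h]] involution_Comp[OF inv f g]
      involution_invol[OF inv gf] involution_invol[OF inv h] by simp
  moreover have "i (i f \<cdot> Meet Z Y (i g) (f \<cdot> i h)) = Meet Y Z g (h \<cdot> i f) \<cdot> f"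
    using involution_Comp[OF inv M H[OF f]] involution_Meet[OF inv H[OF g] fh]
      involution_invol[OF inv f] involution_invol[OF inv g] involution_invol[OF inv h]
      involution_Comp[OF inv H[OF h] f] by simp
  ultimately show ?thesis by simp
qed

text \<open>The involution obtained from a representation agrees with \<open>span_converse\<close>
  on arrows; as total functions the two may differ elsewhere.\<close>

lemma modular_cong:
  assumes m: "modular Q i" and eq: "\<And>f. f \<in> Arr Q \<Longrightarrow> i' f = i f"
  shows "modular Q i'"
  unfolding modular_def
proof (intro conjI involution_cong[OF modular_involution[OF m] eq] allI ballI)
  fix X Y Z f g h assume "f \<in> Hom Q X Y" "g \<in> Hom Q Y Z" "h \<in> Hom Q X Z"
  then show "Meet X Z (g \<cdot> f) h \<preceq> g \<cdot> Meet X Y f (i' g \<cdot> h)"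
    using modular_law[OF m, of f X Y g Z h] eq[of g] Hom_Dom_Cod[of g Q Y Z] by simp
qed

text \<open>The unit makes \<open>1\<close> the meet of \<open>g f\<close> and \<open>1\<close>, so
  the modular law yields \<open>1 \<preceq> g (f \<sqinter> i g)\<close>. Transposing
  \<open>g\<close> back, \<open>f\<close> lies below \<open>f \<sqinter> i g\<close>.\<close>

lemma modular_adjoint_le:
  assumes m: "modular Q i" and f: "f \<in> Hom Q X Y" and adj: "adjoint Q f g"
  shows "f \<preceq> i g"
proof -
  note inv = modular_involution[OF m]
  note H = involution_in_Hom[OF inv]
  have g: "g \<in> Hom Q Y X" "Ident Q X \<preceq> g \<cdot> f" "f \<cdot> g \<preceq> Ident Q Y" using adj adjoint_iff[OF f] by auto
  have ob: "X \<in> Ob Q" "Y \<in> Ob Q" using f Hom_objects by blast+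
  have I: "Ident Q X \<in> Hom Q X X" using ob Ident_in_Hom by blast
  have gf: "g \<cdot> f \<in> Hom Q X X" using f g Comp_in_Hom by blast
  let ?k = "Meet X Y f (i g)"
  have k: "?k \<in> Hom Q X Y" using ob f H[OF g(1)] by (intro Meet_in_Hom)
  have "Meet X X (g \<cdot> f) (Ident Q X) \<preceq> g \<cdot> ?k"
    using modular_law[OF m f g(1) I] Comp_Ident_right[OF H[OF g(1)]] by simp
  moreover have "Meet X X (g \<cdot> f) (Ident Q X) = Ident Q X"
    using g(2) I gf Leq_refl[OF I] by (intro Meet_eqI)
  ultimately have "Ident Q X \<preceq> g \<cdot> ?k" by simp
  then have "f \<cdot> Ident Q X \<preceq> ?k"
    using adjoint_mate_left[OF f adj I k] by blast
  then show ?thesis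
    using Comp_Ident_right[OF f] Leq_trans[OF _ Meet_right[OF ob f H[OF g(1)]] f k H[OF g(1)]] by simp
qed

lemma adjoint_involution:
  assumes inv: "involution Q i" and f: "f \<in> Hom Q X Y" and adj: "adjoint Q f g"
  shows "adjoint Q (i g) (i f)"
proof -
  note H = involution_in_Hom[OF inv]
  have g: "g \<in> Hom Q Y X" "Ident Q X \<preceq> g \<cdot> f" "f \<cdot> g \<preceq> Ident Q Y" using adj adjoint_iff[OF f] by auto
  have ob: "X \<in> Ob Q" "Y \<in> Ob Q" using f Hom_objects by blast+
  have "Ident Q X \<preceq> i f \<cdot> i g"
    using involution_mono[OF inv g(2) Ident_in_Hom[OF ob(1)] Comp_in_Hom[OF f g(1)]]
      involution_Comp[OF inv f g(1)] involution_Ident[OF inv ob(1)] by simp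
  moreover have "i g \<cdot> i f \<preceq> Ident Q Y"
    using involution_mono[OF inv g(3) Comp_in_Hom[OF g(1) f] Ident_in_Hom[OF ob(2)]]
      involution_Comp[OF inv g(1) f] involution_Ident[OF inv ob(2)] by simp
  ultimately show ?thesis using adjoint_iff[OF H[OF g(1)]] H[OF f] by blast
qed

text \<open>The previous inequality \<open>f \<preceq> i g\<close> is applied twice: to the
  adjunction of \<open>f\<close> and \<open>g\<close>, and to its image under the involution, in
  which \<open>i g\<close> is the left adjoint of \<open>i f\<close>.\<close>

lemma modular_adjoint_eq:
  assumes m: "modular Q i" and f: "f \<in> Hom Q X Y" and adj: "adjoint Q f g"
  shows "g = i f"
proof -
  note inv = modular_involution[OF m]
  note H = involution_in_Hom[OF inv]
  have g: "g \<in> Hom Q Y X" using adj adjoint_iff[OF f] by auto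
  have "i g \<preceq> f"
    using modular_adjoint_le[OF m H[OF g] adjoint_involution[OF inv f adj]] involution_invol[OF inv f] by simp
  then have "i g = f" using modular_adjoint_le[OF m f adj] Leq_antisym[OF H[OF g] f] by blast
  then show ?thesis using involution_invol[OF inv g] by simp
qed

lemma modular_radj: "modular Q i \<Longrightarrow> f \<in> Hom (Map Q) X Y \<Longrightarrow> radj Q f = i f"
  using modular_adjoint_eq Map_Hom Map_adjoint by blast

text \<open>Passing to right adjoints reverses the order, the involution preserves it, and by
  \<open>modular_adjoint_eq\<close> the two agree on left adjoints.\<close>

lemma modular_imp_map_discrete:
  assumes m: "modular Q i"
  shows "map_discrete Q"
  unfolding map_discrete_def
proof (intro allI ballI impI)
  fix X Y f g assume f: "f \<in> Hom Q X Y" and g: "g \<in> Hom Q X Y"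
    and "left_adjoint Q f \<and> left_adjoint Q g \<and> f \<preceq> g"
  then obtain f' g' where adj: "adjoint Q f f'" "adjoint Q g g'" and le: "f \<preceq> g"
    by (auto simp: left_adjoint_def)
  note inv = modular_involution[OF m]
  have eq: "f' = i f" "g' = i g" using modular_adjoint_eq[OF m] f g adj by blast+
  have "i g \<preceq> i f" using adjoint_antimono[OF f g adj le] eq by simp
  then have "g \<preceq> f"
    using involution_mono[OF inv _ involution_in_Hom[OF inv g] involution_in_Hom[OF inv f]]
      involution_invol[OF inv f] involution_invol[OF inv g] by simp
  then show "f = g" using le Leq_antisym[OF f g] by blast
qed

text \<open>With converses for right adjoints, the modular law extracts \<open>f\<close> on the left
  and its dual extracts the converse of \<open>n\<close> on the right.\<close>

lemma modular_imp_weakly_modular: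
  assumes m: "modular Q i"
  shows "weakly_modular Q"
proof -
  note inv = modular_involution[OF m]
  note iH = involution_in_Hom[OF inv]
  have "Meet X Y (f \<cdot> radj Q g) (p \<cdot> radj Q n) \<preceq>
      f \<cdot> (Meet (Dom Q p) (Dom Q f) (radj Q g \<cdot> n) (radj Q f \<cdot> p) \<cdot> radj Q n)"
    if fg: "(f, g) \<in> spans (Map Q) X Y" and pn: "(p, n) \<in> spans (Map Q) X Y" for X Y f g p n
  proof -
    obtain U where f: "f \<in> Hom (Map Q) U Y" and g: "g \<in> Hom (Map Q) U X" using fg unfolding spans_iff by blast
    obtain V where p: "p \<in> Hom (Map Q) V Y" and n: "n \<in> Hom (Map Q) V X" using pn unfolding spans_iff by blast
    note H = f[THEN Map_Hom] g[THEN Map_Hom] p[THEN Map_Hom] n[THEN Map_Hom]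
    note I = H[THEN iH]
    have ob: "X \<in> Ob Q" "Y \<in> Ob Q" "U \<in> Ob Q" "V \<in> Ob Q" using H Hom_objects by blast+
    have fp: "i f \<cdot> p \<in> Hom Q V U" and gn: "i g \<cdot> n \<in> Hom Q V U" and pn': "p \<cdot> i n \<in> Hom Q X Y"
      and fg': "f \<cdot> i g \<in> Hom Q X Y" using H I Comp_in_Hom by blast+
    have fpn: "(i f \<cdot> p) \<cdot> i n \<in> Hom Q X U" using fp I(4) Comp_in_Hom by blast
    have M: "Meet X U (i g) ((i f \<cdot> p) \<cdot> i n) \<in> Hom Q X U"
      using ob I(2) fpn by (intro Meet_in_Hom)
    have M': "Meet V U (i f \<cdot> p) (i g \<cdot> n) \<in> Hom Q V U" using ob fp gn by (intro Meet_in_Hom)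
    have "Meet X Y (f \<cdot> i g) (p \<cdot> i n) \<preceq> f \<cdot> Meet X U (i g) ((i f \<cdot> p) \<cdot> i n)"
      using modular_law[OF m I(2) H(1) pn'] Comp_assoc[OF I(4) H(3) I(1)] by simp
    moreover have "Meet X U ((i f \<cdot> p) \<cdot> i n) (i g) \<preceq> Meet V U (i f \<cdot> p) (i g \<cdot> n) \<cdot> i n"
      using modular_law_dual[OF m I(4) fp I(2)] involution_invol[OF inv H(4)] by simp
    then have "f \<cdot> Meet X U (i g) ((i f \<cdot> p) \<cdot> i n) \<preceq> f \<cdot> (Meet V U (i f \<cdot> p) (i g \<cdot> n) \<cdot> i n)"
      using Comp_mono_right[OF _ M Comp_in_Hom[OF I(4) M'] H(1)] Meet_commute[OF I(2) fpn] by simp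
    ultimately have "Meet X Y (f \<cdot> i g) (p \<cdot> i n) \<preceq> f \<cdot> (Meet V U (i f \<cdot> p) (i g \<cdot> n) \<cdot> i n)"
      using Leq_trans[OF _ _ Meet_in_Hom[OF ob(1,2) fg' pn'] Comp_in_Hom[OF M H(1)]
          Comp_in_Hom[OF Comp_in_Hom[OF I(4) M'] H(1)]] by blast
    then show ?thesis
      using Meet_commute[OF fp gn] Hom_Dom_Cod[OF H(1)] Hom_Dom_Cod[OF H(3)]
        modular_radj[OF m f] modular_radj[OF m g] modular_radj[OF m n] by simp
  qed
  then show ?thesis unfolding weakly_modular_def by blast
qed

text \<open>By weak tabularity an involution is determined by its values on composites
  \<open>f \<cdot> radj Q g\<close>, and modularity forces it to swap the two legs there.\<close>

lemma span_converse_eq: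
  assumes m: "modular Q i" and wt: "weakly_tabular Q" and "q \<in> Arr Q"
  shows "span_converse Q q = i q"
proof -
  note inv = modular_involution[OF m]
  let ?X = "Dom Q q" and ?Y = "Cod Q q"
  let ?A = "{f \<cdot> radj Q g | f g. (f, g) \<in> spans (Map Q) ?X ?Y \<and> f \<cdot> radj Q g \<preceq> q}"
  have q: "q \<in> Hom Q ?X ?Y" using assms(3) Arr_Hom by blast
  have ob: "?X \<in> Ob Q" "?Y \<in> Ob Q" using q Hom_objects by blast+
  have A: "?A \<subseteq> Hom Q ?X ?Y" using span_in_Hom by (auto simp: spans_iff)
  have conv: "i (f \<cdot> radj Q g) = g \<cdot> radj Q f" if "(f, g) \<in> spans (Map Q) ?X ?Y" for f g
  proof -
    obtain U where f: "f \<in> Hom (Map Q) U ?Y" and g: "g \<in> Hom (Map Q) U ?X"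
      using \<open>(f, g) \<in> spans (Map Q) ?X ?Y\<close> unfolding spans_iff by blast
    show ?thesis
      using involution_Comp[OF inv Map_radj[OF g] Map_Hom[OF f]] modular_radj[OF m f]
        modular_radj[OF m g] involution_invol[OF inv Map_Hom[OF g]] by simp
  qed
  have "i ` ?A = {g \<cdot> radj Q f | f g. (f, g) \<in> spans (Map Q) ?X ?Y \<and> f \<cdot> radj Q g \<preceq> q}"
    (is "_ = ?B")
  proof (intro equalityI subsetI)
    fix b assume "b \<in> ?B"
    then obtain f g where fg: "b = g \<cdot> radj Q f" "(f, g) \<in> spans (Map Q) ?X ?Y" "f \<cdot> radj Q g \<preceq> q" by blast
    then show "b \<in> i ` ?A" using conv[OF fg(2)] by (intro image_eqI[of _ _ "f \<cdot> radj Q g"]) auto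
  qed (use conv in auto)
  moreover have "q = Join ?X ?Y ?A" using wt q by (auto simp: weakly_tabular_def)
  ultimately show ?thesis
    using involution_Join[OF inv ob A] unfolding span_converse_def by simp
qed

end

section \<open>Closed cribles\<close>

context site
begin

definition cl :: "'o \<Rightarrow> 'o \<Rightarrow> ('a \<times> 'a) set \<Rightarrow> ('a \<times> 'a) set"
  where "cl X Y R = {(f, g) \<in> spans C X Y. \<exists>S\<in>J (Dom C f). \<forall>s\<in>S. (f \<cdot> s, g \<cdot> s) \<in> R}"

lemma crible_closure_eq: "crible_closure C J (X, R, Y) = (X, cl X Y R, Y)"
  by (simp add: crible_closure_def cl_def)

lemma clI:
  "f \<in> Hom C U Y \<Longrightarrow> g \<in> Hom C U X \<Longrightarrow> S \<in> J U \<Longrightarrow>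
    (\<And>s V. s \<in> S \<Longrightarrow> s \<in> Hom C V U \<Longrightarrow> (f \<cdot> s, g \<cdot> s) \<in> R) \<Longrightarrow> (f, g) \<in> cl X Y R"
  using covering_sieve[of U S] Dom_in_Ob
  by (force simp: cl_def spans_def Hom_def sieve_def)

lemma clE:
  assumes "(f, g) \<in> cl X Y R"
  obtains U S where "f \<in> Hom C U Y" and "g \<in> Hom C U X" and "S \<in> J U"
    and "\<And>s. s \<in> S \<Longrightarrow> (f \<cdot> s, g \<cdot> s) \<in> R" and "\<And>s. s \<in> S \<Longrightarrow> s \<in> Hom C (Dom C s) U"
proof -
  obtain S where S: "(f, g) \<in> spans C X Y" "S \<in> J (Dom C f)" "\<forall>s\<in>S. (f \<cdot> s, g \<cdot> s) \<in> R"
    using assms by (auto simp: cl_def)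
  have "f \<in> Hom C (Dom C f) Y" "g \<in> Hom C (Dom C f) X" using S(1) by (auto simp: spans_def Hom_def)
  moreover have "s \<in> Hom C (Dom C s) (Dom C f)" if "s \<in> S" for s
    using covering_sieve[OF _ S(2)] that Hom_objects[OF calculation(1)] by (auto simp: sieve_def Hom_def)
  ultimately show ?thesis using that S by blast
qed

lemma cl_mono: "R \<subseteq> S \<Longrightarrow> cl X Y R \<subseteq> cl X Y S"
  unfolding cl_def by blast

lemma cl_extensive:
  assumes R: "is_crible C X Y R"
  shows "R \<subseteq> cl X Y R"
proof (rule subrelI)
  fix f g assume fg: "(f, g) \<in> R"
  then obtain U where U: "f \<in> Hom C U Y" "g \<in> Hom C U X" using crible_span[OF R] by blast
  then show "(f, g) \<in> cl X Y R"
    using Hom_objects[OF U(1)] by (intro clI[OF _ _ covering_maximal]) (auto intro: crible_Comp[OF R fg])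
qed

lemma is_crible_cl:
  assumes R: "is_crible C X Y R"
  shows "is_crible C X Y (cl X Y R)"
proof (rule is_cribleI)
  fix f g h U V assume *: "(f, g) \<in> cl X Y R" "h \<in> Hom C V U" "f \<in> Hom C U Y" "g \<in> Hom C U X"
  from *(1) obtain U' S where S: "f \<in> Hom C U' Y" "S \<in> J U'" "\<And>s. s \<in> S \<Longrightarrow> (f \<cdot> s, g \<cdot> s) \<in> R"
    by (rule clE) blast
  have U': "U' = U" using S(1) *(3) by (auto simp: Hom_def)
  have ob: "U \<in> Ob C" using *(2) Hom_objects by blast
  show "(f \<cdot> h, g \<cdot> h) \<in> cl X Y R"
  proof (rule clI)
    show "pullback_sieve C h S \<in> J V" using covering_pullback[OF ob _ *(2)] S(2) U' by blast
    show "f \<cdot> h \<in> Hom C V Y" "g \<cdot> h \<in> Hom C V X" using * Comp_in_Hom by blast+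
    fix s W assume "s \<in> pullback_sieve C h S" and s: "s \<in> Hom C W V"
    then have "h \<cdot> s \<in> S" by (simp add: pullback_sieve_def)
    then show "((f \<cdot> h) \<cdot> s, (g \<cdot> h) \<cdot> s) \<in> R"
      using S(3) Comp_assoc[OF s *(2,3)] Comp_assoc[OF s *(2,4)] by simp
  qed
qed (blast elim: clE)

text \<open>Upward closure follows from local character: for \<open>f\<close> in \<open>S\<close>,
  hence in \<open>T\<close>, the pullback of \<open>T\<close> along \<open>f\<close> is the maximal
  sieve.\<close>

lemma covering_superset:
  assumes X: "X \<in> Ob C" and S: "S \<in> J X" and T: "sieve C X T" and "S \<subseteq> T"
  shows "T \<in> J X"
proof (rule covering_local[OF X S T])
  fix f assume f: "f \<in> S"
  then have fH: "f \<in> Hom C (Dom C f) X" using covering_sieve[OF X S] by (auto simp: sieve_def Hom_def)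
  have "f \<in> T" using f assms(4) by blast
  then have "pullback_sieve C f T = {h \<in> Arr C. Cod C h = Dom C f}"
    using T by (auto simp: pullback_sieve_def sieve_def)
  then show "pullback_sieve C f T \<in> J (Dom C f)"
    using covering_maximal[of "Dom C f"] Hom_objects[OF fH] by simp
qed

text \<open>Local character of \<open>J\<close> assembles the inner covers over the members of an
  outer cover into a single cover.\<close>

lemma cl_idem:
  assumes R: "is_crible C X Y R"
  shows "cl X Y (cl X Y R) = cl X Y R"
proof
  show "cl X Y (cl X Y R) \<subseteq> cl X Y R"
  proof (rule subrelI)
    fix f g assume "(f, g) \<in> cl X Y (cl X Y R)"
    then obtain U S where f: "f \<in> Hom C U Y" and g: "g \<in> Hom C U X" and S: "S \<in> J U"
      and fgs: "\<And>s. s \<in> S \<Longrightarrow> (f \<cdot> s, g \<cdot> s) \<in> cl X Y R" and SH: "\<And>s. s \<in> S \<Longrightarrow> s \<in> Hom C (Dom C s) U"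
      by (rule clE) blast
    have U: "U \<in> Ob C" using f Hom_objects by blast
    \<comment> \<open>All restrictions of \<open>(f, g)\<close> that land in \<open>R\<close>: the
      largest sieve that can witness membership in the closure. Its pullback along a member
      \<open>s\<close> of \<open>S\<close> contains the inner cover \<open>S'\<close>.\<close>
    let ?T = "{h \<in> Arr C. Cod C h = U \<and> (f \<cdot> h, g \<cdot> h) \<in> R}"
    have fg_Comp: "(f \<cdot> (s \<cdot> h), g \<cdot> (s \<cdot> h)) \<in> R \<longleftrightarrow> ((f \<cdot> s) \<cdot> h, (g \<cdot> s) \<cdot> h) \<in> R"
      if "s \<in> Hom C V U" "h \<in> Hom C W V" for s h V W
      using Comp_assoc[OF that(2,1) f] Comp_assoc[OF that(2,1) g] by simp
    have sieve_T: "sieve C U ?T"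
      unfolding sieve_def
    proof (intro conjI ballI impI)
      fix s h assume s: "s \<in> ?T" and h: "h \<in> Arr C" "Cod C h = Dom C s"
      have sH: "s \<in> Hom C (Dom C s) U" and hH: "h \<in> Hom C (Dom C h) (Dom C s)"
        using s h by (auto simp: Hom_def)
      have "(f \<cdot> s, g \<cdot> s) \<in> R" using s by blast
      then have "((f \<cdot> s) \<cdot> h, (g \<cdot> s) \<cdot> h) \<in> R"
        using crible_Comp[OF R _ Comp_in_Hom[OF sH f] hH] by blast
      then show "s \<cdot> h \<in> ?T" using fg_Comp[OF sH hH] Comp_in_Hom[OF hH sH] by (simp add: Hom_def)
    qed auto
    have "?T \<in> J U"
    proof (rule covering_local[OF U S sieve_T])
      fix s assume s: "s \<in> S"
      then have sH: "s \<in> Hom C (Dom C s) U" by (rule SH)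
      obtain V S' where V: "f \<cdot> s \<in> Hom C V Y" and S': "S' \<in> J V"
        and R': "\<And>t. t \<in> S' \<Longrightarrow> ((f \<cdot> s) \<cdot> t, (g \<cdot> s) \<cdot> t) \<in> R"
        and S'H: "\<And>t. t \<in> S' \<Longrightarrow> t \<in> Hom C (Dom C t) V"
        using fgs[OF s] by (rule clE) blast
      have VD: "V = Dom C s" using V Comp_in_Hom[OF sH f] by (simp add: Hom_def)
      have "sieve C (Dom C s) (pullback_sieve C s ?T)"
        unfolding sieve_def
      proof (intro conjI ballI impI)
        fix t h assume t: "t \<in> pullback_sieve C s ?T" and h: "h \<in> Arr C" "Cod C h = Dom C t"
        have tH: "t \<in> Hom C (Dom C t) (Dom C s)" and hH: "h \<in> Hom C (Dom C h) (Dom C t)"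
          and st: "s \<cdot> t \<in> ?T"
          using t h by (auto simp: pullback_sieve_def Hom_def)
        have "(s \<cdot> t) \<cdot> h \<in> ?T"
          using sieve_T st h Comp_in_Hom[OF tH sH] unfolding sieve_def by (auto simp: Hom_def)
        then show "t \<cdot> h \<in> pullback_sieve C s ?T"
          using Comp_assoc[OF hH tH sH] Comp_in_Hom[OF hH tH] by (simp add: pullback_sieve_def Hom_def)
      qed (auto simp: pullback_sieve_def)
      moreover have "S' \<subseteq> pullback_sieve C s ?T"
      proof
        fix t assume t: "t \<in> S'"
        then have tH: "t \<in> Hom C (Dom C t) (Dom C s)" using S'H VD by blast
        show "t \<in> pullback_sieve C s ?T"
          using R'[OF t] fg_Comp[OF sH tH] tH Comp_in_Hom[OF tH sH] by (auto simp: pullback_sieve_def Hom_def)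
      qed
      ultimately show "pullback_sieve C s ?T \<in> J (Dom C s)"
        using covering_superset[of "Dom C s" S'] S' VD Hom_objects[OF sH] by blast
    qed
    then show "(f, g) \<in> cl X Y R" using f g by (rule_tac clI) auto
  qed
qed (rule cl_extensive[OF is_crible_cl[OF R]])

text \<open>\<open>cl\<close> refers to the domain of the first leg, which for a span is also that
  of the second.\<close>

lemma cl_converse: "cl Y X (R\<inverse>) = (cl X Y R)\<inverse>"
  by (auto simp: cl_def spans_def)

lemma cl_leI: "is_crible C X Y S \<Longrightarrow> R \<subseteq> cl X Y S \<Longrightarrow> cl X Y R \<subseteq> cl X Y S"
  using cl_mono[of R "cl X Y S" X Y] cl_idem by blast

end

text \<open>That the closed cribles form a quantaloid is an assumption, discharged by the
  Sup-functors of whichever equivalence is given.\<close>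

locale closed_crible_quantaloid = site C J + K: quantaloid "closed_cribles C J"
  for C :: "('o, 'a) category" (structure) and J
begin

abbreviation "K \<equiv> closed_cribles C J"

lemma Hom_K: "(X', R, Y') \<in> Hom K X Y \<longleftrightarrow>
    X' = X \<and> Y' = Y \<and> X \<in> Ob C \<and> Y \<in> Ob C \<and> is_crible C X Y R \<and> cl X Y R = R"
  by (auto simp: Hom_closed_cribles crible_closure_eq)

lemma Hom_K_cases:
  assumes "r \<in> Hom K X Y"
  obtains R where "r = (X, R, Y)" "is_crible C X Y R" "cl X Y R = R"
  using assms by (cases r) (auto simp: Hom_K)

lemma K_Comp: "is_crible C X Y R \<Longrightarrow> (Y', S, Z) \<cdot>\<^bsub>K\<^esub> (X, R, Y) = (X, cl X Z (S O R), Z)"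
  by (simp add: crible_closure_eq)

lemma K_Meet:
  assumes "(X, R, Y) \<in> Hom K X Y" and "(X, S, Y) \<in> Hom K X Y"
  shows "(X, R, Y) \<sqinter>\<^bsub>hom_lattice K X Y\<^esub> (X, S, Y) = (X, R \<inter> S, Y)"
proof (rule K.Meet_eqI[OF assms])
  have RS: "is_crible C X Y (R \<inter> S)" using assms is_crible_Int by (auto simp: Hom_K)
  moreover have "cl X Y (R \<inter> S) \<subseteq> R \<inter> S"
    using cl_mono[of "R \<inter> S" R X Y] cl_mono[of "R \<inter> S" S X Y] assms by (auto simp: Hom_K)
  ultimately show "(X, R \<inter> S, Y) \<in> Hom K X Y"
    using cl_extensive[OF RS] assms(1) by (auto simp: Hom_K)
  fix u assume "u \<in> Hom K X Y" and *: "u \<preceq>\<^bsub>K\<^esub> (X, R, Y)" "u \<preceq>\<^bsub>K\<^esub> (X, S, Y)"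
  then show "u \<preceq>\<^bsub>K\<^esub> (X, R \<inter> S, Y)" by (elim Hom_K_cases) auto
qed simp_all

text \<open>The supremum of \<open>A\<close> lies below the closure of the union \<open>?B\<close>,
  so it is enough that a span in \<open>R\<close> covered by \<open>?B\<close> lies in
  \<open>U\<close>. On the cover its restrictions are in \<open>R\<close> and in \<open>?B\<close>,
  hence in \<open>U\<close>, and \<open>U\<close> is closed.\<close>

lemma locally_localic_K: "locally_localic K"
proof (rule K.locally_localicI)
  fix X Y f A u assume f: "f \<in> Hom K X Y" and A: "A \<subseteq> Hom K X Y" and u: "u \<in> Hom K X Y"
    and le: "\<And>a. a \<in> A \<Longrightarrow> K.Meet X Y f a \<preceq>\<^bsub>K\<^esub> u"
  have ob: "X \<in> Ob K" "Y \<in> Ob K" using K.Hom_objects[OF f] by blast+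
  obtain R where R: "f = (X, R, Y)" "is_crible C X Y R" "cl X Y R = R" using f by (rule Hom_K_cases)
  obtain U where U: "u = (X, U, Y)" "is_crible C X Y U" "cl X Y U = U" using u by (rule Hom_K_cases)
  let ?B = "\<Union>{S. (X, S, Y) \<in> A}"
  have B: "is_crible C X Y ?B" using A by (intro is_crible_Union) (auto simp: Hom_K)
  have BH: "(X, cl X Y ?B, Y) \<in> Hom K X Y" using B is_crible_cl cl_idem ob by (simp add: Hom_K)
  have RB: "R \<inter> ?B \<subseteq> U"
  proof -
    have "R \<inter> S \<subseteq> U" if S: "(X, S, Y) \<in> A" for S
    proof -
      have "(X, S, Y) \<in> Hom K X Y" using S A by blast
      then show ?thesis using le[OF S] f K_Meet[of X R Y S] by (simp add: R(1) U(1))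
    qed
    then show ?thesis by blast
  qed
  have "K.Join X Y A \<preceq>\<^bsub>K\<^esub> (X, cl X Y ?B, Y)"
  proof (rule K.Join_least[OF ob A BH])
    fix a assume a: "a \<in> A"
    then have "a \<in> Hom K X Y" using A by blast
    then obtain S where S: "a = (X, S, Y)" by (rule Hom_K_cases)
    then show "a \<preceq>\<^bsub>K\<^esub> (X, cl X Y ?B, Y)" using a cl_extensive[OF B] by auto
  qed
  moreover have "R \<inter> cl X Y ?B \<subseteq> U"
  proof (rule subrelI)
    fix p q assume "(p, q) \<in> R \<inter> cl X Y ?B"
    then have pq: "(p, q) \<in> R" "(p, q) \<in> cl X Y ?B" by blast+
    from pq(2) obtain V S where p: "p \<in> Hom C V Y" and q: "q \<in> Hom C V X" and S: "S \<in> J V"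
      and pqs: "\<And>s. s \<in> S \<Longrightarrow> (p \<cdot> s, q \<cdot> s) \<in> ?B" and SH: "\<And>s. s \<in> S \<Longrightarrow> s \<in> Hom C (Dom C s) V"
      by (rule clE) blast
    have "(p \<cdot> s, q \<cdot> s) \<in> U" if "s \<in> S" for s
      using pqs[OF that] crible_Comp[OF R(2) pq(1) p SH[OF that]] RB by blast
    then show "(p, q) \<in> U" using clI[OF p q S, of U] U(3) by blast
  qed
  moreover obtain S where S: "K.Join X Y A = (X, S, Y)"
    using K.Join_in_Hom[OF ob A] by (rule Hom_K_cases)
  ultimately show "K.Meet X Y f (K.Join X Y A) \<preceq>\<^bsub>K\<^esub> u"
    using f K.Join_in_Hom[OF ob A] K_Meet[of X R Y S] by (auto simp: R(1) U(1))
qed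

section \<open>The involution on closed cribles\<close>

definition conv :: "('o, 'a) crible \<Rightarrow> ('o, 'a) crible"
  where "conv = (\<lambda>(X, R, Y). (Y, R\<inverse>, X))"

lemma conv_simp [simp]: "conv (X, R, Y) = (Y, R\<inverse>, X)"
  by (simp add: conv_def)

lemma conv_in_Hom: "r \<in> Hom K X Y \<Longrightarrow> conv r \<in> Hom K Y X"
  by (cases r) (simp add: Hom_K is_crible_converse cl_converse)

text \<open>For plain relations the modular law keeps the intermediate element \<open>t\<close> of
  the composite. Closure only defers the choice of \<open>t\<close> to the members \<open>s\<close>
  of a cover, where \<open>(a s, t)\<close> in \<open>S\<close> and \<open>(a s, b s)\<close> in
  \<open>H\<close> put \<open>(t, b s)\<close> into \<open>S\<inverse> O H\<close>.\<close>

lemma modular_conv: "modular K conv"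
  unfolding modular_def
proof (intro conjI allI ballI)
  show "involution K conv"
  proof (rule K.involutionI)
    show "conv (Ident K X) = Ident K X" for X
    proof -
      have "{(h, h) |h. h \<in> Arr C \<and> Cod C h = X}\<inverse> = {(h, h) |h. h \<in> Arr C \<and> Cod C h = X}" by auto
      then show ?thesis by (simp add: crible_closure_eq cl_converse[symmetric])
    qed
    show "conv (s \<cdot>\<^bsub>K\<^esub> r) = conv r \<cdot>\<^bsub>K\<^esub> conv s" if "r \<in> Hom K X Y" "s \<in> Hom K Y Z" for r s X Y Z
      using that
      by (elim Hom_K_cases)
        (simp add: K_Comp is_crible_converse cl_converse[symmetric] converse_relcomp del: closed_cribles_simps)
  qed (auto elim!: Hom_K_cases simp: conv_in_Hom Hom_K is_crible_converse cl_converse)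
  fix X Y Z f g h assume f: "f \<in> Hom K X Y" and g: "g \<in> Hom K Y Z" and h: "h \<in> Hom K X Z"
  obtain R where R: "f = (X, R, Y)" "is_crible C X Y R" "cl X Y R = R" using f by (rule Hom_K_cases)
  obtain S where S: "g = (Y, S, Z)" "is_crible C Y Z S" "cl Y Z S = S" using g by (rule Hom_K_cases)
  obtain H where H: "h = (X, H, Z)" "is_crible C X Z H" "cl X Z H = H" using h by (rule Hom_K_cases)
  let ?T = "cl X Y (S\<inverse> O H)"
  have SH: "is_crible C X Y (S\<inverse> O H)" using is_crible_relcomp[OF H(2) is_crible_converse[OF S(2)]] .
  have ob: "X \<in> Ob C" "Y \<in> Ob C" using K.Hom_objects[OF f] by simp_all
  have T: "(X, ?T, Y) \<in> Hom K X Y"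
    unfolding Hom_K using is_crible_cl[OF SH] cl_idem[OF SH] ob by blast
  have conv_g: "conv g \<cdot>\<^bsub>K\<^esub> h = (X, ?T, Y)"
    unfolding S(1) H(1) conv_simp by (rule K_Comp[OF H(2)])
  have RT: "is_crible C X Y (R \<inter> ?T)" by (rule is_crible_Int[OF R(2) is_crible_cl[OF SH]])
  have gf: "g \<cdot>\<^bsub>K\<^esub> f = (X, cl X Z (S O R), Z)" unfolding R(1) S(1) by (rule K_Comp[OF R(2)])
  have gfH: "(X, cl X Z (S O R), Z) \<in> Hom K X Z" using K.Comp_in_Hom[OF f g] unfolding gf .
  have "cl X Z (S O R) \<inter> H \<subseteq> cl X Z (S O (R \<inter> ?T))"
  proof (rule subrelI)
    fix a b assume "(a, b) \<in> cl X Z (S O R) \<inter> H"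
    then have ab: "(a, b) \<in> cl X Z (S O R)" "(a, b) \<in> H" by blast+
    from ab(1) obtain V V' where a: "a \<in> Hom C V Z" and b: "b \<in> Hom C V X" and V': "V' \<in> J V"
      and abs: "\<And>s. s \<in> V' \<Longrightarrow> (a \<cdot> s, b \<cdot> s) \<in> S O R" and VH: "\<And>s. s \<in> V' \<Longrightarrow> s \<in> Hom C (Dom C s) V"
      by (rule clE) blast
    have "(a \<cdot> s, b \<cdot> s) \<in> S O (R \<inter> ?T)" if s: "s \<in> V'" for s
    proof -
      obtain t where t: "(a \<cdot> s, t) \<in> S" "(t, b \<cdot> s) \<in> R" using abs[OF s] by blast
      have "(a \<cdot> s, b \<cdot> s) \<in> H" using crible_Comp[OF H(2) ab(2) a VH[OF s]] .
      then have "(t, b \<cdot> s) \<in> ?T" using t(1) cl_extensive[OF SH] by blast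
      then show ?thesis using t by blast
    qed
    then show "(a, b) \<in> cl X Z (S O (R \<inter> ?T))" using clI[OF a b V'] by blast
  qed
  moreover have "K.Meet X Z (g \<cdot>\<^bsub>K\<^esub> f) h = (X, cl X Z (S O R) \<inter> H, Z)"
    using K_Meet[OF gfH] h unfolding gf H(1) by blast
  moreover have "K.Meet X Y f (conv g \<cdot>\<^bsub>K\<^esub> h) = (X, R \<inter> ?T, Y)"
    using K_Meet[OF _ T, of R] f unfolding conv_g R(1) by blast
  ultimately show "K.Meet X Z (g \<cdot>\<^bsub>K\<^esub> f) h \<preceq>\<^bsub>K\<^esub> g \<cdot>\<^bsub>K\<^esub> K.Meet X Y f (conv g \<cdot>\<^bsub>K\<^esub> h)"
    using K_Comp[OF RT, of Y S Z] S(1) by simp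
qed

lemma graph_in_Hom:
  assumes f: "f \<in> Hom C U Y"
  shows "(U, cl U Y (graph_crible C f), Y) \<in> Hom K U Y"
  using is_crible_graph[OF f] is_crible_cl cl_idem Hom_objects[OF f] by (simp add: Hom_K)

text \<open>The unit already holds for the graph before closure. The counit says that a graph is
  single-valued, which after closure means agreement on a cover.\<close>

lemma adjoint_graph:
  assumes f: "f \<in> Hom C U Y"
  shows "adjoint K (U, cl U Y (graph_crible C f), Y) (conv (U, cl U Y (graph_crible C f), Y))"
proof -
  let ?f = "graph_crible C f" and ?g = "cl U Y (graph_crible C f)"
  note G = is_crible_graph[OF f]
  note H = graph_in_Hom[OF f]
  have cg: "is_crible C U Y ?g" using G is_crible_cl by blast
  have gg: "is_crible C U U (?g\<inverse> O ?g)" using is_crible_relcomp[OF cg is_crible_converse[OF cg]] .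
  have "Ident K U \<preceq>\<^bsub>K\<^esub> conv (U, ?g, Y) \<cdot>\<^bsub>K\<^esub> (U, ?g, Y)"
  proof -
    have "{(h, h) |h. h \<in> Arr C \<and> Cod C h = U} \<subseteq> ?f\<inverse> O ?f"
      using mem_graph_crible[OF f] by (fastforce simp: Hom_def)
    also have "\<dots> \<subseteq> ?g\<inverse> O ?g" using cl_extensive[OF G] by blast
    finally show ?thesis
      using K_Comp[OF cg, of Y "?g\<inverse>" U] cl_mono by (simp add: crible_closure_eq)
  qed
  moreover have "(U, ?g, Y) \<cdot>\<^bsub>K\<^esub> conv (U, ?g, Y) \<preceq>\<^bsub>K\<^esub> Ident K Y"
  proof -
    let ?I = "{(h, h) |h. h \<in> Arr C \<and> Cod C h = Y}"
    \<comment> \<open>The two memberships in \<open>?g\<close> come with different covers. One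
      serves for the outer closure and the pullback of the other for the inner one; idempotence then
      merges the two closures.\<close>
    have "?g O ?g\<inverse> \<subseteq> cl Y Y (cl Y Y ?I)"
    proof (rule subrelI)
      fix a b assume "(a, b) \<in> ?g O ?g\<inverse>"
      then obtain t where t: "(a, t) \<in> ?g" "(b, t) \<in> ?g" by blast
      from t(1) obtain V S where a: "a \<in> Hom C V Y" and tV: "t \<in> Hom C V U" and S: "S \<in> J V"
        and as: "\<And>s. s \<in> S \<Longrightarrow> (a \<cdot> s, t \<cdot> s) \<in> ?f" by (rule clE) blast
      from t(2) obtain V' S' where b: "b \<in> Hom C V' Y" "t \<in> Hom C V' U" and S': "S' \<in> J V'"
        and bs: "\<And>s. s \<in> S' \<Longrightarrow> (b \<cdot> s, t \<cdot> s) \<in> ?f"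
        and S'H: "\<And>s. s \<in> S' \<Longrightarrow> s \<in> Hom C (Dom C s) V'" by (rule clE) blast
      have V: "V' = V" using tV b(2) by (simp add: Hom_def)
      have bV: "b \<in> Hom C V Y" using b V by simp
      have ob: "V \<in> Ob C" using a Hom_objects by blast
      show "(a, b) \<in> cl Y Y (cl Y Y ?I)"
      proof (rule clI[OF a bV S])
        fix s W assume s: "s \<in> S" "s \<in> Hom C W V"
        show "(a \<cdot> s, b \<cdot> s) \<in> cl Y Y ?I"
        proof (rule clI[OF Comp_in_Hom[OF s(2) a] Comp_in_Hom[OF s(2) bV]])
          show "pullback_sieve C s S' \<in> J W" using covering_pullback[OF ob _ s(2)] S' V by blast
          fix r W' assume "r \<in> pullback_sieve C s S'" and r: "r \<in> Hom C W' W"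
          then have "s \<cdot> r \<in> S'" by (simp add: pullback_sieve_def)
          then have "b \<cdot> (s \<cdot> r) = f \<cdot> (t \<cdot> (s \<cdot> r))" using bs mem_graph_crible[OF f] by blast
          moreover have "a \<cdot> s = f \<cdot> (t \<cdot> s)" using as[OF s(1)] mem_graph_crible[OF f] by blast
          then have "(a \<cdot> s) \<cdot> r = f \<cdot> (t \<cdot> (s \<cdot> r))"
            using Comp_assoc[OF r Comp_in_Hom[OF s(2) tV] f] Comp_assoc[OF r s(2) tV] by simp
          ultimately have "(a \<cdot> s) \<cdot> r = (b \<cdot> s) \<cdot> r" using Comp_assoc[OF r s(2) bV] by simp
          moreover have "(a \<cdot> s) \<cdot> r \<in> Hom C W' Y" using Comp_in_Hom[OF r Comp_in_Hom[OF s(2) a]] .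
          ultimately show "((a \<cdot> s) \<cdot> r, (b \<cdot> s) \<cdot> r) \<in> ?I" by (auto simp: Hom_def)
        qed
      qed
    qed
    then have "?g O ?g\<inverse> \<subseteq> cl Y Y ?I" using cl_idem[OF is_crible_Ident] by simp
    then show ?thesis
      using K_Comp[OF is_crible_converse[OF cg], of U ?g Y] cl_leI[OF is_crible_Ident]
      by (simp add: crible_closure_eq)
  qed
  ultimately show ?thesis using K.adjoint_iff[OF H] conv_in_Hom[OF H] by blast
qed

text \<open>A span \<open>(f, g)\<close> of \<open>C\<close> lies in a closed crible exactly when
  the closed graph of \<open>f\<close> is below that crible composed with the closed graph of
  \<open>g\<close>; so closed graphs alone separate closed cribles.\<close>

lemma weakly_tabular_K: "weakly_tabular K"
proof (rule K.weakly_tabularI)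
  fix X Y q u assume q: "q \<in> Hom K X Y" and u: "u \<in> Hom K X Y"
    and le: "\<And>U f g. f \<in> Hom (Map K) U Y \<Longrightarrow> g \<in> Hom (Map K) U X \<Longrightarrow>
      f \<preceq>\<^bsub>K\<^esub> q \<cdot>\<^bsub>K\<^esub> g \<Longrightarrow> f \<preceq>\<^bsub>K\<^esub> u \<cdot>\<^bsub>K\<^esub> g"
  obtain R where R: "q = (X, R, Y)" "is_crible C X Y R" "cl X Y R = R" using q by (rule Hom_K_cases)
  obtain S where S: "u = (X, S, Y)" "is_crible C X Y S" "cl X Y S = S" using u by (rule Hom_K_cases)
  have "R \<subseteq> S"
  proof (rule subrelI)
    fix f g assume fg: "(f, g) \<in> R"
    then obtain U where f: "f \<in> Hom C U Y" and g: "g \<in> Hom C U X" using crible_span[OF R(2)] by blast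
    let ?f = "cl U Y (graph_crible C f)" and ?g = "cl U X (graph_crible C g)"
    have G: "is_crible C U X ?g" using is_crible_graph[OF g] is_crible_cl by blast
    have "graph_crible C f \<subseteq> R O ?g"
    proof (rule subrelI)
      fix a h assume "(a, h) \<in> graph_crible C f"
      then obtain V where h: "h \<in> Hom C V U" "a = f \<cdot> h" using mem_graph_crible[OF f] by blast
      have "(f \<cdot> h, g \<cdot> h) \<in> R" using crible_Comp[OF R(2) fg f h(1)] .
      moreover have "(g \<cdot> h, h) \<in> ?g"
        using h(1) mem_graph_crible[OF g] cl_extensive[OF is_crible_graph[OF g]] by blast
      ultimately show "(a, h) \<in> R O ?g" using h(2) by blast
    qed
    then have "(U, ?f, Y) \<preceq>\<^bsub>K\<^esub> q \<cdot>\<^bsub>K\<^esub> (U, ?g, X)"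
      using K_Comp[OF G, of X R Y] cl_mono R(1) by simp
    then have "(U, ?f, Y) \<preceq>\<^bsub>K\<^esub> u \<cdot>\<^bsub>K\<^esub> (U, ?g, X)"
      using le K.Hom_MapI[OF graph_in_Hom[OF f] adjoint_graph[OF f]]
        K.Hom_MapI[OF graph_in_Hom[OF g] adjoint_graph[OF g]] by blast
    then have "?f \<subseteq> cl U Y (S O ?g)" using K_Comp[OF G, of X S Y] S(1) by simp
    \<comment> \<open>Evaluation at the generating span \<open>(f, 1)\<close> of the graph recovers
      membership, in the manner of the Yoneda lemma.\<close>
    then have "(f, Ident C U) \<in> cl U Y (S O ?g)"
      using mem_graph_crible_Ident[OF f] cl_extensive[OF is_crible_graph[OF f]] by blast
    then obtain V T where V: "f \<in> Hom C V Y" and T: "T \<in> J V"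
      and fs: "\<And>s. s \<in> T \<Longrightarrow> (f \<cdot> s, Ident C U \<cdot> s) \<in> S O ?g"
      and TH: "\<And>s. s \<in> T \<Longrightarrow> s \<in> Hom C (Dom C s) V" by (rule clE) blast
    have VU: "V = U" using V f by (simp add: Hom_def)
    \<comment> \<open>One closure comes from the composition and one from the closed graph of
      \<open>g\<close>; they are unwound separately, and \<open>S\<close> is closed.\<close>
    have "(f, g) \<in> cl X Y (cl X Y S)"
    proof (rule clI[OF f g T[unfolded VU]])
      fix s W assume s: "s \<in> T" "s \<in> Hom C W U"
      then obtain t where t: "(f \<cdot> s, t) \<in> S" "(t, s) \<in> ?g" using fs[OF s(1)] Comp_Ident_left[OF s(2)] by auto
      from t(2) obtain W' T' where t': "t \<in> Hom C W' X" "s \<in> Hom C W' U" "T' \<in> J W'"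
        and ts: "\<And>r. r \<in> T' \<Longrightarrow> (t \<cdot> r, s \<cdot> r) \<in> graph_crible C g" by (rule clE) blast
      have W': "W' = W" using t'(2) s(2) by (simp add: Hom_def)
      show "(f \<cdot> s, g \<cdot> s) \<in> cl X Y S"
      proof (rule clI[OF Comp_in_Hom[OF s(2) f] Comp_in_Hom[OF s(2) g] t'(3)[unfolded W']])
        fix r V' assume r: "r \<in> T'" "r \<in> Hom C V' W"
        have "t \<cdot> r = (g \<cdot> s) \<cdot> r"
          using ts[OF r(1)] mem_graph_crible[OF g] Comp_assoc[OF r(2) s(2) g] by simp
        then show "((f \<cdot> s) \<cdot> r, (g \<cdot> s) \<cdot> r) \<in> S"
          using crible_Comp[OF S(2) t(1) Comp_in_Hom[OF s(2) f] r(2)] by simp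
      qed
    qed
    then show "(f, g) \<in> S" using S(3) by simp
  qed
  then show "q \<preceq>\<^bsub>K\<^esub> u" using R(1) S(1) by simp
qed

end

section \<open>Transfer along equivalences\<close>

text \<open>An equivalence seen from one side, so that properties are pulled back from
  \<open>R\<close> along a single functor. Order reflection includes faithfulness.\<close>

locale sup_equivalence = sup_functor Q R FO FA
  for Q :: "('o, 'a, 'm) quantaloid_scheme" and R :: "('p, 'b, 'n) quantaloid_scheme"
    and FO :: "'o \<Rightarrow> 'p" and FA :: "'a \<Rightarrow> 'b" +
  assumes full: "X \<in> Ob Q \<Longrightarrow> Y \<in> Ob Q \<Longrightarrow> k \<in> Hom R (FO X) (FO Y) \<Longrightarrow> \<exists>f\<in>Hom Q X Y. FA f = k"
    and reflect: "f \<in> Hom Q X Y \<Longrightarrow> g \<in> Hom Q X Y \<Longrightarrow> FA f \<preceq>\<^bsub>R\<^esub> FA g \<Longrightarrow> f \<preceq>\<^bsub>Q\<^esub> g"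
    and essentially_surjective: "U \<in> Ob R \<Longrightarrow> \<exists>V\<in>Ob Q. \<exists>e. iso_arrow R (FO V) U e"
begin

lemma FA_inj: "f \<in> Hom Q X Y \<Longrightarrow> g \<in> Hom Q X Y \<Longrightarrow> FA f = FA g \<Longrightarrow> f = g"
  using reflect[of f X Y g] reflect[of g X Y f] cod.Leq_refl[OF Hom_map[of f X Y]]
    dom.Leq_antisym[of f X Y g] by simp

lemma Meet_map:
  assumes f: "f \<in> Hom Q X Y" and g: "g \<in> Hom Q X Y"
  shows "FA (dom.Meet X Y f g) = cod.Meet (FO X) (FO Y) (FA f) (FA g)"
proof -
  have ob: "X \<in> Ob Q" "Y \<in> Ob Q" using f dom.Hom_objects by blast+
  have M: "dom.Meet X Y f g \<in> Hom Q X Y" using ob f g by (rule dom.Meet_in_Hom)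
  show ?thesis
  proof (rule cod.Meet_eqI[symmetric])
    show "FA (dom.Meet X Y f g) \<preceq>\<^bsub>R\<^esub> FA f" "FA (dom.Meet X Y f g) \<preceq>\<^bsub>R\<^esub> FA g"
      using Leq_map[OF dom.Meet_left[OF ob f g] M f] Leq_map[OF dom.Meet_right[OF ob f g] M g] .
    fix u assume u: "u \<in> Hom R (FO X) (FO Y)" "u \<preceq>\<^bsub>R\<^esub> FA f" "u \<preceq>\<^bsub>R\<^esub> FA g"
    obtain v where v: "v \<in> Hom Q X Y" "FA v = u" using full[OF ob u(1)] by blast
    have "v \<preceq>\<^bsub>Q\<^esub> dom.Meet X Y f g"
      using u v reflect[OF v(1) f] reflect[OF v(1) g] by (intro dom.Meet_greatest[OF ob f g v(1)]) auto
    then show "u \<preceq>\<^bsub>R\<^esub> FA (dom.Meet X Y f g)" using Leq_map v M by blast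
  qed (use f g M Hom_map in auto)
qed

lemma locally_localic_reflect:
  assumes "locally_localic R"
  shows "locally_localic Q"
proof (rule dom.locally_localicI)
  fix X Y f A u assume f: "f \<in> Hom Q X Y" and A: "A \<subseteq> Hom Q X Y" and u: "u \<in> Hom Q X Y"
    and le: "\<And>a. a \<in> A \<Longrightarrow> dom.Meet X Y f a \<preceq>\<^bsub>Q\<^esub> u"
  have ob: "X \<in> Ob Q" "Y \<in> Ob Q" using f dom.Hom_objects by blast+
  have J: "dom.Join X Y A \<in> Hom Q X Y" using ob A by (rule dom.Join_in_Hom)
  have "cod.Meet (FO X) (FO Y) (FA f) (cod.Join (FO X) (FO Y) (FA ` A)) \<preceq>\<^bsub>R\<^esub> FA u"
  proof (rule cod.locally_localic_Meet_Join_le[OF assms Hom_map[OF f] _ Hom_map[OF u]])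
    show "FA ` A \<subseteq> Hom R (FO X) (FO Y)" using A Hom_map by blast
    fix b assume "b \<in> FA ` A"
    then obtain a where a: "a \<in> A" "b = FA a" by blast
    have aH: "a \<in> Hom Q X Y" using a A by blast
    show "cod.Meet (FO X) (FO Y) (FA f) b \<preceq>\<^bsub>R\<^esub> FA u"
      using Leq_map[OF le[OF a(1)] dom.Meet_in_Hom[OF ob f aH] u] Meet_map[OF f aH] a(2) by simp
  qed
  then show "dom.Meet X Y f (dom.Join X Y A) \<preceq>\<^bsub>Q\<^esub> u"
    using reflect[OF dom.Meet_in_Hom[OF ob f J] u] Meet_map[OF f J] Sup_map[OF ob A] by simp
qed

text \<open>Fullness lifts the right adjoint, and order reflection lifts the inequalities for unit
  and counit.\<close>

lemma Map_reflect:
  assumes f: "f \<in> Hom Q X Y" and "FA f \<in> Hom (Map R) (FO X) (FO Y)"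
  shows "f \<in> Hom (Map Q) X Y"
proof -
  have ob: "X \<in> Ob Q" "Y \<in> Ob Q" using f dom.Hom_objects by blast+
  obtain g where g: "g \<in> Hom Q Y X" "FA g = radj R (FA f)"
    using full[OF ob(2,1) cod.Map_radj[OF assms(2)]] by blast
  have "Ident Q X \<preceq>\<^bsub>Q\<^esub> g \<cdot>\<^bsub>Q\<^esub> f"
    using reflect[OF dom.Ident_in_Hom[OF ob(1)] dom.Comp_in_Hom[OF f g(1)]]
      cod.Map_unit[OF assms(2)] Ident_map[OF ob(1)] Comp_map[OF f g(1)] g(2) by simp
  moreover have "f \<cdot>\<^bsub>Q\<^esub> g \<preceq>\<^bsub>Q\<^esub> Ident Q Y"
    using reflect[OF dom.Comp_in_Hom[OF g(1) f] dom.Ident_in_Hom[OF ob(2)]]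
      cod.Map_counit[OF assms(2)] Ident_map[OF ob(2)] Comp_map[OF g(1) f] g(2) by simp
  ultimately show ?thesis using dom.Hom_MapI[OF f] dom.adjoint_iff[OF f] g(1) by blast
qed

text \<open>The apex \<open>U\<close> of a span in \<open>R\<close> may lie outside the image of
  \<open>FO\<close>. Essential surjectivity replaces it by an isomorphic object \<open>FO V\<close>;
  isomorphisms are left adjoints, so the legs composed with \<open>e\<close> are maps and lift to
  \<open>Q\<close>.\<close>

lemma weakly_tabular_reflect:
  assumes wt: "weakly_tabular R"
  shows "weakly_tabular Q"
proof (rule dom.weakly_tabularI)
  fix X Y q u assume q: "q \<in> Hom Q X Y" and u: "u \<in> Hom Q X Y"
    and le: "\<And>U f g. f \<in> Hom (Map Q) U Y \<Longrightarrow> g \<in> Hom (Map Q) U X \<Longrightarrow>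
      f \<preceq>\<^bsub>Q\<^esub> q \<cdot>\<^bsub>Q\<^esub> g \<Longrightarrow> f \<preceq>\<^bsub>Q\<^esub> u \<cdot>\<^bsub>Q\<^esub> g"
  have ob: "X \<in> Ob Q" "Y \<in> Ob Q" using q dom.Hom_objects by blast+
  note FH = Hom_map[OF q] Hom_map[OF u]
  have "FA q \<preceq>\<^bsub>R\<^esub> FA u"
  proof (rule cod.weakly_tabular_Leq[OF wt FH])
    fix U f g assume f: "f \<in> Hom (Map R) U (FO Y)" and g: "g \<in> Hom (Map R) U (FO X)"
      and fg: "f \<preceq>\<^bsub>R\<^esub> FA q \<cdot>\<^bsub>R\<^esub> g"
    note H = f[THEN cod.Map_Hom] g[THEN cod.Map_Hom]
    have U: "U \<in> Ob R" using H cod.Hom_objects by blast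
    obtain V e where V: "V \<in> Ob Q" and "iso_arrow R (FO V) U e"
      using essentially_surjective[OF U] by blast
    then obtain e' where e: "e \<in> Hom R (FO V) U" and e': "e' \<in> Hom R U (FO V)"
      and inv: "e' \<cdot>\<^bsub>R\<^esub> e = Ident R (FO V)" "e \<cdot>\<^bsub>R\<^esub> e' = Ident R U"
      by (auto simp: iso_arrow_def)
    have "adjoint R e e'"
      using cod.adjoint_iff[OF e] e' inv cod.Leq_refl[OF cod.Ident_in_Hom[OF U]]
        cod.Leq_refl[OF cod.Ident_in_Hom[OF Ob_map[OF V]]] by simp
    then have eM: "e \<in> Hom (Map R) (FO V) U" using cod.Hom_MapI[OF e] by blast
    have fe: "f \<cdot>\<^bsub>R\<^esub> e \<in> Hom (Map R) (FO V) (FO Y)" and ge: "g \<cdot>\<^bsub>R\<^esub> e \<in> Hom (Map R) (FO V) (FO X)"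
      using cod.Map_Comp[OF eM] f g by blast+
    obtain a where a: "a \<in> Hom Q V Y" "FA a = f \<cdot>\<^bsub>R\<^esub> e"
      using full[OF V ob(2) cod.Map_Hom[OF fe]] by blast
    obtain b where b: "b \<in> Hom Q V X" "FA b = g \<cdot>\<^bsub>R\<^esub> e"
      using full[OF V ob(1) cod.Map_Hom[OF ge]] by blast
    have M: "a \<in> Hom (Map Q) V Y" "b \<in> Hom (Map Q) V X"
      using Map_reflect a b fe ge by simp_all
    have "f \<cdot>\<^bsub>R\<^esub> e \<preceq>\<^bsub>R\<^esub> (FA q \<cdot>\<^bsub>R\<^esub> g) \<cdot>\<^bsub>R\<^esub> e"
      using cod.Comp_mono_left[OF fg H(1) cod.Comp_in_Hom[OF H(2) FH(1)] e] .
    then have "FA a \<preceq>\<^bsub>R\<^esub> FA (q \<cdot>\<^bsub>Q\<^esub> b)"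
      using a(2) b(2) Comp_map[OF b(1) q] cod.Comp_assoc[OF e H(2) FH(1)] by simp
    then have "a \<preceq>\<^bsub>Q\<^esub> u \<cdot>\<^bsub>Q\<^esub> b"
      using le[OF M] reflect[OF a(1) dom.Comp_in_Hom[OF b(1) q]] by blast
    then have "f \<cdot>\<^bsub>R\<^esub> e \<preceq>\<^bsub>R\<^esub> (FA u \<cdot>\<^bsub>R\<^esub> g) \<cdot>\<^bsub>R\<^esub> e"
      using Leq_map[OF _ a(1) dom.Comp_in_Hom[OF b(1) u]] a(2) b(2) Comp_map[OF b(1) u]
        cod.Comp_assoc[OF e H(2) FH(2)] by simp
    moreover have ug: "FA u \<cdot>\<^bsub>R\<^esub> g \<in> Hom R U (FO Y)" using H FH cod.Comp_in_Hom by blast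
    ultimately have "(f \<cdot>\<^bsub>R\<^esub> e) \<cdot>\<^bsub>R\<^esub> e' \<preceq>\<^bsub>R\<^esub> ((FA u \<cdot>\<^bsub>R\<^esub> g) \<cdot>\<^bsub>R\<^esub> e) \<cdot>\<^bsub>R\<^esub> e'"
      using cod.Comp_mono_left[OF _ cod.Comp_in_Hom[OF e H(1)] cod.Comp_in_Hom[OF e ug] e'] by blast
    then show "f \<preceq>\<^bsub>R\<^esub> FA u \<cdot>\<^bsub>R\<^esub> g"
      using cod.Comp_assoc[OF e' e H(1)] cod.Comp_assoc[OF e' e ug] inv(2)
        cod.Comp_Ident_right[OF H(1)] cod.Comp_Ident_right[OF ug] by simp
  qed
  then show "q \<preceq>\<^bsub>Q\<^esub> u" using reflect q u by blast
qed

lemma modular_reflect: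
  assumes m: "modular R i"
  shows "\<exists>i'. modular Q i'"
proof -
  note inv = cod.modular_involution[OF m]
  note iH = cod.involution_in_Hom[OF inv]
  \<comment> \<open>\<open>FO\<close> may identify distinct objects, so a preimage under
    \<open>FA\<close> is sought in the hom prescribed by \<open>q\<close>; there it is unique by
    \<open>FA_inj\<close>.\<close>
  define i' where "i' q = (SOME p. p \<in> Hom Q (Cod Q q) (Dom Q q) \<and> FA p = i (FA q))" for q
  have i': "i' q \<in> Hom Q Y X" "FA (i' q) = i (FA q)" if q: "q \<in> Hom Q X Y" for q X Y
  proof -
    have "X \<in> Ob Q" "Y \<in> Ob Q" using q dom.Hom_objects by blast+
    then have "\<exists>p. p \<in> Hom Q Y X \<and> FA p = i (FA q)" using full iH[OF Hom_map[OF q]] by blast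
    then have "i' q \<in> Hom Q Y X \<and> FA (i' q) = i (FA q)"
      unfolding i'_def using Hom_Dom_Cod[OF q] by (auto intro: someI2)
    then show "i' q \<in> Hom Q Y X" "FA (i' q) = i (FA q)" by blast+
  qed
  have "involution Q i'"
  proof (rule dom.involutionI)
    show "i' f \<in> Hom Q Y X" if "f \<in> Hom Q X Y" for f X Y using i'[OF that] by blast
    show "i' (Ident Q X) = Ident Q X" if "X \<in> Ob Q" for X
      using FA_inj[OF i'(1)] dom.Ident_in_Hom[OF that] i'(2)[OF dom.Ident_in_Hom[OF that]]
        Ident_map[OF that] cod.involution_Ident[OF inv Ob_map[OF that]] by simp
    show "i' (g \<cdot>\<^bsub>Q\<^esub> f) = i' f \<cdot>\<^bsub>Q\<^esub> i' g" if f: "f \<in> Hom Q X Y" and g: "g \<in> Hom Q Y Z" for f g X Y Z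
    proof (rule FA_inj)
      show "FA (i' (g \<cdot>\<^bsub>Q\<^esub> f)) = FA (i' f \<cdot>\<^bsub>Q\<^esub> i' g)"
        using i'(2)[OF dom.Comp_in_Hom[OF f g]] Comp_map[OF f g] Comp_map[OF i'(1)[OF g] i'(1)[OF f]]
          cod.involution_Comp[OF inv Hom_map[OF f] Hom_map[OF g]] i'(2)[OF f] i'(2)[OF g] by simp
      show "i' (g \<cdot>\<^bsub>Q\<^esub> f) \<in> Hom Q Z X" using i'(1)[OF dom.Comp_in_Hom[OF f g]] .
      show "i' f \<cdot>\<^bsub>Q\<^esub> i' g \<in> Hom Q Z X" using dom.Comp_in_Hom[OF i'(1)[OF g] i'(1)[OF f]] .
    qed
    show "i' f \<preceq>\<^bsub>Q\<^esub> i' g" if f: "f \<in> Hom Q X Y" and g: "g \<in> Hom Q X Y" and le: "f \<preceq>\<^bsub>Q\<^esub> g" for f g X Y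
      using reflect[OF i'(1)[OF f] i'(1)[OF g]] i'(2)[OF f] i'(2)[OF g]
        cod.involution_mono[OF inv Leq_map[OF le f g] Hom_map[OF f] Hom_map[OF g]] by simp
    show "i' (i' f) = f" if f: "f \<in> Hom Q X Y" for f X Y
      using FA_inj[OF i'(1)[OF i'(1)[OF f]] f] i'(2)[OF i'(1)[OF f]] i'(2)[OF f]
        cod.involution_invol[OF inv Hom_map[OF f]] by simp
  qed
  moreover have "dom.Meet X Z (g \<cdot>\<^bsub>Q\<^esub> f) h \<preceq>\<^bsub>Q\<^esub> g \<cdot>\<^bsub>Q\<^esub> dom.Meet X Y f (i' g \<cdot>\<^bsub>Q\<^esub> h)"
    if f: "f \<in> Hom Q X Y" and g: "g \<in> Hom Q Y Z" and h: "h \<in> Hom Q X Z" for f g h X Y Z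
  proof -
    have ob: "X \<in> Ob Q" "Y \<in> Ob Q" "Z \<in> Ob Q" using f g dom.Hom_objects by blast+
    have gf: "g \<cdot>\<^bsub>Q\<^esub> f \<in> Hom Q X Z" and gh: "i' g \<cdot>\<^bsub>Q\<^esub> h \<in> Hom Q X Y"
      using f g h i'(1) dom.Comp_in_Hom by blast+
    have M: "dom.Meet X Y f (i' g \<cdot>\<^bsub>Q\<^esub> h) \<in> Hom Q X Y" using ob f gh by (intro dom.Meet_in_Hom)
    have "FA (dom.Meet X Z (g \<cdot>\<^bsub>Q\<^esub> f) h) \<preceq>\<^bsub>R\<^esub> FA (g \<cdot>\<^bsub>Q\<^esub> dom.Meet X Y f (i' g \<cdot>\<^bsub>Q\<^esub> h))"
      using cod.modular_law[OF m Hom_map[OF f] Hom_map[OF g] Hom_map[OF h]]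
        Meet_map[OF gf h] Comp_map[OF f g] Comp_map[OF M g] Meet_map[OF f gh]
        Comp_map[OF h i'(1)[OF g]] i'(2)[OF g] by simp
    then show ?thesis
      using reflect[OF dom.Meet_in_Hom[OF ob(1,3) gf h] dom.Comp_in_Hom[OF M g]] by blast
  qed
  ultimately show ?thesis unfolding modular_def by blast
qed

end

section \<open>From an equivalence to a full and order-reflecting functor\<close>

lemma naturally_isomorphic_idD:
  assumes "naturally_isomorphic C C FO FA id id"
  obtains \<eta> \<theta> where "\<And>X. X \<in> Ob C \<Longrightarrow> \<eta> X \<in> Hom C (FO X) X" and "\<And>X. X \<in> Ob C \<Longrightarrow> \<theta> X \<in> Hom C X (FO X)"
    and "\<And>X. X \<in> Ob C \<Longrightarrow> \<theta> X \<cdot>\<^bsub>C\<^esub> \<eta> X = Ident C (FO X)"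
    and "\<And>X. X \<in> Ob C \<Longrightarrow> \<eta> X \<cdot>\<^bsub>C\<^esub> \<theta> X = Ident C X"
    and "\<And>X Y f. f \<in> Hom C X Y \<Longrightarrow> \<eta> Y \<cdot>\<^bsub>C\<^esub> FA f = f \<cdot>\<^bsub>C\<^esub> \<eta> X"
proof -
  obtain \<eta> where \<eta>: "\<forall>X\<in>Ob C. iso_arrow C (FO X) X (\<eta> X)"
    "\<And>X Y f. f \<in> Hom C X Y \<Longrightarrow> \<eta> Y \<cdot>\<^bsub>C\<^esub> FA f = f \<cdot>\<^bsub>C\<^esub> \<eta> X"
    using assms unfolding naturally_isomorphic_def by auto
  from \<eta>(1) obtain \<theta> where "\<forall>X\<in>Ob C. \<theta> X \<in> Hom C X (FO X) \<and> \<theta> X \<cdot>\<^bsub>C\<^esub> \<eta> X = Ident C (FO X) \<and>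
      \<eta> X \<cdot>\<^bsub>C\<^esub> \<theta> X = Ident C X"
    unfolding iso_arrow_def by metis
  then show thesis using \<eta> that[of \<eta> \<theta>] by (auto simp: iso_arrow_def)
qed

text \<open>By naturality \<open>f\<close> is the conjugate of \<open>GA (FA f)\<close> by the
  invertible \<open>\<eta>\<close>, and both \<open>GA\<close> and composition are monotone.\<close>

lemma equivalence_reflects_Leq:
  assumes "sup_functor Q R FO FA" and "sup_functor R Q GO GA"
    and "naturally_isomorphic Q Q (GO \<circ> FO) (GA \<circ> FA) id id"
    and f: "f \<in> Hom Q X Y" and g: "g \<in> Hom Q X Y" and le: "FA f \<preceq>\<^bsub>R\<^esub> FA g"
  shows "f \<preceq>\<^bsub>Q\<^esub> g"
proof -
  interpret F: sup_functor Q R FO FA by fact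
  interpret G: sup_functor R Q GO GA by fact
  have ob: "X \<in> Ob Q" "Y \<in> Ob Q" using f F.dom.Hom_objects by blast+
  from assms(3) obtain \<eta> \<theta> where \<eta>: "\<And>X. X \<in> Ob Q \<Longrightarrow> \<eta> X \<in> Hom Q (GO (FO X)) X"
    and \<theta>: "\<And>X. X \<in> Ob Q \<Longrightarrow> \<theta> X \<in> Hom Q X (GO (FO X))"
    and \<eta>\<theta>: "\<And>X. X \<in> Ob Q \<Longrightarrow> \<eta> X \<cdot>\<^bsub>Q\<^esub> \<theta> X = Ident Q X"
    and nat: "\<And>X Y f. f \<in> Hom Q X Y \<Longrightarrow> \<eta> Y \<cdot>\<^bsub>Q\<^esub> GA (FA f) = f \<cdot>\<^bsub>Q\<^esub> \<eta> X"
    by (rule naturally_isomorphic_idD) auto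
  note H = f[THEN F.Hom_map, THEN G.Hom_map] g[THEN F.Hom_map, THEN G.Hom_map]
  have "GA (FA f) \<preceq>\<^bsub>Q\<^esub> GA (FA g)" using G.Leq_map[OF le F.Hom_map[OF f] F.Hom_map[OF g]] .
  then have "\<eta> Y \<cdot>\<^bsub>Q\<^esub> GA (FA f) \<preceq>\<^bsub>Q\<^esub> \<eta> Y \<cdot>\<^bsub>Q\<^esub> GA (FA g)"
    using F.dom.Comp_mono_right[OF _ H \<eta>[OF ob(2)]] by blast
  then have "f \<cdot>\<^bsub>Q\<^esub> \<eta> X \<preceq>\<^bsub>Q\<^esub> g \<cdot>\<^bsub>Q\<^esub> \<eta> X" using nat[OF f] nat[OF g] by simp
  then have "(f \<cdot>\<^bsub>Q\<^esub> \<eta> X) \<cdot>\<^bsub>Q\<^esub> \<theta> X \<preceq>\<^bsub>Q\<^esub> (g \<cdot>\<^bsub>Q\<^esub> \<eta> X) \<cdot>\<^bsub>Q\<^esub> \<theta> X"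
    using F.dom.Comp_mono_left[OF _ F.dom.Comp_in_Hom[OF \<eta>[OF ob(1)] f]
        F.dom.Comp_in_Hom[OF \<eta>[OF ob(1)] g] \<theta>[OF ob(1)]] by blast
  then show ?thesis
    using F.dom.Comp_assoc[OF \<theta>[OF ob(1)] \<eta>[OF ob(1)] f] F.dom.Comp_assoc[OF \<theta>[OF ob(1)] \<eta>[OF ob(1)] g]
      \<eta>\<theta>[OF ob(1)] F.dom.Comp_Ident_right[OF f] F.dom.Comp_Ident_right[OF g] by simp
qed

lemma quantaloid_equivalent_imp_sup_equivalence:
  assumes "quantaloid_equivalent Q R"
  shows "\<exists>FO FA. sup_equivalence Q R FO FA"
proof -
  obtain FO FA GO GA where F: "sup_functor Q R FO FA" and G: "sup_functor R Q GO GA"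
    and GF: "naturally_isomorphic Q Q (GO \<circ> FO) (GA \<circ> FA) id id"
    and FG: "naturally_isomorphic R R (FO \<circ> GO) (FA \<circ> GA) id id"
    using assms unfolding quantaloid_equivalent_def by blast
  interpret F: sup_functor Q R FO FA by (rule F)
  interpret G: sup_functor R Q GO GA by (rule G)
  from GF obtain \<eta> \<theta> where \<eta>: "\<And>X. X \<in> Ob Q \<Longrightarrow> \<eta> X \<in> Hom Q (GO (FO X)) X"
    and \<theta>: "\<And>X. X \<in> Ob Q \<Longrightarrow> \<theta> X \<in> Hom Q X (GO (FO X))"
    and \<theta>\<eta>: "\<And>X. X \<in> Ob Q \<Longrightarrow> \<theta> X \<cdot>\<^bsub>Q\<^esub> \<eta> X = Ident Q (GO (FO X))"
    and nat: "\<And>X Y f. f \<in> Hom Q X Y \<Longrightarrow> \<eta> Y \<cdot>\<^bsub>Q\<^esub> GA (FA f) = f \<cdot>\<^bsub>Q\<^esub> \<eta> X"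
    by (rule naturally_isomorphic_idD) auto
  have "sup_equivalence Q R FO FA"
  proof (intro sup_equivalence.intro sup_equivalence_axioms.intro F)
    show "f \<preceq>\<^bsub>Q\<^esub> g" if "f \<in> Hom Q X Y" "g \<in> Hom Q X Y" "FA f \<preceq>\<^bsub>R\<^esub> FA g" for f g X Y
      using equivalence_reflects_Leq[OF F G GF that] .
    show "\<exists>V\<in>Ob Q. \<exists>e. iso_arrow R (FO V) U e" if "U \<in> Ob R" for U
      using FG that G.Ob_map[OF that] unfolding naturally_isomorphic_def by auto
    fix X Y k assume ob: "X \<in> Ob Q" "Y \<in> Ob Q" and k: "k \<in> Hom R (FO X) (FO Y)"
    note Gk = G.Hom_map[OF k]
    \<comment> \<open>The only possible preimage of \<open>k\<close>: naturality of
      \<open>\<eta>\<close> determines \<open>f\<close> from \<open>GA k\<close>.\<close>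
    define f where "f = (\<eta> Y \<cdot>\<^bsub>Q\<^esub> GA k) \<cdot>\<^bsub>Q\<^esub> \<theta> X"
    have \<eta>k: "\<eta> Y \<cdot>\<^bsub>Q\<^esub> GA k \<in> Hom Q (GO (FO X)) Y" using Gk \<eta>[OF ob(2)] F.dom.Comp_in_Hom by blast
    have f: "f \<in> Hom Q X Y" unfolding f_def using \<eta>k \<theta>[OF ob(1)] F.dom.Comp_in_Hom by blast
    note Ff = F.Hom_map[OF f]
    note GFf = G.Hom_map[OF Ff]
    have "f \<cdot>\<^bsub>Q\<^esub> \<eta> X = \<eta> Y \<cdot>\<^bsub>Q\<^esub> GA k"
      unfolding f_def
      using F.dom.Comp_assoc[OF \<eta>[OF ob(1)] \<theta>[OF ob(1)] \<eta>k] \<theta>\<eta>[OF ob(1)] F.dom.Comp_Ident_right[OF \<eta>k]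
      by simp
    then have "\<theta> Y \<cdot>\<^bsub>Q\<^esub> (\<eta> Y \<cdot>\<^bsub>Q\<^esub> GA (FA f)) = \<theta> Y \<cdot>\<^bsub>Q\<^esub> (\<eta> Y \<cdot>\<^bsub>Q\<^esub> GA k)"
      using nat[OF f] by simp
    then have eq: "GA (FA f) = GA k"
      using F.dom.Comp_assoc[OF GFf \<eta>[OF ob(2)] \<theta>[OF ob(2)]] F.dom.Comp_assoc[OF Gk \<eta>[OF ob(2)] \<theta>[OF ob(2)]]
        \<theta>\<eta>[OF ob(2)] F.dom.Comp_Ident_left[OF GFf] F.dom.Comp_Ident_left[OF Gk] by simp
    \<comment> \<open>\<open>GA\<close> is injective on this hom because the other natural
      isomorphism makes it reflect the order as well.\<close>
    have "FA f \<preceq>\<^bsub>R\<^esub> k" "k \<preceq>\<^bsub>R\<^esub> FA f"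
      using equivalence_reflects_Leq[OF G F FG Ff k] equivalence_reflects_Leq[OF G F FG k Ff]
        F.dom.Leq_refl[OF Gk] unfolding eq by blast+
    then show "\<exists>f\<in>Hom Q X Y. FA f = k" using f F.cod.Leq_antisym[OF Ff k] by blast
  qed
  then show ?thesis by blast
qed

text \<open>Only properties checked directly on closed cribles are transferred; map-discreteness and
  weak modularity then follow in \<open>Q\<close> itself from its involution.\<close>

lemma quantaloid_of_closed_cribles_imp:
  fixes Q :: "('o, 'a, 'm) quantaloid_scheme"
  assumes "quantaloid_of_closed_cribles TYPE('c) TYPE('b) Q"
  shows "locally_localic Q \<and> weakly_tabular Q \<and> (\<exists>i. modular Q i)"
proof -
  obtain C :: "('c, 'b) category" and J where "site C J" and eq: "quantaloid_equivalent Q (closed_cribles C J)"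
    using assms unfolding quantaloid_of_closed_cribles_def by blast
  obtain FO FA where "sup_equivalence Q (closed_cribles C J) FO FA"
    using quantaloid_equivalent_imp_sup_equivalence[OF eq] by blast
  interpret sup_equivalence Q "closed_cribles C J" FO FA by fact
  interpret S: site C J by fact
  interpret closed_crible_quantaloid C J by unfold_locales
  show ?thesis
    using locally_localic_reflect[OF locally_localic_K] weakly_tabular_reflect[OF weakly_tabular_K]
      modular_reflect[OF modular_conv] by blast
qed

text \<open>Representability appears twice. With the types of \<open>Q\<close> itself it closes the
  circle, as \<open>Map Q\<close> provides a site on these types. With arbitrary types
  \<open>'c\<close> and \<open>'b\<close> it still implies the elementary conditions, so a
  representation over any types yields one over those of \<open>Q\<close>.\<close>

theorem theorem4p3:
  fixes Q :: "('o, 'a) quantaloid"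
  assumes "quantaloid Q"
  shows
    "((locally_localic Q \<and> map_discrete Q \<and> weakly_tabular Q \<and> weakly_modular Q)
        \<longleftrightarrow>
      (sup_functor (cribles (Map Q)) Q id (crible_join Q) \<and>
       full_functor (cribles (Map Q)) Q id (crible_join Q) \<and>
       locally_left_exact (cribles (Map Q)) Q id (crible_join Q)))
     \<and>
     ((sup_functor (cribles (Map Q)) Q id (crible_join Q) \<and>
       full_functor (cribles (Map Q)) Q id (crible_join Q) \<and>
       locally_left_exact (cribles (Map Q)) Q id (crible_join Q))
        \<longleftrightarrow>
      (site (Map Q) (map_topology Q) \<and>
       quantaloid_isomorphic Q (closed_cribles (Map Q) (map_topology Q))))
     \<and>
     ((site (Map Q) (map_topology Q) \<and>
       quantaloid_isomorphic Q (closed_cribles (Map Q) (map_topology Q)))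
        \<longleftrightarrow>
      quantaloid_of_closed_cribles TYPE('o) TYPE('a) Q)
     \<and>
     (quantaloid_of_closed_cribles TYPE('c) TYPE('b) Q
        \<longrightarrow>
      locally_localic Q \<and> map_discrete Q \<and> weakly_tabular Q \<and> weakly_modular Q)
     \<and>
     (locally_localic Q \<and> map_discrete Q \<and> weakly_tabular Q \<and> weakly_modular Q
        \<longrightarrow>
      involution Q (span_converse Q) \<and> modular Q (span_converse Q))"
proof -
  interpret quantaloid Q by fact
  let ?C1 = "locally_localic Q \<and> map_discrete Q \<and> weakly_tabular Q \<and> weakly_modular Q"
  let ?C2 = "sup_functor (cribles (Map Q)) Q id (crible_join Q) \<and>
    full_functor (cribles (Map Q)) Q id (crible_join Q) \<and>
    locally_left_exact (cribles (Map Q)) Q id (crible_join Q)"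
  let ?C3 = "site (Map Q) (map_topology Q) \<and>
    quantaloid_isomorphic Q (closed_cribles (Map Q) (map_topology Q))"
  have 12: ?C2 if ?C1
    using that sup_functor_crible_join full_crible_join_iff locally_left_exact_crible_join by blast
  have 23: ?C3 if ?C2
    using that site_map_topology quantaloid_isomorphic_closed_cribles by blast
  have 34: "quantaloid_of_closed_cribles TYPE('o) TYPE('a) Q" if ?C3
    using that assms quantaloid_isomorphic_imp_equivalent unfolding quantaloid_of_closed_cribles_def by blast
  have 41: ?C1 if "quantaloid_of_closed_cribles TYPE('o) TYPE('a) Q"
    using quantaloid_of_closed_cribles_imp[OF that] modular_imp_map_discrete modular_imp_weakly_modular
    by blast
  have 51: ?C1 if "quantaloid_of_closed_cribles TYPE('c) TYPE('b) Q"
    using quantaloid_of_closed_cribles_imp[OF that] modular_imp_map_discrete modular_imp_weakly_modular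
    by blast
  have "involution Q (span_converse Q) \<and> modular Q (span_converse Q)" if ?C1
  proof -
    \<comment> \<open>The involution has to exist before it can be identified: it comes from the
      converse of cribles via the representation, and \<open>span_converse_eq\<close> then gives the
      formula.\<close>
    have "quantaloid_of_closed_cribles TYPE('o) TYPE('a) Q" using that 12 23 34 by blast
    then obtain i where i: "modular Q i" using quantaloid_of_closed_cribles_imp by blast
    have "modular Q (span_converse Q)"
      using modular_cong[OF i] span_converse_eq[OF i] that by blast
    then show ?thesis using modular_involution by blast
  qed
  then show ?thesis using 12 23 34 41 51 by blast
qed

end
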